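(* (1) Let $Q$ be the square grid, i.e. the Cayley graph of $\mathbb{Z}^2$ with respect to its standard generators $(\pm 1,0),(0,\pm 1)$. There is a random pair $(R_1,R_2)$ of spanning double rays of $Q$ such that almost surely every edge of $Q$ lies in exactly one of $R_1,R_2$, and such that the (joint) distribution of $(R_1,R_2)$ is invariant under the action of $\mathbb{Z}^2$ on $Q$ by translations. (2) Moreover, if $\Gamma$ is an infinite Abelian group and $G$ is a connected locally finite Cayley graph of $\Gamma$, then $G$ admits a $\Gamma$-invariant random spanning double ray.
   Context: A spanning double ray of a graph $G$ is a connected subgraph of $G$ containing all vertices of $G$ in which every vertex has exactly two neighbours; on an infinite graph it is a two-way infinite path through all vertices. For a group $\Gamma$ and a symmetric set $S\subseteq\Gamma$ not containing the identity, the Cayley graph $\mathrm{Cay}(\Gamma,S)$ has vertex set $\Gamma$ and an edge between $g$ and $gs$ for all $g\in\Gamma$, $s\in S$. It is connected and locally finite iff $S$ is a finite generating set. $\Gamma$ acts on it by left multiplication. Spanning subgraphs of $G$ are identified with elements of $2^{E(G)}$, equipped with the $\sigma$-algebra generated by cylinder sets (events depending on finitely many edges). A random spanning double ray of $G$ is a random element of $2^{E(G)}$ that is almost surely the edge set of a spanning double ray of $G$. It is $\Gamma$-invariant if its distribution is invariant under the action of $\Gamma$ on $2^{E(G)}$ induced by the action of $\Gamma$ on $G$; invariance of the distribution of a pair of random subgraphs is understood with respect to the diagonal action. *)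

theory Defs
  imports "HOL-Algebra.Elementary_Groups" "HOL-Probability.Probability"
begin

text \<open>Simple undirected graphs; an edge is the set of its two end vertices.\<close>

record 'v graph =
  verts :: "'v set"
  edges :: "'v set set"

definition neighbours :: "'v graph \<Rightarrow> 'v \<Rightarrow> 'v set" where
  "neighbours H v = {u. {v, u} \<in> edges H}"

definition graph_connected :: "'v graph \<Rightarrow> bool" where
  "graph_connected H \<longleftrightarrow>
     (\<forall>u\<in>verts H. \<forall>v\<in>verts H. (u, v) \<in> {(x, y). {x, y} \<in> edges H}\<^sup>*)"

definition locally_finite :: "'v graph \<Rightarrow> bool" where
  "locally_finite H \<longleftrightarrow> (\<forall>v\<in>verts H. finite (neighbours H v))"

definition spanning_double_ray :: "'v graph \<Rightarrow> 'v graph \<Rightarrow> bool" where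
  "spanning_double_ray G H \<longleftrightarrow>
     verts H = verts G \<and> edges H \<subseteq> edges G \<and> graph_connected H \<and>
     (\<forall>v\<in>verts H. card (neighbours H v) = 2)"

definition spanning_subgraph :: "'v graph \<Rightarrow> 'v set set \<Rightarrow> 'v graph" where
  "spanning_subgraph G F = \<lparr>verts = verts G, edges = F\<rparr>"

definition cayley_graph :: "('g, 'r) monoid_scheme \<Rightarrow> 'g set \<Rightarrow> 'g graph" where
  "cayley_graph \<Gamma> S =
     \<lparr>verts = carrier \<Gamma>, edges = {{g, g \<otimes>\<^bsub>\<Gamma>\<^esub> s} | g s. g \<in> carrier \<Gamma> \<and> s \<in> S}\<rparr>"

definition Z2 :: "(int \<times> int) monoid" where
  "Z2 = integer_group \<times>\<times> integer_group"

definition square_grid :: "(int \<times> int) graph" where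
  "square_grid = cayley_graph Z2 {(1, 0), (-1, 0), (0, 1), (0, -1)}"

definition cylinder_sets :: "'v graph \<Rightarrow> 'v set set set set" where
  "cylinder_sets G = {A. A \<subseteq> Pow (edges G) \<and>
     (\<exists>D. finite D \<and> D \<subseteq> edges G \<and>
        (\<forall>F\<in>Pow (edges G). \<forall>F'\<in>Pow (edges G). F \<inter> D = F' \<inter> D \<longrightarrow> (F \<in> A \<longleftrightarrow> F' \<in> A)))}"

text \<open>The measurable space of spanning subgraphs, encoded as edge sets. Only the space and the
  \<open>\<sigma>\<close>-algebra of this measure are used.\<close>

definition edge_space :: "'v graph \<Rightarrow> 'v set set measure" where
  "edge_space G = sigma (Pow (edges G)) (cylinder_sets G)"

definition translate :: "('g, 'r) monoid_scheme \<Rightarrow> 'g \<Rightarrow> 'g set set \<Rightarrow> 'g set set" where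
  "translate \<Gamma> g F = (\<lambda>e. (\<lambda>x. g \<otimes>\<^bsub>\<Gamma>\<^esub> x) ` e) ` F"

definition translate_pair ::
    "('g, 'r) monoid_scheme \<Rightarrow> 'g \<Rightarrow> 'g set set \<times> 'g set set \<Rightarrow> 'g set set \<times> 'g set set" where
  "translate_pair \<Gamma> g = map_prod (translate \<Gamma> g) (translate \<Gamma> g)"

text \<open>Measurability is required explicitly because \<^term>\<open>distr\<close> carries no information for
  non-measurable maps.\<close>

definition invariant_measure ::
    "('g, 'r) monoid_scheme \<Rightarrow> ('g \<Rightarrow> 'x \<Rightarrow> 'x) \<Rightarrow> 'x measure \<Rightarrow> bool" where
  "invariant_measure \<Gamma> act \<mu> \<longleftrightarrow>
     (\<forall>g\<in>carrier \<Gamma>. act g \<in> \<mu> \<rightarrow>\<^sub>M \<mu> \<and> distr \<mu> \<mu> (act g) = \<mu>)"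

definition random_spanning_double_ray ::
    "'v graph \<Rightarrow> 'w measure \<Rightarrow> ('w \<Rightarrow> 'v set set) \<Rightarrow> bool" where
  "random_spanning_double_ray G M R \<longleftrightarrow>
     prob_space M \<and> R \<in> M \<rightarrow>\<^sub>M edge_space G \<and>
     (AE \<omega> in M. spanning_double_ray G (spanning_subgraph G (R \<omega>)))"

end

theory Submission imports Defs begin

text \<open>Both random objects are factors of an odometer: all residues of a random shift modulo
  \<open>2 \<cdot> 3\<^sup>k\<close> are uniform and compatible, stage \<open>k\<close> of the construction depends on the \<open>k\<close>-th residue in a
  translation-equivariant way (so its law is exactly invariant), and the stages converge on every
  edge. A subgraph that is connected and 2-regular is already a double ray, so no acyclicity has to
  be checked.

  For an Abelian group, the generators give a spanning subgraph \<open>\<int>\<^sup>d \<times> path\<close> with \<open>d > 0\<close>, on which a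
  finite index subgroup acts by shifts of \<open>\<int>\<^sup>d\<close>; there we use a Peano curve, in the form of nested
  boxes with side lengths powers of 3. For the square grid, one starts with the rows and the columns,
  and merges three neighbouring rays of each colour at a time by swapping colours along
  squares placed at 3-adically chosen positions.\<close>

section \<open>Random inverse sequences and cylinder events\<close>

text \<open>Both constructions are hierarchical: blocks are merged three at a time, and the random
  shift gives the hierarchy a position that is uniform at every scale. That 3 is odd shapes both. An
  odd multiple of \<open>3 * n\<close> is an odd multiple of \<open>n\<close>, so the even and odd
  labels of walls persist from scale to scale, and three paths running between an even and an odd
  corner merge into one path of the same kind; the factor 2 in the moduli \<open>2 * 3 ^ k\<close>
  records these labels. In the square grid, oddness ensures that a merged segment has exactly one
  end at the boundary to the next strip, where a mark links it to its neighbour. "Almost surely" is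
  used for one purpose: a block boundary that stayed in place at all scales could not be passed.
  This requires a fixed integer plus the random residues to be divisible by all powers of 3, which
  has probability 0. Otherwise adjacent vertices share a block at some stage, whence connectedness.
  An Abelian group acts on its grid only up to a change of the base point of the grid, so the base
  point is randomised as well.\<close>

text \<open>The final \<open>\<sigma>\<close>-algebra of the completed measure is used so that every almost sure
  property of \<open>f\<close> becomes measurable on the target.\<close>

lemma push_forward_final:
  fixes M :: "'a measure" and f :: "'a \<Rightarrow> 'b"
  assumes "prob_space M"
  obtains N :: "'b measure" where "prob_space N"
    "\<And>P. AE \<omega> in M. P (f \<omega>) \<Longrightarrow> AE y in N. P y"
    "\<And>h K. (\<lambda>\<omega>. h (f \<omega>)) \<in> M \<rightarrow>\<^sub>M K \<Longrightarrow> h \<in> N \<rightarrow>\<^sub>M K"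
    "\<And>h K. (\<lambda>\<omega>. h (f \<omega>)) \<in> M \<rightarrow>\<^sub>M K \<Longrightarrow> distr N K h = distr M K (\<lambda>\<omega>. h (f \<omega>))"
proof -
  interpret prob_space M by fact
  let ?C = "completion M"
  interpret C: prob_space ?C by (rule prob_space_completion)
  define Y where "Y = f ` space M"
  define \<A> where "\<A> = {A. A \<subseteq> Y \<and> f -` A \<inter> space M \<in> sets ?C}"
  have sa: "sigma_algebra Y \<A>"
    unfolding sigma_algebra_iff2
  proof (intro conjI ballI allI impI)
    show "\<A> \<subseteq> Pow Y" "{} \<in> \<A>" by (auto simp: \<A>_def)
  next
    fix s assume s: "s \<in> \<A>"
    have "f -` (Y - s) \<inter> space M = space ?C - (f -` s \<inter> space M)"
      by (auto simp: Y_def)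
    with s show "Y - s \<in> \<A>" by (auto simp: \<A>_def)
  next
    fix A :: "nat \<Rightarrow> 'b set" assume A: "range A \<subseteq> \<A>"
    have "f -` (\<Union>i. A i) \<inter> space M = (\<Union>i. f -` A i \<inter> space M)" by auto
    moreover have "(\<Union>i. f -` A i \<inter> space M) \<in> sets ?C"
      using A by (intro sets.countable_UN) (auto simp: \<A>_def)
    moreover have "(\<Union>i. A i) \<subseteq> Y" using A by (auto simp: \<A>_def)
    ultimately show "(\<Union>i. A i) \<in> \<A>"
      by (simp add: \<A>_def)
  qed
  define N0 where "N0 = sigma Y \<A>"
  have sub: "\<A> \<subseteq> Pow Y" by (auto simp: \<A>_def)
  have spN0: "space N0 = Y" using sub by (simp add: N0_def)
  have stN0: "sets N0 = \<A>" using sub sa by (simp add: N0_def sigma_algebra.sigma_sets_eq)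
  have f: "f \<in> ?C \<rightarrow>\<^sub>M N0"
    unfolding N0_def by (rule measurable_measure_of[OF sub]) (auto simp: Y_def \<A>_def)
  define N where "N = distr ?C N0 f"
  have spN: "space N = Y" and stN: "sets N = \<A>" by (simp_all add: N_def spN0 stN0)
  have hK: "h \<in> N \<rightarrow>\<^sub>M K" if h: "(\<lambda>\<omega>. h (f \<omega>)) \<in> M \<rightarrow>\<^sub>M K" for h :: "'b \<Rightarrow> 'z" and K
  proof (rule measurableI)
    fix x assume "x \<in> space N"
    then show "h x \<in> space K" using measurable_space[OF h] by (auto simp: spN Y_def)
  next
    fix A assume A: "A \<in> sets K"
    have "f -` (h -` A \<inter> Y) \<inter> space M = (\<lambda>\<omega>. h (f \<omega>)) -` A \<inter> space M"
      by (auto simp: Y_def)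
    also have "\<dots> \<in> sets ?C" using measurable_sets[OF h A] by (rule sets_completionI_sets)
    finally show "h -` A \<inter> space N \<in> sets N" by (auto simp: spN stN \<A>_def)
  qed
  show thesis
  proof (rule that)
    show "prob_space N" unfolding N_def by (rule C.prob_space_distr[OF f])
    show "AE y in N. P y" if P: "AE \<omega> in M. P (f \<omega>)" for P
    proof -
      have "{\<omega>\<in>space ?C. \<not> P (f \<omega>)} \<in> sets ?C"
        using sets_completion_AE[where M = M and P = "\<lambda>\<omega>. \<not> P (f \<omega>)"] P by (auto simp: pred_def)
      from sets.compl_sets[OF this] have "{\<omega>\<in>space ?C. P (f \<omega>)} \<in> sets ?C"
        by (rule back_subst[where P = "\<lambda>A. A \<in> sets ?C"]) auto
      moreover have "f -` {y\<in>Y. P y} \<inter> space M = {\<omega>\<in>space ?C. P (f \<omega>)}"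
        by (auto simp: Y_def)
      ultimately have "{y \<in> space N0. P y} \<in> sets N0"
        by (simp add: stN0 \<A>_def spN0)
      then show ?thesis unfolding N_def using AE_completion[OF P]
        by (subst AE_distr_iff[OF f]) auto
    qed
    show "h \<in> N \<rightarrow>\<^sub>M K" if "(\<lambda>\<omega>. h (f \<omega>)) \<in> M \<rightarrow>\<^sub>M K" for h K
      using that by (rule hK)
    show "distr N K h = distr M K (\<lambda>\<omega>. h (f \<omega>))" if h: "(\<lambda>\<omega>. h (f \<omega>)) \<in> M \<rightarrow>\<^sub>M K" for h K
    proof -
      have "h \<in> N0 \<rightarrow>\<^sub>M K" using hK[OF h] by (simp add: N_def)
      then have "distr N K h = distr ?C K (\<lambda>\<omega>. h (f \<omega>))"
        unfolding N_def by (subst distr_distr[OF _ f]) (auto simp: comp_def)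
      also have "\<dots> = distr M K (\<lambda>\<omega>. h (f \<omega>))" by (rule distr_completion[OF h])
      finally show ?thesis .
    qed
  qed
qed

text \<open>The fibre over the \<open>p\<close>-th point is listed at the positions
  \<open>p * c\<close> to \<open>p * c + c - 1\<close>, so that \<open>\<rho>\<close> becomes
  division by \<open>c\<close> on indices.\<close>

lemma exists_lifted_enumeration:
  assumes e: "bij_betw e {..<N} B" and fin: "finite B'" and "\<rho> ` B' \<subseteq> B"
    and fib: "\<And>b. b \<in> B \<Longrightarrow> card {b' \<in> B'. \<rho> b' = b} = c" and "c > 0"
  shows "\<exists>e'. bij_betw e' {..<N * c} B' \<and> (\<forall>q<N * c. \<rho> (e' q) = e (q div c))"
proof -
  have "\<exists>h. bij_betw h {..<c} {b' \<in> B'. \<rho> b' = b}" if "b \<in> B" for b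
    using fib[OF that] fin ex_bij_betw_nat_finite[of "{b' \<in> B'. \<rho> b' = b}"]
    by (auto simp: atLeast0LessThan)
  then obtain h where h: "\<And>b. b \<in> B \<Longrightarrow> bij_betw (h b) {..<c} {b' \<in> B'. \<rho> b' = b}"
    by metis
  define e' where "e' q = h (e (q div c)) (q mod c)" for q
  have div: "q div c < N" if "q < N * c" for q
    using that by (simp add: less_mult_imp_div_less)
  have eB: "e (q div c) \<in> B" if "q < N * c" for q
    using e div[OF that] by (auto simp: bij_betw_def)
  have e'in: "e' q \<in> B'" "\<rho> (e' q) = e (q div c)" if "q < N * c" for q
    using h[OF eB[OF that]] \<open>c > 0\<close> unfolding e'_def bij_betw_def by fastforce+
  have "inj_on e' {..<N * c}"
  proof (rule inj_onI)
    fix p q assume p: "p \<in> {..<N * c}" and q: "q \<in> {..<N * c}" and eq: "e' p = e' q"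
    then have "e (p div c) = e (q div c)" using e'in by (metis lessThan_iff)
    then have 1: "p div c = q div c" using e div p q by (auto simp: bij_betw_def inj_on_def)
    have "h (e (p div c)) (p mod c) = h (e (p div c)) (q mod c)" using eq 1 by (simp add: e'_def)
    then have "p mod c = q mod c"
      using h[OF eB[of p]] p \<open>c > 0\<close> by (auto simp: bij_betw_def inj_on_def)
    with 1 show "p = q" by (metis div_mult_mod_eq)
  qed
  moreover have "e' ` {..<N * c} = B'"
  proof
    show "e' ` {..<N * c} \<subseteq> B'" using e'in by auto
    show "B' \<subseteq> e' ` {..<N * c}"
    proof
      fix b assume b: "b \<in> B'"
      then have \<rho>: "\<rho> b \<in> B" using assms by auto
      then obtain p where p: "p < N" "e p = \<rho> b" using e by (auto simp: bij_betw_def)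
      obtain r where r: "r < c" "h (\<rho> b) r = b"
        using h[OF \<rho>] b by (force simp: bij_betw_def)
      have "e' (p * c + r) = b" using p r by (simp add: e'_def)
      moreover have "p * c + r < N * c"
      proof -
        have "p * c + r < (p + 1) * c" using r by simp
        also have "\<dots> \<le> N * c" using p by (intro mult_right_mono) auto
        finally show ?thesis .
      qed
      ultimately show "b \<in> e' ` {..<N * c}" by (metis imageI lessThan_iff)
    qed
  qed
  ultimately show ?thesis using e'in(2) unfolding bij_betw_def by blast
qed

lemma floor_mult_div:
  fixes \<omega> :: real
  assumes "0 \<le> \<omega>" "c > 0"
  shows "nat \<lfloor>\<omega> * real (N * c)\<rfloor> div c = nat \<lfloor>\<omega> * real N\<rfloor>"
proof -
  have "\<lfloor>\<omega> * real N\<rfloor> = \<lfloor>(\<omega> * real (N * c)) / real c\<rfloor>" using assms by simp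
  also have "\<dots> = \<lfloor>\<omega> * real (N * c)\<rfloor> div int c"
    using floor_divide_real_eq_div[of "int c" "\<omega> * real (N * c)"] by simp
  finally show ?thesis using assms by (simp add: nat_div_distrib)
qed

text \<open>A uniform \<open>\<omega> \<in> [0,1)\<close> has \<open>\<lfloor>\<omega> N\<rfloor>\<close> uniform on \<open>{0,\<dots>,N-1}\<close> for all \<open>N\<close> simultaneously, and
  \<open>\<lfloor>\<omega> N c\<rfloor> div c = \<lfloor>\<omega> N\<rfloor>\<close>.\<close>

lemma uniform_inverse_sequence_exists:
  fixes B :: "nat \<Rightarrow> 'b set" and \<rho> :: "nat \<Rightarrow> 'b \<Rightarrow> 'b" and c :: nat
  assumes fin: "\<And>k. finite (B k)" and ne: "B 0 \<noteq> {}"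
    and \<rho>: "\<And>k. \<rho> k ` B (Suc k) \<subseteq> B k"
    and fib: "\<And>k b. b \<in> B k \<Longrightarrow> card {b' \<in> B (Suc k). \<rho> k b' = b} = c" and c: "c > 0"
  obtains M :: "real measure" and Z where "prob_space M"
    "\<And>k \<omega>. \<omega> \<in> space M \<Longrightarrow> Z k \<omega> \<in> B k"
    "\<And>k \<omega>. \<omega> \<in> space M \<Longrightarrow> \<rho> k (Z (Suc k) \<omega>) = Z k \<omega>"
    "\<And>k. Z k \<in> M \<rightarrow>\<^sub>M count_space UNIV"
    "\<And>k b. b \<in> B k \<Longrightarrow> measure M {\<omega> \<in> space M. Z k \<omega> = b} = 1 / card (B k)"
proof -
  let ?N = "\<lambda>k. card (B k)"
  \<comment> \<open>The enumerations are chosen level by level, each lifting the previous one; on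
    indices \<open>\<rho> k\<close> is then \<open>div c\<close>, the relation satisfied by nested
    floors.\<close>
  have "\<exists>e. \<forall>k. bij_betw (e k) {..<?N k} (B k) \<and>
      (?N (Suc k) = ?N k * c \<and> (\<forall>q<?N k * c. \<rho> k (e (Suc k) q) = e k (q div c)))"
  proof (rule dependent_nat_choice)
    show "\<exists>e. bij_betw e {..<?N 0} (B 0)"
      using ex_bij_betw_nat_finite[OF fin, of 0] by (auto simp: atLeast0LessThan)
  next
    fix e k assume e: "bij_betw e {..<?N k} (B k)"
    obtain e' where e': "bij_betw e' {..<?N k * c} (B (Suc k))"
        "\<forall>q<?N k * c. \<rho> k (e' q) = e (q div c)"
      using exists_lifted_enumeration[OF e fin \<rho> fib c] by auto
    moreover have "?N (Suc k) = ?N k * c" using bij_betw_same_card[OF e'(1)] by simp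
    ultimately show "\<exists>e'. bij_betw e' {..<?N (Suc k)} (B (Suc k)) \<and>
        (?N (Suc k) = ?N k * c \<and> (\<forall>q<?N k * c. \<rho> k (e' q) = e (q div c)))" by auto
  qed
  then obtain e where e: "\<And>k. bij_betw (e k) {..<?N k} (B k)"
    and N: "\<And>k. ?N (Suc k) = ?N k * c"
    and e\<rho>: "\<And>k q. q < ?N k * c \<Longrightarrow> \<rho> k (e (Suc k) q) = e k (q div c)" by blast
  have Npos: "?N k > 0" for k
    by (induction k) (use ne fin c N in \<open>auto simp: card_gt_0_iff\<close>)
  define M where "M = restrict_space lborel {0..<1::real}"
  have spM: "space M = {0..<1}" by (simp add: M_def space_restrict_space)
  have prob: "prob_space M"
    by (rule prob_spaceI) (simp add: spM, simp add: M_def emeasure_restrict_space)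
  define q where "q k \<omega> = nat \<lfloor>\<omega> * real (?N k)\<rfloor>" for k and \<omega> :: real
  define Z where "Z k \<omega> = e k (q k \<omega>)" for k \<omega>
  have q: "q k \<omega> < ?N k" if "\<omega> \<in> space M" for k \<omega>
  proof -
    have "\<omega> * real (?N k) < real (?N k)" using that Npos[of k] by (simp add: spM)
    then have "\<lfloor>\<omega> * real (?N k)\<rfloor> < int (?N k)" by linarith
    then show ?thesis using Npos[of k] by (simp add: q_def nat_less_iff)
  qed
  have qdiv: "q (Suc k) \<omega> div c = q k \<omega>" if "\<omega> \<in> space M" for k \<omega>
    using floor_mult_div[of \<omega> c "?N k"] that c by (simp add: q_def N spM)
  \<comment> \<open>The event is a half-open interval of length \<open>1 / ?N k\<close>, which gives
    measurability and uniformity.\<close>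
  have qset: "{\<omega> \<in> space M. q k \<omega> = p} = {p / ?N k..<(real p + 1) / ?N k}" if "p < ?N k" for k p
  proof -
    have "q k \<omega> = p \<longleftrightarrow> p / ?N k \<le> \<omega> \<and> \<omega> < (real p + 1) / ?N k" if "0 \<le> \<omega>" for \<omega>
    proof -
      have "q k \<omega> = p \<longleftrightarrow> \<lfloor>\<omega> * real (?N k)\<rfloor> = int p"
        using that by (auto simp: q_def)
      also have "\<dots> \<longleftrightarrow> p \<le> \<omega> * ?N k \<and> \<omega> * ?N k < p + 1"
        by (auto simp: floor_eq_iff)
      also have "\<dots> \<longleftrightarrow> p / ?N k \<le> \<omega> \<and> \<omega> < (real p + 1) / ?N k"
        using Npos[of k] by (simp add: field_simps)
      finally show ?thesis .
    qed
    note eq = this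
    have "(real p + 1) / ?N k \<le> 1" using that by (simp add: field_simps)
    then have "\<omega> \<in> space M \<and> q k \<omega> = p \<longleftrightarrow> \<omega> \<in> {p / ?N k..<(real p + 1) / ?N k}" for \<omega>
    proof (cases "0 \<le> \<omega>")
      case True
      with eq[OF this] \<open>(real p + 1) / ?N k \<le> 1\<close> show ?thesis by (auto simp: spM)
    next
      case False
      then have "\<not> p / ?N k \<le> \<omega>" using order_trans[of 0 "p / ?N k" \<omega>] by auto
      with False show ?thesis by (auto simp: spM)
    qed
    then show ?thesis unfolding set_eq_iff mem_Collect_eq by blast
  qed
  have qmeas: "{\<omega> \<in> space M. q k \<omega> = p} \<in> sets M" if "p < ?N k" for k p
  proof -
    have "{real p / ?N k..<(real p + 1) / ?N k} \<subseteq> {0..<1}"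
      unfolding qset[OF that, symmetric] spM by blast
    then show ?thesis unfolding qset[OF that] by (simp add: M_def sets_restrict_space_iff)
  qed
  have Zset: "{\<omega> \<in> space M. Z k \<omega> = b} = {\<omega> \<in> space M. q k \<omega> = p}"
    if "p < ?N k" "e k p = b" for k p b
    using that e[of k] q by (auto simp: Z_def bij_betw_def inj_on_def)
  have Zin: "Z k \<omega> \<in> B k" if "\<omega> \<in> space M" for k \<omega>
    using e[of k] q[OF that] by (auto simp: Z_def bij_betw_def)
  have ex: "\<exists>p<?N k. e k p = b" if "b \<in> B k" for k b
    using e[of k] that unfolding bij_betw_def by (metis imageE lessThan_iff)
  show thesis
  proof (rule that)
    show "prob_space M" by (rule prob)
    show "Z k \<omega> \<in> B k" if "\<omega> \<in> space M" for k \<omega> using that by (rule Zin)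
    show "\<rho> k (Z (Suc k) \<omega>) = Z k \<omega>" if "\<omega> \<in> space M" for k \<omega>
      using e\<rho>[of "q (Suc k) \<omega>" k] q[OF that, of "Suc k"] qdiv[OF that] by (simp add: Z_def N)
    show "Z k \<in> M \<rightarrow>\<^sub>M count_space UNIV" for k
    proof -
      have "Z k \<in> M \<rightarrow>\<^sub>M count_space (B k)"
      proof (subst measurable_count_space_eq2[OF fin], intro conjI ballI)
        show "Z k \<in> space M \<rightarrow> B k" using Zin by auto
        fix b assume "b \<in> B k"
        then obtain p where p: "p < ?N k" "e k p = b" using ex by blast
        have "Z k -` {b} \<inter> space M = {\<omega> \<in> space M. Z k \<omega> = b}" by auto
        then show "Z k -` {b} \<inter> space M \<in> sets M" using Zset[OF p] qmeas[OF p(1)] by simp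
      qed
      then show ?thesis by (rule measurable_compose[where g = "\<lambda>x. x"]) simp
    qed
    show "measure M {\<omega> \<in> space M. Z k \<omega> = b} = 1 / ?N k" if b: "b \<in> B k" for k b
    proof -
      obtain p where p: "p < ?N k" "e k p = b" using ex[OF b] by blast
      have sub: "{real p / ?N k..<(real p + 1) / ?N k} \<subseteq> {0..<1}"
        unfolding qset[OF p(1), symmetric] spM by blast
      have "measure M {\<omega> \<in> space M. Z k \<omega> = b} = measure lborel {real p / ?N k..<(real p + 1) / ?N k}"
        unfolding Zset[OF p] qset[OF p(1)] unfolding M_def
        by (rule measure_restrict_space) (use sub in auto)
      also have "\<dots> = (real p + 1) / ?N k - p / ?N k"
        by (intro measure_lborel_Ico) (simp add: divide_right_mono)
      also have "\<dots> = 1 / ?N k" by (simp add: diff_divide_distrib[symmetric])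
      finally show ?thesis .
    qed
  qed
qed

section \<open>Cylinder sets as a generator of the sigma-algebra\<close>

lemma cylinder_subset: "A \<in> cylinder_sets G \<Longrightarrow> A \<subseteq> Pow (edges G)"
  by (simp add: cylinder_sets_def)

lemma cylinder_setsI:
  assumes "A \<subseteq> Pow (edges G)" "finite D" "D \<subseteq> edges G"
    and "\<And>F F'. F \<subseteq> edges G \<Longrightarrow> F' \<subseteq> edges G \<Longrightarrow> F \<inter> D = F' \<inter> D \<Longrightarrow> F \<in> A \<Longrightarrow> F' \<in> A"
  shows "A \<in> cylinder_sets G"
  unfolding cylinder_sets_def mem_Collect_eq
proof (intro conjI exI ballI impI)
  fix F F' assume F: "F \<in> Pow (edges G)" "F' \<in> Pow (edges G)" "F \<inter> D = F' \<inter> D"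
  show "F \<in> A \<longleftrightarrow> F' \<in> A"
    using assms(4)[of F F'] assms(4)[of F' F] F by (metis PowD)
qed (use assms in auto)

lemma cylinder_setsE:
  assumes "A \<in> cylinder_sets G"
  obtains D where "finite D" "D \<subseteq> edges G"
    "\<And>F F'. F \<subseteq> edges G \<Longrightarrow> F' \<subseteq> edges G \<Longrightarrow> F \<inter> D = F' \<inter> D \<Longrightarrow> F \<in> A \<longleftrightarrow> F' \<in> A"
proof -
  from assms obtain D where "finite D" "D \<subseteq> edges G"
    "\<forall>F\<in>Pow (edges G). \<forall>F'\<in>Pow (edges G). F \<inter> D = F' \<inter> D \<longrightarrow> (F \<in> A \<longleftrightarrow> F' \<in> A)"
    unfolding cylinder_sets_def by blast
  with that[of D] show thesis by (meson PowI)
qed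

lemma space_edge_space [simp]: "space (edge_space G) = Pow (edges G)"
  and sets_edge_space: "sets (edge_space G) = sigma_sets (Pow (edges G)) (cylinder_sets G)"
proof -
  have "cylinder_sets G \<subseteq> Pow (Pow (edges G))" using cylinder_subset by blast
  then show "space (edge_space G) = Pow (edges G)"
    and "sets (edge_space G) = sigma_sets (Pow (edges G)) (cylinder_sets G)"
    unfolding edge_space_def by (rule space_measure_of, rule sets_measure_of)
qed

lemma Int_stable_cylinder_sets: "Int_stable (cylinder_sets G)"
proof (rule Int_stableI)
  fix A B assume A: "A \<in> cylinder_sets G" and B: "B \<in> cylinder_sets G"
  obtain D where D: "finite D" "D \<subseteq> edges G"
    "\<And>F F'. F \<subseteq> edges G \<Longrightarrow> F' \<subseteq> edges G \<Longrightarrow> F \<inter> D = F' \<inter> D \<Longrightarrow> F \<in> A \<longleftrightarrow> F' \<in> A"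
    using A by (rule cylinder_setsE) blast
  obtain D' where D': "finite D'" "D' \<subseteq> edges G"
    "\<And>F F'. F \<subseteq> edges G \<Longrightarrow> F' \<subseteq> edges G \<Longrightarrow> F \<inter> D' = F' \<inter> D' \<Longrightarrow> F \<in> B \<longleftrightarrow> F' \<in> B"
    using B by (rule cylinder_setsE) blast
  show "A \<inter> B \<in> cylinder_sets G"
  proof (rule cylinder_setsI[of _ _ "D \<union> D'"])
    show "A \<inter> B \<subseteq> Pow (edges G)" using cylinder_subset[OF A] by auto
    fix F F' assume F: "F \<subseteq> edges G" "F' \<subseteq> edges G" "F \<inter> (D \<union> D') = F' \<inter> (D \<union> D')" "F \<in> A \<inter> B"
    then have "F \<inter> D = F' \<inter> D" "F \<inter> D' = F' \<inter> D'" by auto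
    then show "F' \<in> A \<inter> B" using D(3) D'(3) F by blast
  qed (use D D' in auto)
qed

text \<open>Cylinder sets are closed under intersection and contain the whole space, so a finite
  measure is determined by them; invariance then needs checking on finitely many edges at a
  time.\<close>

lemma edge_measure_eqI:
  assumes "sets \<mu> = sets (edge_space G)" "sets \<nu> = sets (edge_space G)" "finite_measure \<mu>"
    and "\<And>A. A \<in> cylinder_sets G \<Longrightarrow> emeasure \<mu> A = emeasure \<nu> A"
  shows "\<mu> = \<nu>"
proof (rule measure_eqI_generator_eq[OF Int_stable_cylinder_sets[of G]])
  show "cylinder_sets G \<subseteq> Pow (Pow (edges G))" using cylinder_subset by blast
  show "range (\<lambda>_::nat. Pow (edges G)) \<subseteq> cylinder_sets G"
  proof -
    have "Pow (edges G) \<in> cylinder_sets G" by (rule cylinder_setsI[of _ _ "{}"]) auto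
    then show ?thesis by simp
  qed
  show "emeasure \<mu> (Pow (edges G)) \<noteq> \<infinity>" for i :: nat
    using finite_measure.emeasure_finite[OF assms(3)] by simp
  show "sets \<mu> = sigma_sets (Pow (edges G)) (cylinder_sets G)"
    "sets \<nu> = sigma_sets (Pow (edges G)) (cylinder_sets G)"
    using assms(1,2) by (simp_all only: sets_edge_space)
  show "(\<Union>i::nat. Pow (edges G)) = Pow (edges G)" by simp
qed (rule assms(4))

section \<open>Limits of uniformly distributed stages\<close>

locale uniform_sequence = prob_space M for M :: "'w measure" +
  fixes B :: "nat \<Rightarrow> 'b set" and Z :: "nat \<Rightarrow> 'w \<Rightarrow> 'b"
  assumes finB: "finite (B k)"
    and Z_in: "\<omega> \<in> space M \<Longrightarrow> Z k \<omega> \<in> B k"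
    and Z_meas [measurable]: "Z k \<in> M \<rightarrow>\<^sub>M count_space UNIV"
    and Z_prob: "b \<in> B k \<Longrightarrow> prob {\<omega> \<in> space M. Z k \<omega> = b} = 1 / card (B k)"
begin

lemma Z_pred [measurable]: "Measurable.pred M (\<lambda>\<omega>. P (Z k \<omega>))"
  by (rule measurable_compose[OF Z_meas]) simp

lemma Z_event: "{\<omega> \<in> space M. P (Z k \<omega>)} \<in> events"
  by measurable

lemma prob_Z: "prob {\<omega> \<in> space M. P (Z k \<omega>)} = card {b \<in> B k. P b} / card (B k)"
proof -
  have "{\<omega> \<in> space M. P (Z k \<omega>)} = (\<Union>b\<in>{b \<in> B k. P b}. {\<omega> \<in> space M. Z k \<omega> = b})"
    using Z_in by auto
  also have "prob \<dots> = (\<Sum>b\<in>{b \<in> B k. P b}. prob {\<omega> \<in> space M. Z k \<omega> = b})"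
    by (rule finite_measure_finite_Union) (use finB Z_event in \<open>auto simp: disjoint_family_on_def\<close>)
  also have "\<dots> = (\<Sum>b\<in>{b \<in> B k. P b}. 1 / card (B k))"
    by (rule sum.cong) (auto simp: Z_prob)
  finally show ?thesis by simp
qed

text \<open>For every \<open>k\<close>, the event that all \<open>P\<close> hold has probability at
  most \<open>1 / N k\<close>, and \<open>N k > k\<close>. It is applied to divisibility by higher
  and higher powers of 3.\<close>

lemma AE_ex_not:
  assumes small: "\<And>k. N k * card {b \<in> B (t k). P k b} \<le> card (B (t k))" and lim: "\<And>k. k < N k"
  shows "AE \<omega> in M. \<exists>k. \<not> P k (Z (t k) \<omega>)"
proof -
  let ?E = "{\<omega> \<in> space M. \<forall>k. P k (Z (t k) \<omega>)}"
  have E: "?E \<in> events" by measurable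
  have "prob ?E \<le> 1 / real (Suc k)" for k
  proof -
    have "prob ?E \<le> prob {\<omega> \<in> space M. P k (Z (t k) \<omega>)}"
      by (rule finite_measure_mono) (use Z_event in auto)
    also have "\<dots> = card {b \<in> B (t k). P k b} / card (B (t k))" by (rule prob_Z)
    also have "\<dots> \<le> 1 / real (Suc k)"
    proof -
      have "Suc k * card {b \<in> B (t k). P k b} \<le> card (B (t k))"
        using small[of k] lim[of k] mult_right_mono[of "Suc k" "N k" "card {b \<in> B (t k). P k b}"] by linarith
      then have "real (Suc k) * card {b \<in> B (t k). P k b} \<le> card (B (t k))"
        by (metis of_nat_le_iff of_nat_mult)
      then show ?thesis by (cases "card (B (t k)) = 0") (auto simp: field_simps)
    qed
    finally show ?thesis .
  qed
  then have "prob ?E \<le> 0"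
    by (intro LIMSEQ_le_const[OF LIMSEQ_Suc[OF lim_1_over_n]]) auto
  then have "prob ?E = 0" using measure_nonneg[of M ?E] by linarith
  then have "?E \<in> null_sets M" using E by (simp add: emeasure_eq_measure null_setsI)
  then show ?thesis by (rule AE_I') auto
qed

text \<open>\<open>F k b\<close> is the approximation of stage \<open>k\<close>, computed from the
  finite datum \<open>b\<close>. The locale fixes only the law of each single \<open>Z k\<close>;
  that the stages fit together enters through \<open>conv\<close>, the stabilisation of every
  edge.\<close>

context
  fixes G :: "'v graph" and F :: "nat \<Rightarrow> 'b \<Rightarrow> 'v set set" and R :: "'w \<Rightarrow> 'v set set"
  assumes R_sub: "\<And>\<omega>. \<omega> \<in> space M \<Longrightarrow> R \<omega> \<subseteq> edges G"
    and F_sub: "\<And>k b. b \<in> B k \<Longrightarrow> F k b \<subseteq> edges G"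
    and conv: "\<And>\<omega> e. \<omega> \<in> space M \<Longrightarrow> e \<in> edges G \<Longrightarrow>
      \<exists>K. \<forall>k\<ge>K. e \<in> F k (Z k \<omega>) \<longleftrightarrow> e \<in> R \<omega>"
begin

lemma eventually_cylinder:
  assumes A: "A \<in> cylinder_sets G" and \<omega>: "\<omega> \<in> space M"
  shows "\<exists>K. \<forall>k\<ge>K. F k (Z k \<omega>) \<in> A \<longleftrightarrow> R \<omega> \<in> A"
proof -
  obtain D where D: "finite D" "D \<subseteq> edges G"
    "\<And>F F'. F \<subseteq> edges G \<Longrightarrow> F' \<subseteq> edges G \<Longrightarrow> F \<inter> D = F' \<inter> D \<Longrightarrow> F \<in> A \<longleftrightarrow> F' \<in> A"
    using A by (rule cylinder_setsE) blast
  have "\<forall>e\<in>D. eventually (\<lambda>k. e \<in> F k (Z k \<omega>) \<longleftrightarrow> e \<in> R \<omega>) sequentially"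
    using conv[OF \<omega>] D(2) by (auto simp: eventually_sequentially)
  then have "eventually (\<lambda>k. \<forall>e\<in>D. e \<in> F k (Z k \<omega>) \<longleftrightarrow> e \<in> R \<omega>) sequentially"
    using D(1) by (simp add: eventually_ball_finite_distrib)
  then obtain K where K: "\<And>k e. k \<ge> K \<Longrightarrow> e \<in> D \<Longrightarrow> e \<in> F k (Z k \<omega>) \<longleftrightarrow> e \<in> R \<omega>"
    by (auto simp: eventually_sequentially)
  have "F k (Z k \<omega>) \<in> A \<longleftrightarrow> R \<omega> \<in> A" if "k \<ge> K" for k
    by (rule D(3)[OF F_sub[OF Z_in[OF \<omega>]] R_sub[OF \<omega>]]) (use K[OF that] in blast)
  then show ?thesis by blast
qed

text \<open>Membership of \<open>R \<omega>\<close> in a cylinder set is decided by all sufficiently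
  late stages, hence is a countable union of countable intersections of events.\<close>

lemma measurable_limit: "R \<in> M \<rightarrow>\<^sub>M edge_space G"
  unfolding edge_space_def
proof (rule measurable_measure_of)
  show "cylinder_sets G \<subseteq> Pow (Pow (edges G))" using cylinder_subset by blast
  show "R \<in> space M \<rightarrow> Pow (edges G)" using R_sub by auto
  fix A assume A: "A \<in> cylinder_sets G"
  have "R -` A \<inter> space M = {\<omega> \<in> space M. \<exists>K. \<forall>k\<in>{K..}. F k (Z k \<omega>) \<in> A}"
    using eventually_cylinder[OF A] by (auto simp: atLeast_def) (meson linear)+
  also have "\<dots> \<in> events" by measurable
  finally show "R -` A \<inter> space M \<in> events" .
qed

text \<open>Dominated convergence: the indicators of the stage events converge pointwise.\<close>

lemma cylinder_prob_limit:
  assumes A: "A \<in> cylinder_sets G"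
  shows "(\<lambda>k. card {b \<in> B k. F k b \<in> A} / card (B k)) \<longlonglongrightarrow> prob (R -` A \<inter> space M)"
proof -
  let ?f = "\<lambda>k \<omega>. indicator {\<omega> \<in> space M. F k (Z k \<omega>) \<in> A} \<omega> :: real"
  have RA: "R -` A \<inter> space M \<in> events"
    using measurable_sets[OF measurable_limit, of A] A by (auto simp: sets_edge_space)
  have "(\<lambda>k. integral\<^sup>L M (?f k)) \<longlonglongrightarrow> integral\<^sup>L M (indicator (R -` A \<inter> space M) :: 'w \<Rightarrow> real)"
  proof (rule integral_dominated_convergence[where w = "\<lambda>_. 1"])
    show "AE \<omega> in M. (\<lambda>k. ?f k \<omega>) \<longlonglongrightarrow> indicator (R -` A \<inter> space M) \<omega>"
    proof (rule AE_I2)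
      fix \<omega> assume \<omega>: "\<omega> \<in> space M"
      obtain K where "\<forall>k\<ge>K. F k (Z k \<omega>) \<in> A \<longleftrightarrow> R \<omega> \<in> A"
        using eventually_cylinder[OF A \<omega>] by blast
      then have "eventually (\<lambda>k. ?f k \<omega> = indicator (R -` A \<inter> space M) \<omega>) sequentially"
        using \<omega> by (auto simp: eventually_sequentially indicator_def)
      then show "(\<lambda>k. ?f k \<omega>) \<longlonglongrightarrow> indicator (R -` A \<inter> space M) \<omega>"
        by (rule tendsto_eventually)
    qed
  qed (use RA Z_event in \<open>auto simp: indicator_def\<close>)
  moreover have "integral\<^sup>L M (?f k) = card {b \<in> B k. F k b \<in> A} / card (B k)" for k
    using Z_event prob_Z[of "\<lambda>b. F k b \<in> A" k] by (simp add: emeasure_eq_measure)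
  ultimately show ?thesis using RA by (simp add: emeasure_eq_measure)
qed

text \<open>At each stage the permutation matches the data that put \<open>F k\<close> into the
  preimage of \<open>A\<close> with those that put it into \<open>A\<close>. The two counts agree
  exactly, and so do their limits. Invariance is thus obtained without letting \<open>T\<close> act
  on the sample space.\<close>

lemma invariant_limit:
  assumes T_cyl: "\<And>A. A \<in> cylinder_sets G \<Longrightarrow> T -` A \<inter> Pow (edges G) \<in> cylinder_sets G"
    and T_meas: "T \<in> edge_space G \<rightarrow>\<^sub>M edge_space G"
    and perm: "\<And>k. \<exists>\<pi>. bij_betw \<pi> (B k) (B k) \<and> (\<forall>b\<in>B k. T (F k b) = F k (\<pi> b))"
  shows "distr (distr M (edge_space G) R) (edge_space G) T = distr M (edge_space G) R"
proof (rule edge_measure_eqI)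
  note [measurable] = measurable_limit T_meas
  show "finite_measure (distr (distr M (edge_space G) R) (edge_space G) T)"
    by (intro prob_space.finite_measure prob_space.prob_space_distr prob_space_distr) measurable
  fix A assume A: "A \<in> cylinder_sets G"
  have sA: "A \<in> sets (edge_space G)" using A by (auto simp: sets_edge_space)
  let ?A' = "T -` A \<inter> Pow (edges G)"
  have A': "?A' \<in> cylinder_sets G" by (rule T_cyl[OF A])
  have "card {b \<in> B k. F k b \<in> ?A'} = card {b \<in> B k. F k b \<in> A}" for k
  proof -
    obtain \<pi> where \<pi>: "bij_betw \<pi> (B k) (B k)" "\<forall>b\<in>B k. T (F k b) = F k (\<pi> b)" using perm by blast
    have "bij_betw \<pi> {b \<in> B k. F k b \<in> ?A'} {b \<in> B k. F k b \<in> A}"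
    proof (rule bij_betw_subset[OF \<pi>(1)])
      have "F k b \<in> ?A' \<longleftrightarrow> F k (\<pi> b) \<in> A" if "b \<in> B k" for b
        using \<pi>(2) F_sub that by auto
      then have "\<pi> ` {b \<in> B k. F k b \<in> ?A'} = \<pi> ` {b \<in> B k. F k (\<pi> b) \<in> A}"
        by (intro arg_cong[where f = "image \<pi>"] Collect_cong conj_cong refl)
      also have "\<dots> = {b \<in> \<pi> ` B k. F k b \<in> A}" by blast
      finally show "\<pi> ` {b \<in> B k. F k b \<in> ?A'} = {b \<in> B k. F k b \<in> A}"
        using \<pi>(1) by (simp only: bij_betw_def)
    qed (rule Collect_restrict)
    then show ?thesis by (rule bij_betw_same_card)
  qed
  then have "prob (R -` ?A' \<inter> space M) = prob (R -` A \<inter> space M)"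
    using LIMSEQ_unique[OF cylinder_prob_limit[OF A']] cylinder_prob_limit[OF A] by simp
  moreover have "?A' \<in> sets (edge_space G)" using A' by (auto simp: sets_edge_space)
  ultimately show "emeasure (distr (distr M (edge_space G) R) (edge_space G) T) A =
      emeasure (distr M (edge_space G) R) A"
    using sA by (simp only: emeasure_distr T_meas measurable_limit measurable_distr_eq1
        space_distr space_edge_space emeasure_eq_measure)
qed auto

end

end

section \<open>The space-filling curve\<close>

definition connected_via :: "'v set set \<Rightarrow> 'v \<Rightarrow> 'v \<Rightarrow> bool" where
  "connected_via F u v \<longleftrightarrow> (u, v) \<in> {(x, y). {x, y} \<in> F}\<^sup>*"

lemma connected_via_refl [simp]: "connected_via F u u"
  by (simp add: connected_via_def)

lemma connected_via_edge: "{u, v} \<in> F \<Longrightarrow> connected_via F u v"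
  by (auto simp: connected_via_def)

lemma connected_via_trans: "connected_via F u v \<Longrightarrow> connected_via F v w \<Longrightarrow> connected_via F u w"
  unfolding connected_via_def by (rule rtrancl_trans)

lemma connected_via_sym: "connected_via F u v \<Longrightarrow> connected_via F v u"
proof -
  have "sym {(x, y). {x, y} \<in> F}" by (auto simp: sym_def insert_commute)
  then show "connected_via F u v \<Longrightarrow> connected_via F v u"
    unfolding connected_via_def by (meson sym_rtrancl symD)
qed

text \<open>At stage \<open>s\<close>, space is tiled by boxes with side lengths \<open>side d s i\<close> (powers of 3), whose grid is
  shifted by \<open>- a\<close>; box faces are walls, labelled alternately even (\<open>\<theta> = False\<close>) and odd
  (\<open>\<theta> = True\<close>). Inside every box runs a Hamiltonian path from the corner at which all walls are even
  to the corner at which all walls are odd. Stage \<open>s\<close> glues triples of boxes stacked in direction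
  \<open>s mod d\<close>, by edges through the walls that are not walls of the next stage.\<close>

primrec side :: "nat \<Rightarrow> nat \<Rightarrow> nat \<Rightarrow> int" where
  "side d 0 i = 1"
| "side d (Suc s) i = (if i = s mod d then 3 * side d s i else side d s i)"

text \<open>Positions are those of faces: the cell with coordinate \<open>x i\<close> lies between
  the faces \<open>x i\<close> and \<open>x i + 1\<close>. A wall is a multiple of the side length
  in shifted coordinates, labelled by the parity of the multiple.\<close>

definition wall :: "nat \<Rightarrow> nat \<Rightarrow> (nat \<Rightarrow> int) \<Rightarrow> bool \<Rightarrow> nat \<Rightarrow> int \<Rightarrow> bool" where
  "wall d s a \<theta> i y \<longleftrightarrow> (y + a i) mod (2 * side d s i) = of_bool \<theta> * side d s i"

type_synonym cell = "(nat \<Rightarrow> int) \<times> nat"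

text \<open>Vectors of length \<open>d\<close> are functions vanishing from \<open>d\<close> on, so
  that each vector is a single function. The number \<open>f\<close> is the level in a path with
  \<open>m\<close> vertices.\<close>

definition cells :: "nat \<Rightarrow> nat \<Rightarrow> cell set" where
  "cells d m = {(x, f). (\<forall>i\<ge>d. x i = 0) \<and> f < m}"

definition end_level :: "nat \<Rightarrow> bool \<Rightarrow> nat" where
  "end_level m \<theta> = (if \<theta> then m - 1 else 0)"

definition corner :: "nat \<Rightarrow> nat \<Rightarrow> (nat \<Rightarrow> int) \<Rightarrow> bool \<Rightarrow> (nat \<Rightarrow> int) \<Rightarrow> bool" where
  "corner d s a \<theta> x \<longleftrightarrow> (\<forall>i<d. wall d s a \<theta> i (x i) \<or> wall d s a \<theta> i (x i + 1))"

definition column_edges :: "nat \<Rightarrow> nat \<Rightarrow> cell set set" where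
  "column_edges d m = {{(x, f), (x, Suc f)} | x f. (x, Suc f) \<in> cells d m}"

text \<open>Boxes on the two sides of a wall labelled \<open>\<theta>\<close> are mirror images, so
  their paths have their \<open>\<theta>\<close>-ends face to face there; the edge across the wall
  joins the two paths.\<close>

definition glue :: "nat \<Rightarrow> nat \<Rightarrow> (nat \<Rightarrow> int) \<Rightarrow> nat \<Rightarrow> bool \<Rightarrow> (nat \<Rightarrow> int) \<Rightarrow> bool" where
  "glue d s a i \<theta> x \<longleftrightarrow> i = s mod d \<and> corner d s a \<theta> x \<and>
     wall d s a \<theta> i (x i + 1) \<and> \<not> wall d (Suc s) a \<theta> i (x i + 1)"

definition glue_edges :: "nat \<Rightarrow> nat \<Rightarrow> nat \<Rightarrow> (nat \<Rightarrow> int) \<Rightarrow> cell set set" where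
  "glue_edges d m s a = {{(x, end_level m \<theta>), (x(i := x i + 1), end_level m \<theta>)} | x i \<theta>.
     (x, end_level m \<theta>) \<in> cells d m \<and> glue d s a i \<theta> x}"

section \<open>Arithmetic of sides and walls\<close>

lemma side_pos [simp]: "side d s i > 0"
  by (induction s) auto

lemma side_nonzero [simp]: "side d s i \<noteq> 0"
  using side_pos[of d s i] by linarith

lemma odd_side [simp]: "odd (side d s i)"
  by (induction s) auto

lemma side_dvd_power: "side d s i dvd 3 ^ s"
  by (induction s) (auto simp: mult_dvd_mono dvd_mult)

lemma wall_cong:
  assumes "2 * 3 ^ s dvd a i - b i"
  shows "wall d s a \<theta> i y \<longleftrightarrow> wall d s b \<theta> i y"
proof -
  have "2 * side d s i dvd (y + a i) - (y + b i)"
    using dvd_trans[OF mult_dvd_mono[OF dvd_refl side_dvd_power] assms] by simp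
  then show ?thesis unfolding wall_def by (metis mod_eq_dvd_iff)
qed

lemma wall_dvd: "wall d s a \<theta> i y \<Longrightarrow> side d s i dvd y + a i"
  unfolding wall_def by (metis dvd_mod_imp_dvd dvd_triv_right)

lemma wall_unique: "wall d s a \<theta> i y \<Longrightarrow> \<not> wall d s a \<theta> i (y + 1)"
proof
  assume "wall d s a \<theta> i y" "wall d s a \<theta> i (y + 1)"
  then have "(y + 1 + a i) mod (2 * side d s i) = (y + a i) mod (2 * side d s i)"
    by (simp add: wall_def)
  then have "2 * side d s i dvd 1" by (simp add: mod_eq_dvd_iff)
  then have "(2::int) dvd 1" by (rule dvd_mult_left)
  then show False by simp
qed

lemma wall_Suc_other: "i \<noteq> s mod d \<Longrightarrow> wall d (Suc s) a \<theta> i y \<longleftrightarrow> wall d s a \<theta> i y"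
  by (simp add: wall_def)

text \<open>As 3 is odd, an even or odd multiple of three times the side is an even or odd multiple
  of the side, respectively: a wall that survives has had the same label before.\<close>

lemma wall_SucD: "wall d (Suc s) a \<theta> i y \<Longrightarrow> wall d s a \<theta> i y"
proof (cases "i = s mod d")
  case True
  assume "wall d (Suc s) a \<theta> i y"
  then have "(y + a i) mod (3 * (2 * side d s i)) = of_bool \<theta> * (3 * side d s i)"
    using True by (simp add: wall_def mult.left_commute)
  then have "(y + a i) mod (2 * side d s i) = of_bool \<theta> * (3 * side d s i) mod (2 * side d s i)"
    by (metis dvd_triv_right mod_mod_cancel)
  also have "of_bool \<theta> * (3 * side d s i) mod (2 * side d s i) = of_bool \<theta> * side d s i"
  proof (cases \<theta>)
    case True
    have "(3 * side d s i) mod (2 * side d s i) = (side d s i + 1 * (2 * side d s i)) mod (2 * side d s i)"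
      by simp
    also have "\<dots> = side d s i" unfolding mod_mult_self1 by (rule mod_pos_pos_trivial) (auto simp: less_imp_le)
    finally show ?thesis using True by simp
  qed simp
  finally show ?thesis by (simp add: wall_def)
qed (simp add: wall_Suc_other)

text \<open>The side is odd, so the parity of the multiple is that of the shifted position itself,
  whatever the stage.\<close>

lemma wall_parity: "wall d s a \<theta> i y \<Longrightarrow> odd (y + a i) \<longleftrightarrow> \<theta>"
proof -
  assume "wall d s a \<theta> i y"
  then have "y + a i = 2 * side d s i * ((y + a i) div (2 * side d s i)) + of_bool \<theta> * side d s i"
    unfolding wall_def by (metis mult_div_mod_eq)
  then have "odd (y + a i) \<longleftrightarrow>
      odd (2 * side d s i * ((y + a i) div (2 * side d s i)) + of_bool \<theta> * side d s i)" by simp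
  then show ?thesis by (cases \<theta>) auto
qed

lemma wall_mult: "wall d s a (odd q) i (q * side d s i - a i)"
proof (cases "odd q")
  case True
  then obtain r where r: "q = 2 * r + 1" by (rule oddE)
  have "q * side d s i = side d s i + r * (2 * side d s i)" by (simp add: r algebra_simps)
  then have "q * side d s i mod (2 * side d s i) = side d s i"
    by (simp only: mod_mult_self1) (rule mod_pos_pos_trivial, auto simp: less_imp_le)
  then show ?thesis using True by (simp add: wall_def)
next
  case False
  then show ?thesis by (auto simp: wall_def elim!: evenE)
qed

text \<open>\<open>\<alpha> s\<close> is the shift as known at stage \<open>s\<close>. The
  assumption \<open>generic\<close> excludes faces that are walls at all stages; no edge of the
  curve would ever cross such a face.\<close>

locale folded_curve =
  fixes d m :: nat and \<alpha> :: "nat \<Rightarrow> nat \<Rightarrow> int"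
  assumes d_pos: "d > 0" and m_pos: "m > 0"
    and compat: "i < d \<Longrightarrow> 2 * 3 ^ s dvd \<alpha> (Suc s) i - \<alpha> s i"
    and generic: "i < d \<Longrightarrow> \<exists>s. \<not> side d s i dvd y + \<alpha> s i"
begin

text \<open>The glueing of stage \<open>s\<close> inspects walls of stage \<open>Suc s\<close> and
  therefore reads the shift of that stage; for the walls of stage \<open>s\<close> both shifts
  agree, by \<open>compat\<close>.\<close>

definition curve :: "cell set set" where
  "curve = column_edges d m \<union> (\<Union>s. glue_edges d m s (\<alpha> (Suc s)))"

abbreviation W where "W s \<equiv> wall d s (\<alpha> s)"

lemma W_Suc: "i < d \<Longrightarrow> wall d s (\<alpha> (Suc s)) \<theta> i y \<longleftrightarrow> W s \<theta> i y"
  by (rule wall_cong) (rule compat)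

lemma smod: "s mod d < d"
  using d_pos by simp

lemma W_SucD: "i < d \<Longrightarrow> W (Suc s) \<theta> i y \<Longrightarrow> W s \<theta> i y"
  using wall_SucD W_Suc by blast

lemma W_mono: "s \<le> s' \<Longrightarrow> i < d \<Longrightarrow> W s' \<theta> i y \<Longrightarrow> W s \<theta> i y"
  by (induction rule: inc_induct) (auto dest: W_SucD)

lemma alpha_parity: "i < d \<Longrightarrow> even (\<alpha> s i - \<alpha> 0 i)"
proof (induction s)
  case (Suc s)
  have "2 dvd \<alpha> (Suc s) i - \<alpha> s i"
    using compat[OF Suc.prems] by (rule dvd_mult_left)
  with Suc show ?case by presburger
qed simp

text \<open>The label is the parity of the shifted position, and the shifts of all stages agree
  modulo 2.\<close>

lemma W_disjoint:
  assumes "i < d" "W s False i y" shows "\<not> W s' True i y"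
proof
  assume "W s' True i y"
  then have "odd (y + \<alpha> s' i)" using wall_parity by blast
  moreover have "even (y + \<alpha> s i)" using assms(2) wall_parity by blast
  ultimately show False
    using alpha_parity[OF assms(1), of s] alpha_parity[OF assms(1), of s'] by auto
qed

lemma corner_0: "corner d 0 (\<alpha> 0) \<theta> x"
proof -
  have "z mod 2 = of_bool \<theta> \<or> (z + 1) mod 2 = of_bool \<theta>" for z :: int
    by (cases \<theta>) (simp, presburger)+
  from this[of "x i + \<alpha> 0 i" for i] show ?thesis
    unfolding corner_def wall_def by (simp add: ac_simps)
qed

lemma corner_Suc: "corner d s (\<alpha> (Suc s)) \<theta> x \<longleftrightarrow> corner d s (\<alpha> s) \<theta> x"
  using W_Suc by (simp add: corner_def)

lemma corner_mono: "s \<le> s' \<Longrightarrow> corner d s' (\<alpha> s') \<theta> x \<Longrightarrow> corner d s (\<alpha> s) \<theta> x"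
  unfolding corner_def using W_mono by blast

text \<open>Take a stage at which neither of the two faces of the cell in direction 0 is a wall any
  more.\<close>

lemma corner_not_forever: "\<exists>s. \<not> corner d s (\<alpha> s) \<theta> x"
proof -
  have *: "\<exists>s. \<not> W s \<theta> 0 y" for y
    using generic[OF d_pos, of y] wall_dvd by blast
  obtain s1 s2 where "\<not> W s1 \<theta> 0 (x 0)" "\<not> W s2 \<theta> 0 (x 0 + 1)"
    using * by blast
  then have "\<not> W (max s1 s2) \<theta> 0 (x 0)" "\<not> W (max s1 s2) \<theta> 0 (x 0 + 1)"
    using W_mono[OF max.cobounded1 d_pos] W_mono[OF max.cobounded2 d_pos] by blast+
  then have "\<not> corner d (max s1 s2) (\<alpha> (max s1 s2)) \<theta> x"
    unfolding corner_def using d_pos by blast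
  then show ?thesis by blast
qed

section \<open>The even and the odd neighbour of a cell\<close>

definition glue_nb :: "nat \<Rightarrow> bool \<Rightarrow> (nat \<Rightarrow> int) \<Rightarrow> (nat \<Rightarrow> int) \<Rightarrow> bool" where
  "glue_nb s \<theta> x y \<longleftrightarrow> corner d s (\<alpha> s) \<theta> x \<and> (let i = s mod d in
     W s \<theta> i (x i + 1) \<and> \<not> W (Suc s) \<theta> i (x i + 1) \<and> y = x(i := x i + 1) \<or>
     W s \<theta> i (x i) \<and> \<not> W (Suc s) \<theta> i (x i) \<and> y = x(i := x i - 1))"

lemma glue_nb_not_corner_Suc:
  assumes "glue_nb s \<theta> x y"
  shows "corner d s (\<alpha> s) \<theta> x" "\<not> corner d (Suc s) (\<alpha> (Suc s)) \<theta> x"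
proof -
  let ?i = "s mod d"
  show "corner d s (\<alpha> s) \<theta> x" using assms by (simp add: glue_nb_def)
  have "\<not> W (Suc s) \<theta> ?i (x ?i)" "\<not> W (Suc s) \<theta> ?i (x ?i + 1)"
    using assms W_SucD[OF smod] wall_unique unfolding glue_nb_def Let_def by metis+
  then show "\<not> corner d (Suc s) (\<alpha> (Suc s)) \<theta> x" using smod by (auto simp: corner_def)
qed

text \<open>Being a \<open>\<theta>\<close>-corner holds at stage 0, is inherited by earlier stages
  and fails eventually. The neighbour is found at the last stage \<open>s\<close> at which it holds:
  only walls in direction \<open>s mod d\<close> change there, so it is the
  \<open>\<theta>\<close>-wall beside the cell in this direction that has vanished and is
  crossed.\<close>

lemma ex1_glue_nb: "\<exists>!y. \<exists>s. glue_nb s \<theta> x y"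
proof (rule ex_ex1I)
  define t where "t = (LEAST s. \<not> corner d s (\<alpha> s) \<theta> x)"
  have t: "\<not> corner d t (\<alpha> t) \<theta> x"
    unfolding t_def using corner_not_forever by (rule LeastI_ex)
  then obtain s where s: "t = Suc s" using corner_0 by (metis not0_implies_Suc)
  then have cs: "corner d s (\<alpha> s) \<theta> x" using not_less_Least[of s "\<lambda>s. \<not> corner d s (\<alpha> s) \<theta> x"] t_def by auto
  let ?i = "s mod d"
  have "W (Suc s) \<theta> i y \<longleftrightarrow> W s \<theta> i y" if "i \<noteq> ?i" "i < d" for i y
    using that W_Suc wall_Suc_other by blast
  with cs t s have "\<not> (W (Suc s) \<theta> ?i (x ?i) \<or> W (Suc s) \<theta> ?i (x ?i + 1))"
    unfolding corner_def by metis
  moreover have "W s \<theta> ?i (x ?i) \<or> W s \<theta> ?i (x ?i + 1)"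
    using cs smod by (auto simp: corner_def)
  ultimately show "\<exists>y s. glue_nb s \<theta> x y" using cs unfolding glue_nb_def Let_def by blast
next
  fix y y' assume "\<exists>s. glue_nb s \<theta> x y" "\<exists>s. glue_nb s \<theta> x y'"
  then obtain s s' where nb: "glue_nb s \<theta> x y" "glue_nb s' \<theta> x y'" by blast
  have "s = s'"
    using glue_nb_not_corner_Suc[OF nb(1)] glue_nb_not_corner_Suc[OF nb(2)] corner_mono
    by (metis Suc_leI linorder_neqE_nat)
  then show "y = y'" using nb wall_unique unfolding glue_nb_def Let_def by metis
qed

text \<open>The next cell towards the end \<open>\<theta>\<close> of the path: along the column,
  upwards for \<open>\<theta> = True\<close>, except at the level where the column ends and a
  glueing edge continues.\<close>

definition nb :: "bool \<Rightarrow> cell \<Rightarrow> cell \<Rightarrow> bool" where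
  "nb \<theta> v u \<longleftrightarrow> (if snd v = end_level m \<theta> then snd u = snd v \<and> (\<exists>s. glue_nb s \<theta> (fst v) (fst u))
     else fst u = fst v \<and> (if \<theta> then snd u = Suc (snd v) else Suc (snd u) = snd v))"

lemma ex1_nb: "\<exists>!u. nb \<theta> v u"
proof (cases "snd v = end_level m \<theta>")
  case True
  obtain y where y: "\<exists>s. glue_nb s \<theta> (fst v) y" "\<And>y'. \<exists>s. glue_nb s \<theta> (fst v) y' \<Longrightarrow> y' = y"
    using ex1_glue_nb[of \<theta> "fst v"] by blast
  have nb: "nb \<theta> v u \<longleftrightarrow> snd u = snd v \<and> (\<exists>s. glue_nb s \<theta> (fst v) (fst u))" for u
    using True by (simp add: nb_def)
  show ?thesis
  proof (rule ex1I)
    show "nb \<theta> v (y, snd v)" unfolding nb using y(1) by simp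
    show "u = (y, snd v)" if "nb \<theta> v u" for u
      using that y(2)[of "fst u"] unfolding nb by (metis prod.collapse)
  qed
next
  case False
  then show ?thesis
  proof (cases \<theta>)
    case True
    with False show ?thesis
      by (intro ex1I[of _ "(fst v, Suc (snd v))"]) (simp_all add: nb_def prod_eq_iff)
  next
    case 2: False
    with False have "snd v > 0" by (simp add: end_level_def)
    with False 2 show ?thesis
      by (intro ex1I[of _ "(fst v, snd v - 1)"]) (simp_all add: nb_def prod_eq_iff, linarith)
  qed
qed

text \<open>If the crossed face is \<open>x + e\<close>, the displacement is
  \<open>2 * e - 1\<close>; so equal displacements mean equal faces.\<close>

lemma glue_nb_step:
  assumes "glue_nb s \<theta> x y"
  obtains e where "W s \<theta> (s mod d) (x (s mod d) + e)" "y = x(s mod d := x (s mod d) + 2 * e - 1)"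
proof -
  from assms consider
      (up) "W s \<theta> (s mod d) (x (s mod d) + 1)" "y = x(s mod d := x (s mod d) + 1)"
    | (down) "W s \<theta> (s mod d) (x (s mod d))" "y = x(s mod d := x (s mod d) - 1)"
    unfolding glue_nb_def Let_def by blast
  then show thesis
  proof cases
    case up then show thesis by (intro that[of 1]) (simp_all add: add.commute)
  next
    case down then show thesis by (intro that[of 0]) simp_all
  qed
qed

text \<open>The two column steps go in opposite directions, and a column step changes the level
  while a glueing step does not. Two glueing steps to the same cell, conceivable only when a column
  has a single level, would cross one face carrying both labels.\<close>

lemma nb_disjoint:
  assumes F: "nb False v u" shows "\<not> nb True v u"
proof
  assume T: "nb True v u"
  have ends: "snd v = end_level m False" "snd v = end_level m True"
    using F T unfolding nb_def
    by (cases "snd v = end_level m False"; cases "snd v = end_level m True"; simp)+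
  obtain s where s: "glue_nb s False (fst v) (fst u)" using F ends by (auto simp: nb_def)
  obtain t where t: "glue_nb t True (fst v) (fst u)" using T ends by (auto simp: nb_def)
  let ?x = "fst v" and ?y = "fst u"
  obtain e where e: "W s False (s mod d) (?x (s mod d) + e)"
      "?y = ?x(s mod d := ?x (s mod d) + 2 * e - 1)"
    using s by (rule glue_nb_step)
  obtain e' where e': "W t True (t mod d) (?x (t mod d) + e')"
      "?y = ?x(t mod d := ?x (t mod d) + 2 * e' - 1)"
    using t by (rule glue_nb_step)
  have neq: "2 * z - (1::int) \<noteq> 0" for z by presburger
  have eq: "s mod d = t mod d"
  proof (rule ccontr)
    assume "s mod d \<noteq> t mod d"
    then have "?y (s mod d) = ?x (s mod d)" by (simp add: e'(2))
    moreover have "?y (s mod d) = ?x (s mod d) + 2 * e - 1" by (simp add: e(2))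
    ultimately show False using neq[of e] by simp
  qed
  have "?y (s mod d) = ?x (s mod d) + 2 * e - 1" by (simp add: e(2))
  moreover have "?y (s mod d) = ?x (s mod d) + 2 * e' - 1" by (simp add: e'(2) eq)
  ultimately have "e = e'" by simp
  then show False using e(1) e'(1) W_disjoint[OF smod] eq by metis
qed

end

lemma div_add_1_eq:
  fixes a n :: int
  assumes "n > 0" "\<not> n dvd a + 1"
  shows "(a + 1) div n = a div n"
proof -
  have "a mod n + 1 \<noteq> n"
  proof
    assume "a mod n + 1 = n"
    then have "a + 1 = n * (a div n) + n" using mult_div_mod_eq[of n a] by linarith
    then show False using assms(2) by simp
  qed
  moreover have "a mod n < n" "0 \<le> a mod n" using assms(1) by simp_all
  ultimately have "0 \<le> a mod n + 1" "a mod n + 1 < n" by linarith+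
  moreover have "a + 1 = n * (a div n) + (a mod n + 1)" using mult_div_mod_eq[of n a] by linarith
  ultimately show ?thesis by (intro int_div_pos_eq)
qed

definition lattice_edges :: "nat \<Rightarrow> nat \<Rightarrow> cell set set" where
  "lattice_edges d m = column_edges d m \<union>
     {{(x, f), (x(i := x i + 1), f)} | x f i. (x, f) \<in> cells d m \<and> i < d}"

lemma column_edge_iff:
  "{(x, f), (y, g)} \<in> column_edges d m \<longleftrightarrow> (x, f) \<in> cells d m \<and> (y, g) \<in> cells d m \<and> y = x \<and> (g = Suc f \<or> f = Suc g)"
  unfolding column_edges_def cells_def by (auto simp: doubleton_eq_iff)

lemma glue_edges_subset: "d > 0 \<Longrightarrow> glue_edges d m s a \<subseteq> lattice_edges d m"
  unfolding glue_edges_def lattice_edges_def glue_def by fastforce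

context folded_curve
begin

lemma glue_Suc:
  "glue d s (\<alpha> (Suc s)) i \<theta> x \<longleftrightarrow> i = s mod d \<and> corner d s (\<alpha> s) \<theta> x \<and>
     W s \<theta> i (x i + 1) \<and> \<not> W (Suc s) \<theta> i (x i + 1)"
  unfolding glue_def corner_Suc using W_Suc[OF smod] by auto

lemma curve_subset: "curve \<subseteq> lattice_edges d m"
proof -
  have "column_edges d m \<subseteq> lattice_edges d m" unfolding lattice_edges_def by (rule Un_upper1)
  then show ?thesis unfolding curve_def using glue_edges_subset[OF d_pos] by blast
qed

text \<open>The crossed face is adjacent to both cells, so being a corner carries over to the other
  side.\<close>

lemma glue_upper:
  assumes "glue d s (\<alpha> (Suc s)) i \<theta> x"
  shows "glue_nb s \<theta> x (x(i := x i + 1))" "glue_nb s \<theta> (x(i := x i + 1)) x"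
proof -
  have *: "i = s mod d" "corner d s (\<alpha> s) \<theta> x" "W s \<theta> i (x i + 1)" "\<not> W (Suc s) \<theta> i (x i + 1)"
    using assms by (auto simp: glue_Suc)
  show "glue_nb s \<theta> x (x(i := x i + 1))" using * by (simp add: glue_nb_def)
  have "corner d s (\<alpha> s) \<theta> (x(i := x i + 1))"
    using *(2,3) by (auto simp: corner_def)
  then show "glue_nb s \<theta> (x(i := x i + 1)) x" using * by (simp add: glue_nb_def)
qed

lemma glue_nbE:
  assumes "glue_nb s \<theta> x y"
  obtains i where "y = x(i := x i + 1)" "glue d s (\<alpha> (Suc s)) i \<theta> x"
  | i where "x = y(i := y i + 1)" "glue d s (\<alpha> (Suc s)) i \<theta> y"
proof -
  let ?i = "s mod d"
  from assms have cs: "corner d s (\<alpha> s) \<theta> x" by (simp add: glue_nb_def)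
  from assms consider
      (up) "W s \<theta> ?i (x ?i + 1)" "\<not> W (Suc s) \<theta> ?i (x ?i + 1)" "y = x(?i := x ?i + 1)"
    | (down) "W s \<theta> ?i (x ?i)" "\<not> W (Suc s) \<theta> ?i (x ?i)" "y = x(?i := x ?i - 1)"
    unfolding glue_nb_def Let_def by blast
  then show thesis
  proof cases
    case up then show thesis using cs that(1)[of ?i] by (simp add: glue_Suc)
  next
    case down
    have "corner d s (\<alpha> s) \<theta> y" using cs down by (auto simp: corner_def)
    then show thesis using down by (intro that(2)[of ?i]) (simp_all add: glue_Suc)
  qed
qed

lemma cells_upd: "i < d \<Longrightarrow> (x(i := z), f) \<in> cells d m \<longleftrightarrow> (x, f) \<in> cells d m"
  by (auto simp: cells_def)

lemma curve_edge_iff: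
  assumes v: "v \<in> cells d m"
  shows "{v, u} \<in> curve \<longleftrightarrow> nb False v u \<or> nb True v u"
proof
  assume "{v, u} \<in> curve"
  then consider (col) "{v, u} \<in> column_edges d m" | (gl) s where "{v, u} \<in> glue_edges d m s (\<alpha> (Suc s))"
    unfolding curve_def by blast
  then show "nb False v u \<or> nb True v u"
  proof cases
    case col
    then show ?thesis
      by (cases v; cases u) (auto simp: column_edge_iff nb_def end_level_def cells_def)
  next
    case gl
    then obtain x i \<theta> where eq: "{v, u} = {(x, end_level m \<theta>), (x(i := x i + 1), end_level m \<theta>)}"
      and g: "glue d s (\<alpha> (Suc s)) i \<theta> x" unfolding glue_edges_def by blast
    from eq glue_upper[OF g] have "nb \<theta> v u"
      by (auto simp: doubleton_eq_iff nb_def)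
    then show ?thesis by (cases \<theta>) auto
  qed
next
  have "{v, u} \<in> curve" if "nb \<theta> v u" for \<theta>
  proof (cases "snd v = end_level m \<theta>")
    case True
    then have su: "snd u = end_level m \<theta>" and "\<exists>s. glue_nb s \<theta> (fst v) (fst u)"
      using that by (auto simp: nb_def)
    then obtain s where s: "glue_nb s \<theta> (fst v) (fst u)" by blast
    obtain x y where vu: "v = (x, end_level m \<theta>)" "u = (y, end_level m \<theta>)"
      using True su by (metis prod.collapse)
    have xc: "(x, end_level m \<theta>) \<in> cells d m" using v vu(1) by simp
    have "glue_nb s \<theta> x y" using s vu by simp
    then have "{v, u} \<in> glue_edges d m s (\<alpha> (Suc s))"
    proof (cases rule: glue_nbE)
      case (1 i)
      then show ?thesis using xc unfolding vu glue_edges_def by blast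
    next
      case (2 i)
      then have "i < d" using smod by (simp add: glue_Suc)
      then have "(y, end_level m \<theta>) \<in> cells d m" using xc unfolding 2(1) by (simp only: cells_upd)
      moreover have "{v, u} = {(y, end_level m \<theta>), (y(i := y i + 1), end_level m \<theta>)}"
        unfolding vu 2(1)[symmetric] by (rule insert_commute)
      ultimately show ?thesis using 2(2) unfolding glue_edges_def by blast
    qed
    then show ?thesis unfolding curve_def by blast
  next
    case False
    then have "{v, u} \<in> column_edges d m"
      using that v by (cases v; cases u; cases \<theta>) (auto simp: column_edge_iff nb_def end_level_def cells_def)
    then show ?thesis unfolding curve_def by blast
  qed
  then show "nb False v u \<or> nb True v u \<Longrightarrow> {v, u} \<in> curve" by blast
qed

lemma card_curve_neighbours:
  assumes v: "v \<in> cells d m"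
  shows "card {u. {v, u} \<in> curve} = 2"
proof -
  obtain a where a: "nb False v a" "\<And>u. nb False v u \<Longrightarrow> u = a" using ex1_nb[of False v] by blast
  obtain b where b: "nb True v b" "\<And>u. nb True v u \<Longrightarrow> u = b" using ex1_nb[of True v] by blast
  have "{u. {v, u} \<in> curve} = {a, b}" using a b unfolding curve_edge_iff[OF v] by blast
  moreover have "a \<noteq> b" using nb_disjoint a b by blast
  ultimately show ?thesis by simp
qed

section \<open>Connectedness of the curve\<close>

abbreviation conn where "conn \<equiv> connected_via curve"

lemma conn_column: "(x, f) \<in> cells d m \<Longrightarrow> (x, g) \<in> cells d m \<Longrightarrow> conn (x, f) (x, g)"
proof (induction "f" "g" rule: linorder_wlog)
  case (le f g)
  from le(1,3) show ?case
  proof (induction g rule: dec_induct)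
    case (step n)
    have "{(x, n), (x, Suc n)} \<in> curve"
      using step unfolding curve_def by (auto simp: column_edge_iff cells_def)
    moreover have "conn (x, f) (x, n)" using step by (auto simp: cells_def)
    ultimately show ?case by (meson connected_via_edge connected_via_trans)
  qed simp
next
  case (sym f g)
  then show ?case by (blast intro: connected_via_sym)
qed

text \<open>The stage \<open>t\<close> of the shift and the stage \<open>s\<close> of the box size
  are separate because the step to \<open>Suc s\<close> compares the small boxes in the shift of the
  large ones; \<open>same_box_Suc\<close> shows that this gives the same partition.\<close>

definition same_box :: "nat \<Rightarrow> nat \<Rightarrow> (nat \<Rightarrow> int) \<Rightarrow> (nat \<Rightarrow> int) \<Rightarrow> bool" where
  "same_box t s x y \<longleftrightarrow> (\<forall>i<d. (x i + \<alpha> t i) div side d s i = (y i + \<alpha> t i) div side d s i)"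

lemma same_box_Suc: "same_box (Suc s) s x y \<longleftrightarrow> same_box s s x y"
proof -
  have "(z + \<alpha> (Suc s) i) div side d s i = (z + \<alpha> s i) div side d s i + (\<alpha> (Suc s) i - \<alpha> s i) div side d s i"
    if "i < d" for i z
  proof -
    have "side d s i dvd \<alpha> (Suc s) i - \<alpha> s i"
      using compat[OF that] side_dvd_power by (meson dvd_mult_right dvd_trans)
    then have "(z + \<alpha> s i + (\<alpha> (Suc s) i - \<alpha> s i)) div side d s i =
        (z + \<alpha> s i) div side d s i + (\<alpha> (Suc s) i - \<alpha> s i) div side d s i"
      by (rule div_plus_div_distrib_dvd_right)
    then show ?thesis by (simp add: algebra_simps)
  qed
  then show ?thesis unfolding same_box_def by auto
qed

text \<open>\<open>u\<close> numbers the box of \<open>x\<close> in the direction that is being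
  tripled. If 3 does not divide \<open>u\<close>, the lower face of that box is not a wall of the
  next stage, so a glueing edge leads through it into the box below.\<close>

lemma glue_between_boxes:
  assumes x: "\<forall>i\<ge>d. x i = 0" and u: "u = (x (s mod d) + \<alpha> (Suc s) (s mod d)) div side d s (s mod d)"
    and "\<not> 3 dvd u"
  shows "\<exists>y f. (\<forall>i\<ge>d. y i = 0) \<and> f < m \<and>
    {(y, f), (y(s mod d := y (s mod d) + 1), f)} \<in> curve \<and>
    same_box (Suc s) s (y(s mod d := y (s mod d) + 1)) x \<and>
    same_box (Suc s) s y (x(s mod d := x (s mod d) - side d s (s mod d)))"
proof -
  let ?i = "s mod d" and ?a = "\<alpha> (Suc s)"
  let ?n = "side d s"
  define \<theta> where "\<theta> = odd u"
  define q where "q l = (x l + ?a l) div ?n l" for l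
  \<comment> \<open>In direction \<open>?i\<close> the last cell before the face
    \<open>u * ?n\<close>, whence the \<open>- 1\<close>; in any other direction the first or the
    last cell of the box, whichever touches a wall with the label \<open>\<theta>\<close> of that
    face.\<close>
  define y where "y l = (if l \<ge> d then 0 else if l = ?i then u * ?n l - 1 - ?a l
    else if odd (q l) = \<theta> then q l * ?n l - ?a l else (q l + 1) * ?n l - 1 - ?a l)" for l
  have W: "wall d s ?a (odd p) l (p * ?n l - ?a l)" for p l by (rule wall_mult)
  have yi: "y ?i + 1 = u * ?n ?i - ?a ?i" using smod[of s] by (simp add: y_def not_le[symmetric])
  have Wi: "wall d s ?a \<theta> ?i (y ?i + 1)" unfolding yi \<theta>_def by (rule W)
  have cor: "corner d s ?a \<theta> y"
    unfolding corner_def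
  proof (intro allI impI)
    fix l assume l: "l < d"
    show "wall d s ?a \<theta> l (y l) \<or> wall d s ?a \<theta> l (y l + 1)"
    proof (cases "l = ?i")
      case False
      show ?thesis
      proof (cases "odd (q l) = \<theta>")
        case True
        then have "y l = q l * ?n l - ?a l" using l False by (simp add: y_def)
        then show ?thesis using W[of "q l" l] True by simp
      next
        case F: False
        then have "y l + 1 = (q l + 1) * ?n l - ?a l" using l False by (simp add: y_def)
        moreover have "odd (q l + 1) = \<theta>" using F by auto
        ultimately show ?thesis using W[of "q l + 1" l] by simp
      qed
    qed (use Wi in simp)
  qed
  have notW: "\<not> wall d (Suc s) ?a \<theta> ?i (y ?i + 1)"
  proof
    assume "wall d (Suc s) ?a \<theta> ?i (y ?i + 1)"
    then have "3 * ?n ?i dvd y ?i + 1 + ?a ?i" using wall_dvd by fastforce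
    then have "3 * ?n ?i dvd u * ?n ?i" by (simp add: yi)
    then show False using \<open>\<not> 3 dvd u\<close> by simp
  qed
  have glue: "glue d s ?a ?i \<theta> y" using cor Wi notW by (simp add: glue_def)
  have y0: "\<forall>i\<ge>d. y i = 0" by (simp add: y_def)
  have f: "end_level m \<theta> < m" using m_pos by (simp add: end_level_def)
  have "{(y, end_level m \<theta>), (y(?i := y ?i + 1), end_level m \<theta>)} \<in> glue_edges d m s ?a"
    unfolding glue_edges_def using glue y0 f by (auto simp: cells_def)
  then have e: "{(y, end_level m \<theta>), (y(?i := y ?i + 1), end_level m \<theta>)} \<in> curve"
    unfolding curve_def by blast
  have dl: "(y l + ?a l) div ?n l = q l" if "l < d" "l \<noteq> ?i" for l
  proof (cases "odd (q l) = \<theta>")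
    case True
    then have "y l + ?a l = q l * ?n l" using that by (simp add: y_def)
    then show ?thesis by simp
  next
    case False
    then have "y l + ?a l = (?n l - 1) + q l * ?n l" using that by (simp add: y_def algebra_simps)
    then show ?thesis by simp
  qed
  have di: "(y ?i + 1 + ?a ?i) div ?n ?i = u" by (simp add: yi)
  have di': "(y ?i + ?a ?i) div ?n ?i = u - 1"
  proof -
    have "y ?i + ?a ?i = (?n ?i - 1) + (u - 1) * ?n ?i" using yi by (simp add: algebra_simps)
    then show ?thesis by simp
  qed
  have dx: "(x ?i - ?n ?i + ?a ?i) div ?n ?i = u - 1"
  proof -
    have eq: "x ?i - ?n ?i + ?a ?i = (x ?i + ?a ?i) + (- 1) * ?n ?i" by simp
    have "(x ?i - ?n ?i + ?a ?i) div ?n ?i = - 1 + u"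
      unfolding eq u by (rule div_mult_self1) simp
    then show ?thesis by simp
  qed
  have "same_box (Suc s) s (y(?i := y ?i + 1)) x"
    unfolding same_box_def using di dl u by (auto simp: q_def)
  moreover have "same_box (Suc s) s y (x(?i := x ?i - ?n ?i))"
    unfolding same_box_def using di' dx dl by (auto simp: q_def)
  ultimately show ?thesis using y0 f e by blast
qed

text \<open>A box of stage \<open>Suc s\<close> consists of three boxes of stage \<open>s\<close>.
  Glueing edges lead from the third to the second and from there to the first, so both cells can be
  moved into the small box whose number is divisible by 3.\<close>

lemma conn_same_box:
  assumes "same_box s s x y" "(x, f) \<in> cells d m" "(y, g) \<in> cells d m"
  shows "conn (x, f) (y, g)"
  using assms
proof (induction s arbitrary: x y f g)
  case 0
  then have "x i = y i" for i by (cases "i < d") (auto simp: same_box_def cells_def)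
  then have "x = y" by auto
  then show ?case using 0 conn_column by blast
next
  case (Suc s)
  let ?i = "s mod d" and ?a = "\<alpha> (Suc s)"
  let ?n = "side d s ?i"
  have IH: "conn (x, f) (y, g)"
    if "same_box (Suc s) s x y" "(x, f) \<in> cells d m" "(y, g) \<in> cells d m" for x y f g
    using Suc.IH that same_box_Suc by blast
  have down: "conn (x, f) (x(?i := x ?i - ?n), f)"
    if x: "(x, f) \<in> cells d m" and u: "\<not> 3 dvd (x ?i + ?a ?i) div ?n" for x f
  proof -
    have x0: "\<forall>i\<ge>d. x i = 0" using x by (auto simp: cells_def)
    obtain y g where y: "\<forall>i\<ge>d. y i = 0" "g < m" "{(y, g), (y(?i := y ?i + 1), g)} \<in> curve"
      "same_box (Suc s) s (y(?i := y ?i + 1)) x" "same_box (Suc s) s y (x(?i := x ?i - ?n))"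
      using glue_between_boxes[OF x0 refl u] by blast
    have yc: "(y, g) \<in> cells d m" "(y(?i := y ?i + 1), g) \<in> cells d m"
      using y(1,2) smod[of s] by (auto simp: cells_def)
    have xc: "(x(?i := x ?i - ?n), f) \<in> cells d m" using x smod by (simp add: cells_upd)
    have "conn (x, f) (y(?i := y ?i + 1), g)" using IH[OF y(4) yc(2) x] by (rule connected_via_sym)
    moreover have "conn (y(?i := y ?i + 1), g) (y, g)"
      using y(3) by (intro connected_via_edge) (simp add: insert_commute)
    moreover have "conn (y, g) (x(?i := x ?i - ?n), f)" by (rule IH[OF y(5) yc(1) xc])
    ultimately show ?thesis by (blast intro: connected_via_trans)
  qed
  have base: "\<exists>z. (z, f) \<in> cells d m \<and> conn (x, f) (z, f) \<and>
      (\<forall>l<d. l \<noteq> ?i \<longrightarrow> z l = x l) \<and> (z ?i + ?a ?i) div ?n = 3 * ((x ?i + ?a ?i) div (3 * ?n))"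
    if x: "(x, f) \<in> cells d m" for x f
  proof -
    define u where "u = (x ?i + ?a ?i) div ?n"
    have u3: "(x ?i + ?a ?i) div (3 * ?n) = u div 3"
      unfolding u_def by (metis mult.commute zdiv_zmult2_eq zero_le_numeral)
    have step: "(x ?i - c * ?n + ?a ?i) div ?n = u - c" for c
    proof -
      have eq: "x ?i - c * ?n + ?a ?i = (x ?i + ?a ?i) + (- c) * ?n" by simp
      have "(x ?i - c * ?n + ?a ?i) div ?n = - c + u"
        unfolding eq u_def by (rule div_mult_self1) simp
      then show ?thesis by simp
    qed
    have c: "(x(?i := x ?i - c * ?n), f) \<in> cells d m" for c using x smod by (simp add: cells_upd)
    consider "u mod 3 = 0" | "u mod 3 = 1" | "u mod 3 = 2" by linarith
    then show ?thesis
    proof cases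
      case 1
      then show ?thesis using x u3 u_def by (intro exI[of _ x]) auto
    next
      case 2
      then have "\<not> 3 dvd u" "u - 1 = 3 * (u div 3)" by presburger+
      then show ?thesis using down[OF x] c[of 1] step[of 1] u3
        by (intro exI[of _ "x(?i := x ?i - ?n)"]) (simp add: u_def)
    next
      case 3
      then have 3: "\<not> 3 dvd u" "\<not> 3 dvd u - 1" "u - 2 = 3 * (u div 3)" by presburger+
      let ?x1 = "x(?i := x ?i - ?n)"
      have "conn (x, f) (?x1, f)" using down[OF x] 3(1) by (simp add: u_def)
      moreover have "conn (?x1, f) (x(?i := x ?i - 2 * ?n), f)"
        using down[of ?x1 f] c[of 1] step[of 1] 3(2) by simp
      ultimately have "conn (x, f) (x(?i := x ?i - 2 * ?n), f)" by (rule connected_via_trans)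
      then show ?thesis using c[of 2] step[of 2] u3 3(3)
        by (intro exI[of _ "x(?i := x ?i - 2 * ?n)"]) simp
    qed
  qed
  obtain x' where x': "(x', f) \<in> cells d m" "conn (x, f) (x', f)" "\<forall>l<d. l \<noteq> ?i \<longrightarrow> x' l = x l"
    "(x' ?i + ?a ?i) div ?n = 3 * ((x ?i + ?a ?i) div (3 * ?n))" using base[OF Suc.prems(2)] by blast
  obtain y' where y': "(y', g) \<in> cells d m" "conn (y, g) (y', g)" "\<forall>l<d. l \<noteq> ?i \<longrightarrow> y' l = y l"
    "(y' ?i + ?a ?i) div ?n = 3 * ((y ?i + ?a ?i) div (3 * ?n))" using base[OF Suc.prems(3)] by blast
  have "same_box (Suc s) s x' y'"
    unfolding same_box_def
  proof (intro allI impI)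
    fix l assume l: "l < d"
    have xy: "(x l + ?a l) div side d (Suc s) l = (y l + ?a l) div side d (Suc s) l"
      using Suc.prems(1) l by (simp add: same_box_def)
    show "(x' l + ?a l) div side d s l = (y' l + ?a l) div side d s l"
    proof (cases "l = ?i")
      case True
      then show ?thesis using xy x'(4) y'(4) by simp
    next
      case False
      then show ?thesis using xy x'(3) y'(3) l by simp
    qed
  qed
  from IH[OF this x'(1) y'(1)] show ?case
    using x'(2) y'(2) by (meson connected_via_trans connected_via_sym)
qed

text \<open>At a stage where the face between the two cells is not a wall, they lie in one
  box.\<close>

lemma conn_step:
  assumes "(x, f) \<in> cells d m" "i < d"
  shows "conn (x, f) (x(i := x i + 1), f)"
proof -
  obtain s where s: "\<not> side d s i dvd x i + 1 + \<alpha> s i" using generic[OF assms(2), of "x i + 1"] by blast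
  have eq: "x i + 1 + \<alpha> s i = (x i + \<alpha> s i) + 1" by simp
  have "(x i + 1 + \<alpha> s i) div side d s i = (x i + \<alpha> s i) div side d s i"
    using s unfolding eq by (intro div_add_1_eq side_pos)
  then have "same_box s s x (x(i := x i + 1))" by (auto simp: same_box_def)
  then show ?thesis using assms by (intro conn_same_box) (auto simp: cells_upd)
qed

lemma conn_upd:
  assumes "(x, f) \<in> cells d m" "i < d"
  shows "conn (x, f) (x(i := z), f)"
proof -
  have up: "conn (x, f) (x(i := x i + int k), f)" if "(x, f) \<in> cells d m" for k x
  proof (induction k)
    case (Suc k)
    have "(x(i := x i + int k), f) \<in> cells d m" using that assms(2) by (simp add: cells_upd)
    from conn_step[OF this assms(2)] have "conn (x(i := x i + int k), f) (x(i := x i + int (Suc k)), f)"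
      by (simp add: ac_simps)
    with Suc show ?case by (rule connected_via_trans)
  qed simp
  show ?thesis
  proof (cases "x i \<le> z")
    case True
    then show ?thesis using up[OF assms(1), of "nat (z - x i)"] by simp
  next
    case False
    have "(x(i := z), f) \<in> cells d m" using assms by (simp add: cells_upd)
    from up[OF this, of "nat (x i - z)"] False have "conn (x(i := z), f) (x, f)" by simp
    then show ?thesis by (rule connected_via_sym)
  qed
qed

lemma conn_all:
  assumes "(x, f) \<in> cells d m" "(y, g) \<in> cells d m"
  shows "conn (x, f) (y, g)"
proof -
  have "conn (x, f) ((\<lambda>i. if i < k then y i else x i), f)" if "k \<le> d" for k
    using that
  proof (induction k)
    case (Suc k)
    let ?z = "\<lambda>i. if i < k then y i else x i"
    have "(?z, f) \<in> cells d m" using assms by (auto simp: cells_def)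
    from conn_upd[OF this, of k "y k"] Suc.prems have 1: "conn (?z, f) (?z(k := y k), f)" by simp
    have eq: "?z(k := y k) = (\<lambda>i. if i < Suc k then y i else x i)" by auto
    show ?case
      by (rule connected_via_trans[OF Suc.IH[OF Suc_leD[OF Suc.prems]] 1[unfolded eq]])
  qed simp
  from this[OF order.refl] have "conn (x, f) ((\<lambda>i. if i < d then y i else x i), f)" .
  moreover have eq: "(\<lambda>i. if i < d then y i else x i) = y"
    using assms by (intro ext) (simp add: cells_def)
  ultimately have "conn (x, f) (y, f)" by (simp only:)
  moreover have "conn (y, f) (y, g)"
    using assms by (intro conn_column) (simp_all add: cells_def)
  ultimately show ?thesis by (rule connected_via_trans)
qed

end

section \<open>Grid coordinates on Abelian groups\<close>

context comm_group
begin

text \<open>Representations \<open>h \<otimes> t [^] k\<close> are unique up to exponents whose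
  power of \<open>t\<close> lies in \<open>H\<close>; this gives injectivity both for a new free
  coordinate and for a lengthened path.\<close>

lemma adjoin_int_pow_diff:
  assumes H: "subgroup H G" and t: "t \<in> carrier G" and h: "h \<in> H" "h' \<in> H"
    and eq: "h \<otimes> t [^] (k::int) = h' \<otimes> t [^] l"
  shows "t [^] (k - l) \<in> H"
proof -
  have hc: "h \<in> carrier G" "h' \<in> carrier G" using h subgroup.mem_carrier[OF H] by auto
  have "t [^] (k - l) = t [^] k \<otimes> inv (t [^] l)" using t by (rule int_pow_diff)
  also have "t [^] k = inv h \<otimes> (h \<otimes> t [^] k)" using hc t by (simp add: m_assoc[symmetric])
  also have "\<dots> = inv h \<otimes> (h' \<otimes> t [^] l)" by (simp only: eq)
  also have "\<dots> \<otimes> inv (t [^] l) = inv h \<otimes> h'" using hc t by (simp add: m_assoc)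
  finally show ?thesis using H h by (simp add: subgroup.m_closed subgroup.m_inv_closed)
qed

definition adjoin :: "'a set \<Rightarrow> 'a \<Rightarrow> 'a set" where
  "adjoin H t = {h \<otimes> t [^] (k::int) | h k. h \<in> H}"

lemma subgroup_adjoin:
  assumes H: "subgroup H G" and t: "t \<in> carrier G"
  shows "subgroup (adjoin H t) G" "H \<subseteq> adjoin H t" "t \<in> adjoin H t"
proof -
  have Hc: "h \<in> carrier G" if "h \<in> H" for h using that by (rule subgroup.mem_carrier[OF H])
  have one: "\<one> \<in> H" using H by (rule subgroup.one_closed)
  show sub: "H \<subseteq> adjoin H t"
  proof
    fix h assume h: "h \<in> H"
    then have "h = h \<otimes> t [^] (0::int)" using Hc by simp
    then show "h \<in> adjoin H t" using h unfolding adjoin_def by blast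
  qed
  have "t = \<one> \<otimes> t [^] (1::int)" using t by simp
  then show "t \<in> adjoin H t" using one unfolding adjoin_def by blast
  show "subgroup (adjoin H t) G"
  proof (rule subgroupI)
    show "adjoin H t \<subseteq> carrier G" using Hc t by (auto simp: adjoin_def)
    show "adjoin H t \<noteq> {}" using one sub by blast
  next
    fix a assume "a \<in> adjoin H t"
    then obtain h k where a: "a = h \<otimes> t [^] (k::int)" "h \<in> H" by (auto simp: adjoin_def)
    then have "inv a = inv h \<otimes> t [^] (- k)"
      using Hc t by (simp add: inv_mult int_pow_neg)
    then show "inv a \<in> adjoin H t" using a(2) subgroup.m_inv_closed[OF H] unfolding adjoin_def by blast
  next
    fix a b assume "a \<in> adjoin H t" "b \<in> adjoin H t"
    then obtain h k h' k' where a: "a = h \<otimes> t [^] (k::int)" "h \<in> H" "b = h' \<otimes> t [^] (k'::int)" "h' \<in> H"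
      by (auto simp: adjoin_def)
    then have "a \<otimes> b = (h \<otimes> h') \<otimes> t [^] (k + k')"
      using Hc t by (simp add: int_pow_mult m_ac)
    then show "a \<otimes> b \<in> adjoin H t" using a(2,4) subgroup.m_closed[OF H] unfolding adjoin_def by blast
  qed
qed

text \<open>Elements of \<open>H\<close> are written uniquely as \<open>\<phi> x \<otimes> w f\<close> with \<open>(x, f) \<in> cells d m\<close>: \<open>\<phi>\<close> embeds
  \<open>\<int>\<^sup>d\<close>, and \<open>w\<close> is a path through representatives of the finitely many cosets. Grid steps are steps by
  elements of \<open>S\<close>.\<close>

definition grid_coordinates ::
    "'a set \<Rightarrow> 'a set \<Rightarrow> nat \<Rightarrow> nat \<Rightarrow> ((nat \<Rightarrow> int) \<Rightarrow> 'a) \<Rightarrow> (nat \<Rightarrow> 'a) \<Rightarrow> bool" where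
  "grid_coordinates S H d m \<phi> w \<longleftrightarrow> m > 0 \<and> (\<forall>x y. \<phi> (\<lambda>i. x i + y i) = \<phi> x \<otimes> \<phi> y) \<and>
     range \<phi> \<subseteq> carrier G \<and> (\<forall>x y. (\<forall>i<d. x i = y i) \<longrightarrow> \<phi> x = \<phi> y) \<and>
     (\<forall>i<d. \<phi> (\<lambda>j. of_bool (j = i)) \<in> S) \<and> range w \<subseteq> carrier G \<and>
     (\<forall>f. Suc f < m \<longrightarrow> (\<exists>s\<in>S. w (Suc f) = w f \<otimes> s)) \<and>
     bij_betw (\<lambda>(x, f). \<phi> x \<otimes> w f) (cells d m) H"

lemma grid_coordinatesD:
  assumes "grid_coordinates S H d m \<phi> w"
  shows "m > 0" "\<phi> (\<lambda>i. x i + y i) = \<phi> x \<otimes> \<phi> y" "\<phi> x \<in> carrier G"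
    "\<forall>i<d. x i = y i \<Longrightarrow> \<phi> x = \<phi> y" "i < d \<Longrightarrow> \<phi> (\<lambda>j. of_bool (j = i)) \<in> S"
    "w f \<in> carrier G" "Suc f < m \<Longrightarrow> \<exists>s\<in>S. w (Suc f) = w f \<otimes> s"
    "bij_betw (\<lambda>(x, f). \<phi> x \<otimes> w f) (cells d m) H"
  using assms unfolding grid_coordinates_def image_subset_iff by (elim conjE; simp)+

lemma grid_coordinatesI:
  assumes "m > 0" "\<And>x y. \<phi> (\<lambda>i. x i + y i) = \<phi> x \<otimes> \<phi> y" "\<And>x. \<phi> x \<in> carrier G"
    "\<And>x y. \<forall>i<d. x i = y i \<Longrightarrow> \<phi> x = \<phi> y" "\<And>i. i < d \<Longrightarrow> \<phi> (\<lambda>j. of_bool (j = i)) \<in> S"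
    "\<And>f. w f \<in> carrier G" "\<And>f. Suc f < m \<Longrightarrow> \<exists>s\<in>S. w (Suc f) = w f \<otimes> s"
    "bij_betw (\<lambda>(x, f). \<phi> x \<otimes> w f) (cells d m) H"
  shows "grid_coordinates S H d m \<phi> w"
  unfolding grid_coordinates_def image_subset_iff
  by (intro conjI allI impI ballI assms) simp_all

lemma grid_coordinates_zero:
  assumes gc: "grid_coordinates S H d m \<phi> w" and "\<forall>i<d. x i = 0"
  shows "\<phi> x = \<one>"
proof -
  have "\<phi> x = \<phi> (\<lambda>i. x i + x i)" by (rule grid_coordinatesD(4)[OF gc]) (use assms(2) in simp)
  also have "\<dots> = \<phi> x \<otimes> \<phi> x" by (rule grid_coordinatesD(2)[OF gc])
  finally show ?thesis using grid_coordinatesD(3)[OF gc] by (metis l_cancel_one')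
qed

lemma grid_coordinates_truncate:
  assumes "grid_coordinates S H d m \<phi> w"
  shows "\<phi> x = \<phi> (\<lambda>i. if i < d then x i else 0)"
  by (rule grid_coordinatesD(4)[OF assms]) simp

lemma grid_coordinates_in:
  assumes gc: "grid_coordinates S H d m \<phi> w" and "f < m"
  shows "\<phi> x \<otimes> w f \<in> H"
proof -
  note bij = grid_coordinatesD(8)[OF gc]
  have "((\<lambda>i. if i < d then x i else 0), f) \<in> cells d m" using assms(2) by (auto simp: cells_def)
  from bij_betwE[OF bij, rule_format, OF this] show ?thesis
    using grid_coordinates_truncate[OF gc, of x] by simp
qed

lemma grid_coordinates_inj:
  assumes gc: "grid_coordinates S H d m \<phi> w" and "f < m" "g < m"
    and eq: "\<phi> x \<otimes> w f = \<phi> y \<otimes> w g"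
  shows "f = g" "\<forall>i<d. x i = y i"
proof -
  have inj: "inj_on (\<lambda>(x, f). \<phi> x \<otimes> w f) (cells d m)"
    using grid_coordinatesD(8)[OF gc] unfolding bij_betw_def by blast
  let ?t = "\<lambda>(x::nat \<Rightarrow> int) i. if i < d then x i else 0"
  have c: "(?t x, f) \<in> cells d m" "(?t y, g) \<in> cells d m" using assms by (auto simp: cells_def)
  have "\<phi> (?t x) \<otimes> w f = \<phi> (?t y) \<otimes> w g" using eq grid_coordinates_truncate[OF gc] by metis
  then have "(?t x, f) = (?t y, g)" using inj_onD[OF inj _ c] by simp
  then show "f = g" "\<forall>i<d. x i = y i" by (auto dest: fun_cong) (metis (full_types))
qed

lemma grid_coordinates_surj:
  assumes gc: "grid_coordinates S H d m \<phi> w" and "h \<in> H"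
  obtains x f where "(x, f) \<in> cells d m" "h = \<phi> x \<otimes> w f"
proof -
  have "(\<lambda>(x, f). \<phi> x \<otimes> w f) ` cells d m = H"
    using grid_coordinatesD(8)[OF gc] unfolding bij_betw_def by blast
  with assms(2) that show thesis by auto
qed

lemma grid_coordinates_trivial: "grid_coordinates S {\<one>} 0 1 (\<lambda>_. \<one>) (\<lambda>_. \<one>)"
proof -
  have "cells 0 1 = {(\<lambda>_. 0, 0)}" by (auto simp: cells_def)
  then show ?thesis by (simp add: grid_coordinates_def bij_betw_def)
qed

text \<open>No nontrivial power of \<open>t\<close> falls back into \<open>H\<close>, so
  \<open>t\<close> opens a new integer coordinate, number \<open>d\<close>, and the path stays as it
  is.\<close>

lemma grid_coordinates_free:
  assumes gc: "grid_coordinates S H d m \<phi> w" and H: "subgroup H G" and t: "t \<in> S" "S \<subseteq> carrier G"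
    and free: "\<And>k::int. t [^] k \<in> H \<Longrightarrow> k = 0"
  shows "grid_coordinates S (adjoin H t) (Suc d) m (\<lambda>x. \<phi> x \<otimes> t [^] x d) w"
proof -
  have tc: "t \<in> carrier G" using t by blast
  have \<phi>c: "\<phi> z \<in> carrier G" and wc: "w f \<in> carrier G" for z f
    using grid_coordinatesD(3,6)[OF gc] by blast+
  have add: "\<phi> (\<lambda>i. x i + y i) = \<phi> x \<otimes> \<phi> y" for x y by (rule grid_coordinatesD(2)[OF gc])
  have loc: "\<phi> x = \<phi> y" if "\<forall>i<d. x i = y i" for x y using that by (rule grid_coordinatesD(4)[OF gc])
  have swap: "\<phi> x \<otimes> t [^] k \<otimes> w f = \<phi> x \<otimes> w f \<otimes> t [^] k" for x f and k :: int
    using \<phi>c wc tc by (simp add: m_ac)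
  have "bij_betw (\<lambda>(x, f). \<phi> x \<otimes> t [^] x d \<otimes> w f) (cells (Suc d) m) (adjoin H t)"
    unfolding bij_betw_def
  proof (intro conjI inj_onI)
    fix p q assume p: "p \<in> cells (Suc d) m" and q: "q \<in> cells (Suc d) m"
      and eq: "(case p of (x, f) \<Rightarrow> \<phi> x \<otimes> t [^] x d \<otimes> w f) = (case q of (x, f) \<Rightarrow> \<phi> x \<otimes> t [^] x d \<otimes> w f)"
    obtain x f y g where pq: "p = (x, f)" "q = (y, g)" by (metis surj_pair)
    have fg: "f < m" "g < m" using p q by (auto simp: pq cells_def)
    have e: "\<phi> x \<otimes> w f \<otimes> t [^] x d = \<phi> y \<otimes> w g \<otimes> t [^] y d" using eq by (simp add: pq swap)
    have "t [^] (x d - y d) \<in> H"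
      by (rule adjoin_int_pow_diff[OF H tc grid_coordinates_in[OF gc fg(1)] grid_coordinates_in[OF gc fg(2)] e])
    then have xy: "x d = y d" using free by fastforce
    then have "\<phi> x \<otimes> w f = \<phi> y \<otimes> w g" using e \<phi>c wc tc by simp
    from grid_coordinates_inj[OF gc fg this] xy have "f = g" "\<forall>i<Suc d. x i = y i"
      by (auto simp: less_Suc_eq)
    moreover have "x i = y i" for i
      using p q \<open>\<forall>i<Suc d. x i = y i\<close> by (cases "i < Suc d") (simp_all add: pq cells_def)
    then have "x = y" by (rule ext)
    ultimately show "p = q" by (simp add: pq)
  next
    show "(\<lambda>(x, f). \<phi> x \<otimes> t [^] x d \<otimes> w f) ` cells (Suc d) m = adjoin H t"
    proof
      show "(\<lambda>(x, f). \<phi> x \<otimes> t [^] x d \<otimes> w f) ` cells (Suc d) m \<subseteq> adjoin H t"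
        using grid_coordinates_in[OF gc] by (auto simp: swap adjoin_def cells_def)
      show "adjoin H t \<subseteq> (\<lambda>(x, f). \<phi> x \<otimes> t [^] x d \<otimes> w f) ` cells (Suc d) m"
      proof
        fix a assume "a \<in> adjoin H t"
        then obtain h k where a: "a = h \<otimes> t [^] (k::int)" "h \<in> H" by (auto simp: adjoin_def)
        obtain x f where x: "(x, f) \<in> cells d m" "h = \<phi> x \<otimes> w f" using grid_coordinates_surj[OF gc a(2)] .
        have c: "(x(d := k), f) \<in> cells (Suc d) m" using x(1) by (auto simp: cells_def)
        have "\<phi> (x(d := k)) = \<phi> x" by (rule loc) simp
        then have "(case (x(d := k), f) of (x, f) \<Rightarrow> \<phi> x \<otimes> t [^] x d \<otimes> w f) = a"
          by (simp add: a x(2) swap)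
        then show "a \<in> (\<lambda>(x, f). \<phi> x \<otimes> t [^] x d \<otimes> w f) ` cells (Suc d) m"
          using rev_image_eqI[OF c, where f = "\<lambda>(x, f). \<phi> x \<otimes> t [^] x d \<otimes> w f"] by simp
      qed
    qed
  qed
  moreover have "\<phi> (\<lambda>j. of_bool (j = i)) \<otimes> t [^] (of_bool (d = i) :: int) \<in> S" if "i < Suc d" for i
  proof (cases "i = d")
    case True
    have "\<phi> (\<lambda>j. of_bool (j = i)) = \<one>" by (rule grid_coordinates_zero[OF gc]) (simp add: True)
    then show ?thesis using True t tc by simp
  next
    case False
    then have "\<phi> (\<lambda>j. of_bool (j = i)) \<in> S" using that by (intro grid_coordinatesD(5)[OF gc]) simp
    then show ?thesis using False \<phi>c by simp
  qed
  moreover have "\<phi> (\<lambda>i. x i + y i) \<otimes> t [^] (x d + y d) = \<phi> x \<otimes> t [^] x d \<otimes> (\<phi> y \<otimes> t [^] y d)" for x y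
    using \<phi>c tc by (simp add: add int_pow_mult m_ac)
  moreover have "\<phi> x \<otimes> t [^] x d = \<phi> y \<otimes> t [^] y d" if "\<forall>i<Suc d. x i = y i" for x y
    using loc[of x y] that by simp
  ultimately show ?thesis
    using grid_coordinatesD(1,7)[OF gc] \<phi>c wc tc by (intro grid_coordinatesI) simp_all
qed

text \<open>Only finitely many cosets of \<open>H\<close> are added, so the lattice stays and the
  path grows: it runs through the old path, steps by \<open>t\<close>, runs back, steps by
  \<open>t\<close> again, and so on. Running back uses that \<open>S\<close> contains
  inverses.\<close>

lemma grid_coordinates_torsion:
  assumes gc: "grid_coordinates S H d m \<phi> w" and H: "subgroup H G" and t: "t \<in> S" "S \<subseteq> carrier G"
    and inv: "\<And>s. s \<in> S \<Longrightarrow> inv s \<in> S"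
    and tors: "t [^] (k0::int) \<in> H" "k0 \<noteq> 0"
  obtains m' w' where "grid_coordinates S (adjoin H t) d m' \<phi> w'"
proof -
  have tc: "t \<in> carrier G" using t by blast
  have \<phi>c: "\<phi> z \<in> carrier G" and wc: "w f \<in> carrier G" for z f
    using grid_coordinatesD(3,6)[OF gc] by blast+
  have m: "m > 0" by (rule grid_coordinatesD(1)[OF gc])
  \<comment> \<open>The number of cosets of \<open>H\<close> in the enlarged group.\<close>
  define r where "r = (LEAST r::nat. r > 0 \<and> t [^] (int r) \<in> H)"
  have "t [^] (int (nat \<bar>k0\<bar>)) \<in> H"
  proof (cases "k0 \<ge> 0")
    case False
    have "t [^] (- k0) = inv (t [^] k0)" using tc by (rule int_pow_neg)
    then show ?thesis using False tors(1) subgroup.m_inv_closed[OF H] by simp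
  qed (use tors in simp)
  then have "nat \<bar>k0\<bar> > 0 \<and> t [^] (int (nat \<bar>k0\<bar>)) \<in> H" using tors(2) by simp
  then have r: "r > 0 \<and> t [^] (int r) \<in> H" unfolding r_def by (rule LeastI)
  have rmin: "j = 0" if "j < r" "t [^] (int j) \<in> H" for j
    using not_less_Least[of j "\<lambda>r. r > 0 \<and> t [^] (int r) \<in> H"] that unfolding r_def by auto
  define refl where "refl j p = (if even j then p else m - 1 - p)" for j p :: nat
  have refl: "refl j p < m" "refl j (refl j p) = p" if "p < m" for j p
    using that by (auto simp: refl_def)
  define w' where "w' f = w (refl (f div m) (f mod m)) \<otimes> t [^] (int (f div m))" for f
  have eqw: "\<phi> x \<otimes> w' f = \<phi> x \<otimes> w (refl (f div m) (f mod m)) \<otimes> t [^] (int (f div m))" for x f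
    using \<phi>c wc tc by (simp add: w'_def m_assoc)
  have inH: "\<phi> x \<otimes> w (refl (f div m) (f mod m)) \<in> H" for x f
    by (rule grid_coordinates_in[OF gc refl(1)]) (use m in simp)
  have "bij_betw (\<lambda>(x, f). \<phi> x \<otimes> w' f) (cells d (r * m)) (adjoin H t)"
    unfolding bij_betw_def
  proof (intro conjI inj_onI)
    fix p q assume p: "p \<in> cells d (r * m)" and q: "q \<in> cells d (r * m)"
      and eq: "(case p of (x, f) \<Rightarrow> \<phi> x \<otimes> w' f) = (case q of (x, f) \<Rightarrow> \<phi> x \<otimes> w' f)"
    obtain x f y g where pq: "p = (x, f)" "q = (y, g)" by (metis surj_pair)
    have fg: "f div m < r" "g div m < r"
      using p q by (auto simp: pq cells_def less_mult_imp_div_less)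
    have e: "\<phi> x \<otimes> w (refl (f div m) (f mod m)) \<otimes> t [^] (int (f div m)) =
        \<phi> y \<otimes> w (refl (g div m) (g mod m)) \<otimes> t [^] (int (g div m))" using eq by (simp add: pq eqw)
    have "t [^] (int (f div m) - int (g div m)) \<in> H"
      by (rule adjoin_int_pow_diff[OF H tc inH inH e])
    moreover have "t [^] (int (g div m) - int (f div m)) \<in> H"
      by (rule adjoin_int_pow_diff[OF H tc inH inH e[symmetric]])
    ultimately have dv: "f div m = g div m"
      using rmin[of "f div m - g div m"] rmin[of "g div m - f div m"] fg
      by (cases "f div m \<le> g div m") (simp_all add: of_nat_diff less_imp_diff_less)
    then have "\<phi> x \<otimes> w (refl (f div m) (f mod m)) = \<phi> y \<otimes> w (refl (g div m) (g mod m))"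
      using e \<phi>c wc tc by simp
    from grid_coordinates_inj[OF gc refl(1) refl(1) this] m dv
    have "refl (f div m) (f mod m) = refl (f div m) (g mod m)" and xy: "\<forall>i<d. x i = y i" by auto
    then have "f mod m = g mod m" using refl(2) m by (metis mod_less_divisor)
    with dv have "f = g" by (metis div_mult_mod_eq)
    moreover have "x i = y i" for i using p q xy by (cases "i < d") (auto simp: pq cells_def)
    then have "x = y" by auto
    ultimately show "p = q" by (simp add: pq)
  next
    show "(\<lambda>(x, f). \<phi> x \<otimes> w' f) ` cells d (r * m) = adjoin H t"
    proof
      show "(\<lambda>(x, f). \<phi> x \<otimes> w' f) ` cells d (r * m) \<subseteq> adjoin H t"
        using inH by (auto simp: eqw adjoin_def)
      show "adjoin H t \<subseteq> (\<lambda>(x, f). \<phi> x \<otimes> w' f) ` cells d (r * m)"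
      proof
        fix a assume "a \<in> adjoin H t"
        then obtain h k where a: "a = h \<otimes> t [^] (k::int)" "h \<in> H" by (auto simp: adjoin_def)
        define j where "j = nat (k mod int r)"
        have j: "j < r" "int j = k mod int r" using r by (simp_all add: j_def nat_less_iff)
        \<comment> \<open>The full multiples of \<open>r\<close> in the exponent are absorbed into
          \<open>H\<close>, leaving the remainder \<open>j\<close>.\<close>
        define h' where "h' = h \<otimes> (t [^] (int r)) [^] (k div int r)"
        have hc: "h \<in> carrier G" using a(2) by (rule subgroup.mem_carrier[OF H])
        have h': "h' \<in> H"
          unfolding h'_def
          by (rule subgroup.m_closed[OF H a(2) subgroup_int_pow_closed[OF H conjunct2[OF r]]])
        have "k = int r * (k div int r) + int j" by (simp add: j(2))
        then have "t [^] k = (t [^] (int r)) [^] (k div int r) \<otimes> t [^] (int j)"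
          using tc by (metis int_pow_mult int_pow_pow)
        then have a': "a = h' \<otimes> t [^] (int j)"
          using hc tc by (simp add: a(1) h'_def m_assoc)
        obtain x q where x: "(x, q) \<in> cells d m" "h' = \<phi> x \<otimes> w q" using grid_coordinates_surj[OF gc h'] .
        have q: "q < m" using x(1) by (simp add: cells_def)
        let ?f = "j * m + refl j q"
        have div: "?f div m = j" "?f mod m = refl j q" using refl(1)[OF q, of j] by simp_all
        have "?f < r * m"
        proof -
          have "?f < (j + 1) * m" using refl(1)[OF q, of j] by simp
          also have "\<dots> \<le> r * m" using j(1) by (intro mult_right_mono) auto
          finally show ?thesis .
        qed
        then have c: "(x, ?f) \<in> cells d (r * m)" using x(1) by (simp add: cells_def)
        have "(case (x, ?f) of (x, f) \<Rightarrow> \<phi> x \<otimes> w' f) = a"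
          unfolding prod.case eqw div refl(2)[OF q] by (simp add: a' x(2))
        then show "a \<in> (\<lambda>(x, f). \<phi> x \<otimes> w' f) ` cells d (r * m)"
          using rev_image_eqI[OF c, where f = "\<lambda>(x, f). \<phi> x \<otimes> w' f"] by simp
      qed
    qed
  qed
  moreover have "\<exists>s\<in>S. w' (Suc f) = w' f \<otimes> s" if "Suc f < r * m" for f
  proof (cases "Suc (f mod m) < m")
    case True
    let ?j = "f div m" and ?p = "f mod m"
    have dm: "Suc f div m = ?j" "Suc f mod m = Suc ?p"
      using True by (simp_all add: div_Suc mod_Suc)
    have "\<exists>s\<in>S. w (refl ?j (Suc ?p)) = w (refl ?j ?p) \<otimes> s"
    proof (cases "even ?j")
      case True
      with grid_coordinatesD(7)[OF gc \<open>Suc ?p < m\<close>] show ?thesis by (simp add: refl_def)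
    next
      case False
      let ?q = "m - 1 - Suc ?p"
      have q: "Suc ?q = m - 1 - ?p" "Suc ?q < m" using \<open>Suc ?p < m\<close> by auto
      obtain s where s: "s \<in> S" "w (Suc ?q) = w ?q \<otimes> s" using grid_coordinatesD(7)[OF gc q(2)] by blast
      then have "w ?q = w (Suc ?q) \<otimes> inv s" using wc t(2) by (metis inv_solve_right subsetD)
      then show ?thesis using False s(1) inv q(1) unfolding refl_def by auto
    qed
    then obtain s where s: "s \<in> S" "w (refl ?j (Suc ?p)) = w (refl ?j ?p) \<otimes> s" by blast
    then have "s \<in> carrier G" using t(2) by blast
    with s(2) have "w' (Suc f) = w' f \<otimes> s"
      unfolding w'_def dm using wc tc by (simp add: m_ac)
    with s(1) show ?thesis by blast
  next
    case False
    let ?j = "f div m" and ?p = "f mod m"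
    have p: "Suc ?p = m" using False m mod_less_divisor[of m f] by linarith
    then have dm: "Suc f div m = Suc ?j" "Suc f mod m = 0"
      using m by (simp_all add: div_Suc mod_Suc)
    \<comment> \<open>At a turn the old representative does not change, so the step is by
      \<open>t\<close> alone.\<close>
    have "refl (Suc ?j) 0 = refl ?j ?p" using p by (auto simp: refl_def)
    then have "w' (Suc f) = w' f \<otimes> t"
      unfolding w'_def dm using wc tc by (simp add: m_assoc int_pow_mult add.commute[of 1])
    then show ?thesis using t by blast
  qed
  moreover have "w' f \<in> carrier G" for f using wc tc by (simp add: w'_def)
  moreover have "r * m > 0" using r m by simp
  ultimately have "grid_coordinates S (adjoin H t) d (r * m) \<phi> w'"
    using grid_coordinatesD(2-5)[OF gc] by (intro grid_coordinatesI) simp_all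
  then show thesis by (rule that)
qed

lemma grid_coordinates_exist:
  assumes "finite T" "T \<subseteq> S" "S \<subseteq> carrier G" and inv: "\<And>s. s \<in> S \<Longrightarrow> inv s \<in> S"
  shows "\<exists>H d m \<phi> w. subgroup H G \<and> T \<subseteq> H \<and> grid_coordinates S H d m \<phi> w"
  using assms(1,2)
proof induction
  case empty
  show ?case using grid_coordinates_trivial triv_subgroup by blast
next
  case (insert t T)
  then obtain H d m \<phi> w where H: "subgroup H G" "T \<subseteq> H" "grid_coordinates S H d m \<phi> w" by auto
  have t: "t \<in> S" "t \<in> carrier G" using insert assms(3) by auto
  have "insert t T \<subseteq> adjoin H t" using subgroup_adjoin[OF H(1) t(2)] H(2) by blast
  moreover have "\<exists>d m \<phi> w. grid_coordinates S (adjoin H t) d m \<phi> w"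
  proof (cases "\<exists>k::int. t [^] k \<in> H \<and> k \<noteq> 0")
    case True
    then show ?thesis using grid_coordinates_torsion[OF H(3,1) t(1) assms(3) inv] by metis
  next
    case False
    then show ?thesis using grid_coordinates_free[OF H(3,1) t(1) assms(3)] by blast
  qed
  ultimately show ?case using subgroup_adjoin(1)[OF H(1) t(2)] by blast
qed

end

section \<open>Invariant double rays in Abelian groups\<close>

text \<open>The data of stage \<open>k\<close>: a residue of the shift for each of the
  \<open>d\<close> directions, and the index \<open>f\<close> of the representative
  \<open>w f\<close> that serves as base point of the grid. The index is the same at all
  stages.\<close>

definition residue_box :: "nat \<Rightarrow> nat \<Rightarrow> nat \<Rightarrow> cell set" where
  "residue_box d m k = ({..<d} \<rightarrow>\<^sub>E {0..<2 * 3 ^ k}) \<times> {..<m}"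

definition reduce :: "nat \<Rightarrow> nat \<Rightarrow> cell \<Rightarrow> cell" where
  "reduce d k = (\<lambda>(a, f). (\<lambda>i\<in>{..<d}. a i mod (2 * 3 ^ k), f))"

lemma finite_residue_box: "finite (residue_box d m k)"
  unfolding residue_box_def by (intro finite_cartesian_product finite_PiE) auto

lemma residue_box_range:
  assumes "b \<in> residue_box d m k" "i < d"
  shows "0 \<le> fst b i" "fst b i < 2 * 3 ^ k"
proof -
  have "fst b \<in> {..<d} \<rightarrow>\<^sub>E {0..<2 * 3 ^ k}"
    using assms(1) unfolding residue_box_def mem_Times_iff by blast
  from PiE_mem[OF this, of i] assms(2) show "0 \<le> fst b i" "fst b i < 2 * 3 ^ k" by simp_all
qed

lemma reduce_in_residue_box: "f < m \<Longrightarrow> reduce d k (a, f) \<in> residue_box d m k"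
  by (auto simp: reduce_def residue_box_def)

lemma mod_eq_fiber:
  fixes x v N :: int
  assumes "0 \<le> v" "v < N"
  shows "0 \<le> x \<and> x < 3 * N \<and> x mod N = v \<longleftrightarrow> x \<in> {v, v + N, v + 2 * N}"
proof
  assume x: "0 \<le> x \<and> x < 3 * N \<and> x mod N = v"
  define q where "q = x div N"
  have xq: "x = q * N + v" using x by (metis q_def div_mult_mod_eq)
  have "q < 3"
  proof (rule ccontr)
    assume "\<not> q < 3"
    then have "3 * N \<le> q * N" using assms by (intro mult_right_mono) auto
    then show False using xq x assms by linarith
  qed
  moreover have "0 \<le> q" using x assms by (simp add: q_def pos_imp_zdiv_nonneg_iff)
  ultimately have "q = 0 \<or> q = 1 \<or> q = 2" by linarith
  then show "x \<in> {v, v + N, v + 2 * N}" using xq by auto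
next
  assume "x \<in> {v, v + N, v + 2 * N}"
  then show "0 \<le> x \<and> x < 3 * N \<and> x mod N = v" using assms by auto
qed

lemma card_reduce_fiber:
  assumes b: "b \<in> residue_box d m k"
  shows "card {b' \<in> residue_box d m (Suc k). reduce d k b' = b} = 3 ^ d"
proof -
  let ?N = "2 * 3 ^ k :: int"
  obtain a f where af: "b = (a, f)" by (cases b)
  have a: "a \<in> {..<d} \<rightarrow>\<^sub>E {0..<?N}" and f: "f < m" using b by (auto simp: residue_box_def af)
  have ai: "0 \<le> a i" "a i < ?N" if "i < d" for i using PiE_mem[OF a] that by auto
  let ?P = "{..<d} \<rightarrow>\<^sub>E {0..<2 * 3 ^ Suc k} :: (nat \<Rightarrow> int) set"
  have mem: "0 \<le> x \<and> x < 2 * 3 ^ Suc k \<and> x mod ?N = a i \<longleftrightarrow> x \<in> {a i, a i + ?N, a i + 2 * ?N}"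
    if "i < d" for x i
    using mod_eq_fiber[OF ai[OF that], of x] by simp
  have "{b' \<in> residue_box d m (Suc k). reduce d k b' = b} =
      {a' \<in> ?P. (\<lambda>i\<in>{..<d}. a' i mod ?N) = a} \<times> {f}"
    using f by (auto simp: residue_box_def reduce_def af)
  also have "{a' \<in> ?P. (\<lambda>i\<in>{..<d}. a' i mod ?N) = a} =
      (\<Pi>\<^sub>E i\<in>{..<d}. {a i, a i + ?N, a i + 2 * ?N})"
  proof (rule Set.set_eqI)
    fix a' :: "nat \<Rightarrow> int"
    have "(\<lambda>i\<in>{..<d}. a' i mod ?N) = a \<longleftrightarrow> (\<forall>i<d. a' i mod ?N = a i)"
      using a by (auto simp: fun_eq_iff PiE_def extensional_def)
    then have "a' \<in> {a' \<in> ?P. (\<lambda>i\<in>{..<d}. a' i mod ?N) = a} \<longleftrightarrow>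
        a' \<in> extensional {..<d} \<and> (\<forall>i<d. 0 \<le> a' i \<and> a' i < 2 * 3 ^ Suc k \<and> a' i mod ?N = a i)"
      unfolding mem_Collect_eq PiE_iff by auto
    also have "\<dots> \<longleftrightarrow> a' \<in> extensional {..<d} \<and> (\<forall>i<d. a' i \<in> {a i, a i + ?N, a i + 2 * ?N})"
      using mem by blast
    also have "\<dots> \<longleftrightarrow> a' \<in> (\<Pi>\<^sub>E i\<in>{..<d}. {a i, a i + ?N, a i + 2 * ?N})"
      unfolding PiE_iff by auto
    finally show "a' \<in> {a' \<in> ?P. (\<lambda>i\<in>{..<d}. a' i mod ?N) = a} \<longleftrightarrow>
        a' \<in> (\<Pi>\<^sub>E i\<in>{..<d}. {a i, a i + ?N, a i + 2 * ?N})" .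
  qed
  also have "card ((\<Pi>\<^sub>E i\<in>{..<d}. {a i, a i + ?N, a i + 2 * ?N}) \<times> {f}) = 3 ^ d"
    by (simp add: card_cartesian_product card_PiE eval_nat_numeral)
  finally show ?thesis .
qed

lemma odometer_exists:
  assumes "m > 0"
  shows "\<exists>(M :: real measure) Z. uniform_sequence M (residue_box d m) Z \<and>
    (\<forall>k. \<forall>\<omega>\<in>space M. reduce d k (Z (Suc k) \<omega>) = Z k \<omega>)"
proof -
  have "reduce d 0 (\<lambda>_. 0, 0) \<in> residue_box d m 0" using assms by (rule reduce_in_residue_box)
  then have ne: "residue_box d m 0 \<noteq> {}" by blast
  have c: "(3::nat) ^ d > 0" by simp
  have sub: "reduce d k ` residue_box d m (Suc k) \<subseteq> residue_box d m k" for k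
  proof
    fix b assume "b \<in> reduce d k ` residue_box d m (Suc k)"
    then obtain a f where "b = reduce d k (a, f)" "f < m" by (auto simp: residue_box_def)
    then show "b \<in> residue_box d m k" by (simp only: reduce_in_residue_box)
  qed
  show ?thesis
  proof (rule uniform_inverse_sequence_exists[where B = "residue_box d m" and \<rho> = "reduce d" and c = "3 ^ d",
        OF finite_residue_box ne sub card_reduce_fiber c])
    fix M :: "real measure" and Z
    assume "prob_space M" "\<And>k \<omega>. \<omega> \<in> space M \<Longrightarrow> Z k \<omega> \<in> residue_box d m k"
      and red: "\<And>k \<omega>. \<omega> \<in> space M \<Longrightarrow> reduce d k (Z (Suc k) \<omega>) = Z k \<omega>"
      and "\<And>k. Z k \<in> M \<rightarrow>\<^sub>M count_space UNIV"
        "\<And>k b. b \<in> residue_box d m k \<Longrightarrow>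
          measure M {\<omega> \<in> space M. Z k \<omega> = b} = 1 / card (residue_box d m k)"
    then have "uniform_sequence M (residue_box d m) Z"
      by (simp add: uniform_sequence_def uniform_sequence_axioms_def finite_residue_box)
    then show ?thesis using red by (intro exI[of _ M] exI[of _ Z]) simp
  qed
qed

text \<open>Adding \<open>t = 0, ..., N - 1\<close> to coordinate \<open>i\<close> moves the class
  where \<open>N\<close> divides \<open>h\<close> to the classes where \<open>h\<close> is congruent
  to \<open>t\<close>. These are disjoint, so the class fills at most one \<open>N\<close>-th of the
  box. Besides single coordinates this covers forms such as \<open>2 * a 0 + a 1\<close>, with
  \<open>i\<close> a coordinate of coefficient 1.\<close>

lemma card_residue_class:
  fixes h :: "(nat \<Rightarrow> int) \<Rightarrow> int"
  assumes i: "i < d" and N: "N > 0" "int N dvd 2 * 3 ^ k"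
    and h: "\<And>a z. int N dvd h (a(i := z)) - h a - (z - a i)"
  shows "N * card {b \<in> residue_box d m k. int N dvd h (fst b)} \<le> card (residue_box d m k)"
proof -
  let ?M = "2 * 3 ^ k :: int"
  let ?A = "{b \<in> residue_box d m k. int N dvd h (fst b)}"
  define g where "g = (\<lambda>(b, t::nat). ((fst b)(i := (fst b i + int t) mod ?M), snd b) :: cell)"
  have hg: "int N dvd h (fst (g (b, t))) - (h (fst b) + int t)" for b t
  proof -
    let ?z = "(fst b i + int t) mod ?M"
    have "?z mod int N = (fst b i + int t) mod int N"
      using N(2) by (rule mod_mod_cancel)
    then have "int N dvd ?z - (fst b i + int t)" by (simp only: mod_eq_dvd_iff)
    from dvd_add[OF h[of "fst b" ?z] this]
    have "int N dvd h ((fst b)(i := ?z)) - h (fst b) - (?z - fst b i) + (?z - (fst b i + int t))" .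
    moreover have "h ((fst b)(i := ?z)) - h (fst b) - (?z - fst b i) + (?z - (fst b i + int t)) =
        h (fst (g (b, t))) - (h (fst b) + int t)"
      unfolding g_def by simp
    ultimately show ?thesis by (simp only:)
  qed
  have inj: "inj_on g (?A \<times> {..<N})"
  proof (rule inj_onI)
    fix p q assume p: "p \<in> ?A \<times> {..<N}" and q: "q \<in> ?A \<times> {..<N}" and eq: "g p = g q"
    obtain b t b' t' where pq: "p = (b, t)" "q = (b', t')" by (metis surj_pair)
    have "int N dvd h (fst (g p)) - int t" if "p = (b, t)" "p \<in> ?A \<times> {..<N}" for p b t
    proof -
      have "int N dvd h (fst b)" using that by simp
      from dvd_add[OF hg[of b t] this] show ?thesis by (simp add: that(1))
    qed
    from dvd_diff[OF this[OF pq(1) p] this[OF pq(2) q]] eq have "int N dvd int t' - int t" by simp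
    then have "int t' mod int N = int t mod int N" by (simp only: mod_eq_dvd_iff)
    then have t: "t = t'" using p q by (simp add: pq)
    have b: "b \<in> residue_box d m k" "b' \<in> residue_box d m k" using p q by (simp_all add: pq)
    note rng = residue_box_range[OF b(1) i] residue_box_range[OF b(2) i]
    have e: "(fst b)(i := (fst b i + int t) mod ?M) = (fst b')(i := (fst b' i + int t) mod ?M)" "snd b = snd b'"
      using eq by (simp_all add: g_def pq t)
    from fun_cong[OF e(1), of i] have "(fst b i + int t) mod ?M = (fst b' i + int t) mod ?M" by simp
    then have "fst b i mod ?M = fst b' i mod ?M" by (simp add: mod_eq_dvd_iff)
    then have "fst b i = fst b' i" using rng by simp
    then have "fst b j = fst b' j" for j
      using fun_cong[OF e(1), of j] by (cases "j = i") simp_all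
    then have "fst b = fst b'" by (rule ext)
    then show "p = q" using e(2) t by (simp add: pq prod_eq_iff)
  qed
  have "g ` (?A \<times> {..<N}) \<subseteq> residue_box d m k"
  proof (rule image_subsetI)
    fix p assume p: "p \<in> ?A \<times> {..<N}"
    obtain a f t where pq: "p = ((a, f), t)" by (metis surj_pair)
    then have a: "a \<in> {..<d} \<rightarrow>\<^sub>E {0..<?M}" "f < m" using p by (simp_all add: residue_box_def)
    have "a(i := (a i + int t) mod ?M) \<in> {..<d} \<rightarrow>\<^sub>E {0..<?M}"
    proof (rule PiE_I)
      show "(a(i := (a i + int t) mod ?M)) j \<in> {0..<?M}" if "j \<in> {..<d}" for j
        using PiE_mem[OF a(1) that] by simp
      show "(a(i := (a i + int t) mod ?M)) j = undefined" if "j \<notin> {..<d}" for j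
        using PiE_arb[OF a(1) that] that i by auto
    qed
    then show "g p \<in> residue_box d m k" using a(2) by (simp add: g_def pq residue_box_def)
  qed
  from card_mono[OF finite_residue_box this] have "card (?A \<times> {..<N}) \<le> card (residue_box d m k)"
    by (simp add: card_image[OF inj])
  then show ?thesis by (simp add: card_cartesian_product mult.commute)
qed

text \<open>Only edges of the ray have to become edges of \<open>G\<close>; further edges of
  \<open>G\<close> between the images do no harm, so a bijection of the vertices is enough.\<close>

lemma double_ray_transfer:
  assumes bij: "bij_betw \<Theta> V (verts G)" and E: "\<And>e. e \<in> E \<Longrightarrow> \<exists>u\<in>V. \<exists>v\<in>V. e = {u, v}"
    and sub: "(`) \<Theta> ` E \<subseteq> edges G"
    and deg: "\<And>v. v \<in> V \<Longrightarrow> card {u. {v, u} \<in> E} = 2"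
    and conn: "\<And>u v. u \<in> V \<Longrightarrow> v \<in> V \<Longrightarrow> connected_via E u v"
  shows "spanning_double_ray G (spanning_subgraph G ((`) \<Theta> ` E))"
proof -
  let ?H = "spanning_subgraph G ((`) \<Theta> ` E)"
  have inj: "inj_on \<Theta> V" and surj: "\<Theta> ` V = verts G" using bij by (auto simp: bij_betw_def)
  have EV: "u \<in> V" "v \<in> V" if "{u, v} \<in> E" for u v
    using E[OF that] by (auto simp: doubleton_eq_iff)
  have edge: "{\<Theta> u, \<Theta> v} \<in> (`) \<Theta> ` E" if "{u, v} \<in> E" for u v
    using imageI[OF that, of "(`) \<Theta>"] by simp
  have nb: "neighbours ?H (\<Theta> v) = \<Theta> ` {u. {v, u} \<in> E}" if v: "v \<in> V" for v
  proof
    show "\<Theta> ` {u. {v, u} \<in> E} \<subseteq> neighbours ?H (\<Theta> v)"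
      using edge by (auto simp: neighbours_def spanning_subgraph_def)
    show "neighbours ?H (\<Theta> v) \<subseteq> \<Theta> ` {u. {v, u} \<in> E}"
    proof
      fix y assume "y \<in> neighbours ?H (\<Theta> v)"
      then obtain e where e: "e \<in> E" "{\<Theta> v, y} = \<Theta> ` e"
        by (auto simp: neighbours_def spanning_subgraph_def)
      obtain p q where pq: "p \<in> V" "q \<in> V" "e = {p, q}" using E[OF e(1)] by blast
      then have "{\<Theta> v, y} = {\<Theta> p, \<Theta> q}" using e(2) by simp
      then consider "\<Theta> v = \<Theta> p" "y = \<Theta> q" | "\<Theta> v = \<Theta> q" "y = \<Theta> p" by (auto simp: doubleton_eq_iff)
      then show "y \<in> \<Theta> ` {u. {v, u} \<in> E}"
      proof cases
        case 1
        then have "v = p" using inj v pq by (auto dest: inj_onD)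
        then show ?thesis using 1 e(1) pq(3) by blast
      next
        case 2
        then have "v = q" using inj v pq by (auto dest: inj_onD)
        then have "{v, p} \<in> E" using e(1) pq(3) by (simp add: insert_commute)
        then show ?thesis using 2 by blast
      qed
    qed
  qed
  have "card (neighbours ?H x) = 2" if "x \<in> verts G" for x
  proof -
    from that have "x \<in> \<Theta> ` V" by (simp only: surj)
    then obtain v where v: "v \<in> V" "x = \<Theta> v" by (elim imageE) simp
    have "inj_on \<Theta> {u. {v, u} \<in> E}" using EV by (intro inj_on_subset[OF inj]) blast
    from card_image[OF this] show ?thesis unfolding v(2) nb[OF v(1)] deg[OF v(1)] .
  qed
  moreover have "graph_connected ?H"
    unfolding graph_connected_def
  proof (intro ballI)
    fix x y assume "x \<in> verts ?H" "y \<in> verts ?H"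
    then have "x \<in> \<Theta> ` V" "y \<in> \<Theta> ` V" by (simp_all add: spanning_subgraph_def surj)
    then obtain u v where uv: "u \<in> V" "x = \<Theta> u" "v \<in> V" "y = \<Theta> v" by (elim imageE) simp
    have "(u, v) \<in> {(x, y). {x, y} \<in> E}\<^sup>*" using conn[OF uv(1,3)] by (simp add: connected_via_def)
    then have "(\<Theta> u, \<Theta> v) \<in> {(x, y). {x, y} \<in> edges ?H}\<^sup>*"
    proof (induction rule: rtrancl_induct)
      case (step y z)
      then have "(\<Theta> y, \<Theta> z) \<in> {(x, y). {x, y} \<in> edges ?H}"
        using edge by (auto simp: spanning_subgraph_def)
      with step.IH show ?case by (rule rtrancl_into_rtrancl)
    qed simp
    then show "(x, y) \<in> {(x, y). {x, y} \<in> edges ?H}\<^sup>*" by (simp add: uv)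
  qed
  ultimately show ?thesis using sub by (simp add: spanning_double_ray_def spanning_subgraph_def)
qed

lemma glue_edges_cong:
  assumes d: "d > 0" and ab: "\<And>i. i < d \<Longrightarrow> 2 * 3 ^ Suc s dvd a i - b i"
  shows "glue_edges d m s a = glue_edges d m s b"
proof -
  have "(2::int) * 3 ^ s dvd 2 * 3 ^ Suc s" by (intro mult_dvd_mono le_imp_power_dvd) auto
  then have ab': "2 * 3 ^ s dvd a i - b i" if "i < d" for i using dvd_trans ab[OF that] by blast
  have W: "wall d s a \<theta> i y \<longleftrightarrow> wall d s b \<theta> i y"
    and W': "wall d (Suc s) a \<theta> i y \<longleftrightarrow> wall d (Suc s) b \<theta> i y" if "i < d" for i \<theta> y
    by (rule wall_cong, rule ab'[OF that], rule wall_cong, rule ab[OF that])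
  have "corner d s a \<theta> x \<longleftrightarrow> corner d s b \<theta> x" for \<theta> x
    unfolding corner_def using W by blast
  moreover have "s mod d < d" using d by simp
  ultimately have "glue d s a i \<theta> x \<longleftrightarrow> glue d s b i \<theta> x" for i \<theta> x
    unfolding glue_def using W W' by blast
  then show ?thesis unfolding glue_edges_def by simp
qed

definition shift :: "(nat \<Rightarrow> int) \<Rightarrow> cell \<Rightarrow> cell" where
  "shift v = (\<lambda>(x, f). (\<lambda>i. x i + v i, f))"

lemma shift_cells: "\<forall>i\<ge>d. v i = 0 \<Longrightarrow> shift v p \<in> cells d m \<longleftrightarrow> p \<in> cells d m"
  by (cases p) (simp add: shift_def cells_def)

text \<open>Moving cells by \<open>v\<close> and lowering the shift by \<open>v\<close> leaves the
  shifted positions unchanged; all equivariance below rests on this.\<close>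

lemma wall_shift: "wall d s (\<lambda>i. a i - v i) \<theta> i (y + v i) \<longleftrightarrow> wall d s a \<theta> i y"
  by (simp add: wall_def)

lemma glue_shift: "glue d s (\<lambda>i. a i - v i) i \<theta> (\<lambda>i. x i + v i) \<longleftrightarrow> glue d s a i \<theta> x"
proof -
  have "wall d s (\<lambda>i. a i - v i) \<theta> i (x i + v i + 1) \<longleftrightarrow> wall d s a \<theta> i (x i + 1)" for s i
    using wall_shift[of d s a v \<theta> i "x i + 1"] by (simp add: ac_simps)
  then show ?thesis by (simp add: glue_def corner_def wall_shift)
qed

lemma shift_glue_edges_subset:
  assumes v: "\<forall>i\<ge>d. v i = 0"
  shows "(`) (shift v) ` glue_edges d m s a \<subseteq> glue_edges d m s (\<lambda>i. a i - v i)"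
proof (rule image_subsetI)
  fix e assume "e \<in> glue_edges d m s a"
  then obtain x i \<theta> where e: "e = {(x, end_level m \<theta>), (x(i := x i + 1), end_level m \<theta>)}"
    "(x, end_level m \<theta>) \<in> cells d m" "glue d s a i \<theta> x" unfolding glue_edges_def by blast
  let ?y = "\<lambda>i. x i + v i"
  have "(\<lambda>j. (x(i := x i + 1)) j + v j) = ?y(i := ?y i + 1)" by (auto simp: fun_eq_iff)
  then have "shift v ` e = {(?y, end_level m \<theta>), (?y(i := ?y i + 1), end_level m \<theta>)}"
    unfolding e(1) by (simp only: image_insert image_empty shift_def prod.case)
  moreover have "(?y, end_level m \<theta>) \<in> cells d m"
    using shift_cells[OF v, of "(x, end_level m \<theta>)"] e(2) by (simp add: shift_def)
  moreover have "glue d s (\<lambda>i. a i - v i) i \<theta> ?y" using e(3) by (simp only: glue_shift)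
  ultimately show "shift v ` e \<in> glue_edges d m s (\<lambda>i. a i - v i)"
    unfolding glue_edges_def by blast
qed

lemma shift_shift_minus: "(`) (shift v) ` (`) (shift (\<lambda>i. - v i)) ` E = E"
  by (simp add: image_image shift_def case_prod_beta)

text \<open>The reverse inclusion is the given one for \<open>- v\<close>.\<close>

lemma shift_equivariantI:
  assumes sub: "\<And>v a. \<forall>i\<ge>d. v i = 0 \<Longrightarrow> (`) (shift v) ` E a \<subseteq> E (\<lambda>i. a i - v i)"
    and v: "\<forall>i\<ge>d. v i = 0"
  shows "(`) (shift v) ` E a = E (\<lambda>i. a i - v i)"
proof
  show "(`) (shift v) ` E a \<subseteq> E (\<lambda>i. a i - v i)" by (rule sub[OF v])
  have "(`) (shift (\<lambda>i. - v i)) ` E (\<lambda>i. a i - v i) \<subseteq> E a"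
    using sub[of "\<lambda>i. - v i" "\<lambda>i. a i - v i"] v by simp
  from image_mono[OF this, of "(`) (shift v)"]
  show "E (\<lambda>i. a i - v i) \<subseteq> (`) (shift v) ` E a" unfolding shift_shift_minus .
qed

lemma shift_glue_edges:
  assumes "\<forall>i\<ge>d. v i = 0"
  shows "(`) (shift v) ` glue_edges d m s a = glue_edges d m s (\<lambda>i. a i - v i)"
  by (rule shift_equivariantI[where E = "glue_edges d m s", OF _ assms]) (rule shift_glue_edges_subset)

lemma shift_column_edges_subset:
  assumes v: "\<forall>i\<ge>d. v i = 0"
  shows "(`) (shift v) ` column_edges d m \<subseteq> column_edges d m"
proof (rule image_subsetI)
  fix e assume "e \<in> column_edges d m"
  then obtain x f where e: "e = {(x, f), (x, Suc f)}" "(x, Suc f) \<in> cells d m"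
    unfolding column_edges_def by blast
  have "shift v ` e = {(\<lambda>i. x i + v i, f), (\<lambda>i. x i + v i, Suc f)}" by (simp add: e(1) shift_def)
  moreover have "(\<lambda>i. x i + v i, Suc f) \<in> cells d m"
    using shift_cells[OF v, of "(x, Suc f)"] e(2) by (simp add: shift_def)
  ultimately show "shift v ` e \<in> column_edges d m" unfolding column_edges_def by blast
qed

lemma shift_column_edges:
  assumes "\<forall>i\<ge>d. v i = 0"
  shows "(`) (shift v) ` column_edges d m = column_edges d m"
  by (rule shift_equivariantI[where E = "\<lambda>_. column_edges d m", OF _ assms]) (rule shift_column_edges_subset)

text \<open>The stages below \<open>k\<close>; they depend on \<open>a\<close> modulo
  \<open>2 * 3 ^ k\<close> only, that is, on the data of stage \<open>k\<close>.\<close>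

definition partial_curve :: "nat \<Rightarrow> nat \<Rightarrow> nat \<Rightarrow> (nat \<Rightarrow> int) \<Rightarrow> cell set set" where
  "partial_curve d m k a = column_edges d m \<union> (\<Union>s<k. glue_edges d m s a)"

lemma partial_curve_cong:
  assumes d: "d > 0" and ab: "\<And>i. i < d \<Longrightarrow> 2 * 3 ^ k dvd a i - b i"
  shows "partial_curve d m k a = partial_curve d m k b"
proof -
  have "glue_edges d m s a = glue_edges d m s b" if "s < k" for s
  proof (rule glue_edges_cong[OF d])
    fix i assume "i < d"
    have "(2::int) * 3 ^ Suc s dvd 2 * 3 ^ k" using that by (intro mult_dvd_mono le_imp_power_dvd) auto
    then show "2 * 3 ^ Suc s dvd a i - b i" using ab[OF \<open>i < d\<close>] by (rule dvd_trans)
  qed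
  then show ?thesis by (simp add: partial_curve_def)
qed

lemma shift_partial_curve:
  assumes v: "\<forall>i\<ge>d. v i = 0"
  shows "(`) (shift v) ` partial_curve d m k a = partial_curve d m k (\<lambda>i. a i - v i)"
  unfolding partial_curve_def image_Un image_UN shift_column_edges[OF v] shift_glue_edges[OF v] ..

lemma partial_curve_subset: "d > 0 \<Longrightarrow> partial_curve d m k a \<subseteq> lattice_edges d m"
proof -
  assume "d > 0"
  moreover have "column_edges d m \<subseteq> lattice_edges d m" unfolding lattice_edges_def by (rule Un_upper1)
  ultimately show ?thesis unfolding partial_curve_def using glue_edges_subset by blast
qed

text \<open>The directions are tripled in turn, so \<open>d\<close> consecutive stages triple each
  of them once.\<close>

lemma side_add_stages: "j \<le> d \<Longrightarrow> side d (k * d + j) i = side d (k * d) i * (if i < j then 3 else 1)"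
proof (induction j)
  case (Suc j)
  then have "(k * d + j) mod d = j" by simp
  then show ?case using Suc by auto
qed simp

lemma side_full_cycles: "i < d \<Longrightarrow> side d (k * d) i = 3 ^ k"
proof (induction k)
  case (Suc k)
  then show ?case using side_add_stages[of d d k i] by (simp add: add.commute)
qed simp

section \<open>Translations acting on edge sets\<close>

lemma measurable_edge_spaceI:
  assumes "\<And>F. F \<subseteq> edges G \<Longrightarrow> f F \<subseteq> edges G"
    and "\<And>A. A \<in> cylinder_sets G \<Longrightarrow> f -` A \<inter> Pow (edges G) \<in> cylinder_sets G"
  shows "f \<in> edge_space G \<rightarrow>\<^sub>M edge_space G"
proof (rule measurable_sigma_sets[OF sets_edge_space])
  show "cylinder_sets G \<subseteq> Pow (Pow (edges G))" using cylinder_subset by blast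
  show "f \<in> space (edge_space G) \<rightarrow> Pow (edges G)" using assms(1) by simp
  fix A assume "A \<in> cylinder_sets G"
  from assms(2)[OF this] show "f -` A \<inter> space (edge_space G) \<in> sets (edge_space G)"
    unfolding space_edge_space sets_edge_space by (rule sigma_sets.Basic)
qed

context group
begin

lemma translate_edge:
  assumes "g \<in> carrier G" "S \<subseteq> carrier G" "e \<in> edges (cayley_graph G S)"
  shows "(\<lambda>x. g \<otimes> x) ` e \<in> edges (cayley_graph G S)"
proof -
  obtain h s where e: "e = {h, h \<otimes> s}" "h \<in> carrier G" "s \<in> S"
    using assms(3) by (auto simp: cayley_graph_def)
  then have "(\<lambda>x. g \<otimes> x) ` e = {g \<otimes> h, (g \<otimes> h) \<otimes> s}" using assms by (auto simp: m_assoc)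
  moreover have "g \<otimes> h \<in> carrier G" using assms(1) e(2) by simp
  ultimately show ?thesis unfolding cayley_graph_def using e(3) by auto
qed

lemma cayley_edge_subset:
  "S \<subseteq> carrier G \<Longrightarrow> e \<in> edges (cayley_graph G S) \<Longrightarrow> e \<subseteq> carrier G"
  by (auto simp: cayley_graph_def)

lemma image_mult_inv:
  assumes "g \<in> carrier G" "A \<subseteq> carrier G"
  shows "(\<lambda>x. inv g \<otimes> x) ` (\<lambda>x. g \<otimes> x) ` A = A" "(\<lambda>x. g \<otimes> x) ` (\<lambda>x. inv g \<otimes> x) ` A = A"
proof -
  have "inv g \<otimes> (g \<otimes> x) = x" "g \<otimes> (inv g \<otimes> x) = x" if "x \<in> A" for x
    using assms that by (auto simp: m_assoc[symmetric])
  then show "(\<lambda>x. inv g \<otimes> x) ` (\<lambda>x. g \<otimes> x) ` A = A" "(\<lambda>x. g \<otimes> x) ` (\<lambda>x. inv g \<otimes> x) ` A = A"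
    unfolding image_image by simp_all
qed

lemma mem_translate_iff:
  assumes "g \<in> carrier G" "S \<subseteq> carrier G" "F \<subseteq> edges (cayley_graph G S)" "e \<in> edges (cayley_graph G S)"
  shows "e \<in> translate G g F \<longleftrightarrow> (\<lambda>x. inv g \<otimes> x) ` e \<in> F"
proof
  assume "e \<in> translate G g F"
  then obtain e' where e': "e' \<in> F" "e = (\<lambda>x. g \<otimes> x) ` e'" by (auto simp: translate_def)
  then have "e' \<subseteq> carrier G" using assms cayley_edge_subset by blast
  then show "(\<lambda>x. inv g \<otimes> x) ` e \<in> F" using e' image_mult_inv(1)[OF assms(1)] by simp
next
  assume *: "(\<lambda>x. inv g \<otimes> x) ` e \<in> F"
  have "e = (\<lambda>x. g \<otimes> x) ` (\<lambda>x. inv g \<otimes> x) ` e"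
    using image_mult_inv(2)[OF assms(1) cayley_edge_subset[OF assms(2,4)]] by simp
  then show "e \<in> translate G g F" using * unfolding translate_def by (rule image_eqI)
qed

lemma translate_subset:
  assumes "g \<in> carrier G" "S \<subseteq> carrier G" "F \<subseteq> edges (cayley_graph G S)"
  shows "translate G g F \<subseteq> edges (cayley_graph G S)"
  using translate_edge[OF assms(1,2)] assms(3) unfolding translate_def by auto

text \<open>The preimage depends on the edges of \<open>D\<close> moved back by
  \<open>inv g\<close>.\<close>

lemma translate_vimage_cylinder:
  assumes g: "g \<in> carrier G" and S: "S \<subseteq> carrier G" and A: "A \<in> cylinder_sets (cayley_graph G S)"
  shows "translate G g -` A \<inter> Pow (edges (cayley_graph G S)) \<in> cylinder_sets (cayley_graph G S)"
proof -
  let ?E = "edges (cayley_graph G S)"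
  obtain D where D: "finite D" "D \<subseteq> ?E"
    "\<And>F F'. F \<subseteq> ?E \<Longrightarrow> F' \<subseteq> ?E \<Longrightarrow> F \<inter> D = F' \<inter> D \<Longrightarrow> F \<in> A \<longleftrightarrow> F' \<in> A"
    using A by (rule cylinder_setsE) blast
  show ?thesis
  proof (rule cylinder_setsI)
    show "finite (translate G (inv g) D)" using D(1) by (simp add: translate_def)
    show "translate G (inv g) D \<subseteq> ?E" using translate_subset[OF _ S D(2)] g by simp
    show "translate G g -` A \<inter> Pow ?E \<subseteq> Pow ?E" by (rule Int_lower2)
    fix F F' assume F: "F \<subseteq> ?E" "F' \<subseteq> ?E" and
      eq: "F \<inter> translate G (inv g) D = F' \<inter> translate G (inv g) D" and
      FA: "F \<in> translate G g -` A \<inter> Pow ?E"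
    have "e \<in> translate G g F \<longleftrightarrow> e \<in> translate G g F'" if e: "e \<in> D" for e
    proof -
      have "(\<lambda>x. inv g \<otimes> x) ` e \<in> translate G (inv g) D" using e by (simp add: translate_def)
      then have "(\<lambda>x. inv g \<otimes> x) ` e \<in> F \<longleftrightarrow> (\<lambda>x. inv g \<otimes> x) ` e \<in> F'" using eq by blast
      then show ?thesis using mem_translate_iff[OF g S F(1)] mem_translate_iff[OF g S F(2)] e D(2) by blast
    qed
    then have "translate G g F \<inter> D = translate G g F' \<inter> D" by blast
    then have "translate G g F' \<in> A"
      using D(3)[OF translate_subset[OF g S F(1)] translate_subset[OF g S F(2)]] FA by blast
    then show "F' \<in> translate G g -` A \<inter> Pow ?E" using F(2) by blast
  qed
qed

lemma measurable_translate:
  assumes "g \<in> carrier G" "S \<subseteq> carrier G"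
  shows "translate G g \<in> edge_space (cayley_graph G S) \<rightarrow>\<^sub>M edge_space (cayley_graph G S)"
  using translate_subset[OF assms] translate_vimage_cylinder[OF assms] by (rule measurable_edge_spaceI)

end

text \<open>The definition of invariance uses the law itself as target of \<open>distr\<close>; only
  its sigma-algebra matters there, so the target may be replaced by \<open>N\<close>.\<close>

lemma invariant_measure_edge_spaceI:
  assumes "\<And>g. g \<in> carrier \<Gamma> \<Longrightarrow> act g \<in> N \<rightarrow>\<^sub>M N"
    and "\<And>g. g \<in> carrier \<Gamma> \<Longrightarrow> distr (distr M N R) N (act g) = distr M N R"
  shows "invariant_measure \<Gamma> act (distr M N R)"
  unfolding invariant_measure_def
proof (intro ballI conjI)
  fix g assume g: "g \<in> carrier \<Gamma>"
  then show "act g \<in> distr M N R \<rightarrow>\<^sub>M distr M N R" using assms(1) by simp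
  have "distr (distr M N R) (distr M N R) (act g) = distr (distr M N R) N (act g)"
    by (rule distr_cong) simp_all
  then show "distr (distr M N R) (distr M N R) (act g) = distr M N R" using assms(2)[OF g] by simp
qed

text \<open>This is the form in which a translation permutes the data of a stage: \<open>n\<close>
  permutes the base points, and the residues are shifted by an amount that depends on the base
  point.\<close>

lemma bij_betw_residue_box_shift:
  assumes n: "\<And>f. f < m \<Longrightarrow> n f < m" "\<And>f h. f < m \<Longrightarrow> h < m \<Longrightarrow> n f = n h \<Longrightarrow> f = h"
  shows "bij_betw (\<lambda>(a, f). reduce d k (\<lambda>i. a i - v f i, n f)) (residue_box d m k) (residue_box d m k)"
    (is "bij_betw ?\<pi> ?B ?B")
proof -
  have "inj_on ?\<pi> ?B"
  proof (rule inj_onI)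
    fix p q assume p: "p \<in> ?B" and q: "q \<in> ?B" and eq: "?\<pi> p = ?\<pi> q"
    obtain a f b h where pq: "p = (a, f)" "q = (b, h)" by (metis surj_pair)
    have fh: "f < m" "h < m" using p q by (simp_all add: pq residue_box_def)
    have "n f = n h" using eq by (simp add: pq reduce_def)
    then have f: "f = h" by (rule n(2)[OF fh])
    have e: "(\<lambda>i\<in>{..<d}. (a i - v h i) mod (2 * 3 ^ k)) = (\<lambda>i\<in>{..<d}. (b i - v h i) mod (2 * 3 ^ k))"
      using eq by (simp add: pq reduce_def f)
    have ab: "a \<in> {..<d} \<rightarrow>\<^sub>E {0..<2 * 3 ^ k}" "b \<in> {..<d} \<rightarrow>\<^sub>E {0..<2 * 3 ^ k}"
      using p q by (simp_all add: pq residue_box_def)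
    have "a i = b i" for i
    proof (cases "i < d")
      case True
      then have "(a i - v h i) mod (2 * 3 ^ k) = (b i - v h i) mod (2 * 3 ^ k)"
        using fun_cong[OF e, of i] by simp
      then have "a i mod (2 * 3 ^ k) = b i mod (2 * 3 ^ k)" by (simp add: mod_eq_dvd_iff)
      then show ?thesis using residue_box_range[OF p True] residue_box_range[OF q True] by (simp add: pq)
    next
      case False
      then have "i \<notin> {..<d}" by simp
      then show ?thesis using PiE_arb[OF ab(1)] PiE_arb[OF ab(2)] by simp
    qed
    then have "a = b" by (rule ext)
    then show "p = q" using f by (simp add: pq)
  qed
  moreover have "?\<pi> ` ?B \<subseteq> ?B"
  proof (rule image_subsetI)
    fix p assume "p \<in> ?B"
    then have "n (snd p) < m" using n(1) by (simp add: residue_box_def mem_Times_iff)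
    then show "?\<pi> p \<in> ?B" unfolding case_prod_beta by (rule reduce_in_residue_box)
  qed
  ultimately show ?thesis using endo_inj_surj[OF finite_residue_box] by (simp add: bij_betw_def)
qed

lemma lattice_edge_cells:
  assumes "e \<in> lattice_edges d m"
  shows "\<exists>u\<in>cells d m. \<exists>v\<in>cells d m. e = {u, v}"
proof -
  from assms consider x f where "e = {(x, f), (x, Suc f)}" "(x, Suc f) \<in> cells d m"
    | x f i where "e = {(x, f), (x(i := x i + 1), f)}" "(x, f) \<in> cells d m" "i < d"
    unfolding lattice_edges_def column_edges_def by blast
  then show ?thesis
  proof cases
    case 1
    moreover from this have "(x, f) \<in> cells d m" by (simp add: cells_def)
    ultimately show ?thesis by blast
  next
    case 2
    moreover from this have "(x(i := x i + 1), f) \<in> cells d m" by (simp add: cells_def)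
    ultimately show ?thesis by blast
  qed
qed

lemma reduce_sequence_cong:
  assumes red: "\<And>k. reduce d k (z (Suc k)) = z k" and i: "i < d" and "s \<le> k"
  shows "2 * 3 ^ s dvd fst (z k) i - fst (z s) i"
  using \<open>s \<le> k\<close>
proof (induction k rule: dec_induct)
  case (step n)
  have "fst (z n) i = fst (z (Suc n)) i mod (2 * 3 ^ n)"
    using red[of n] i by (cases "z (Suc n)") (simp add: reduce_def flip: red[of n])
  then have "2 * 3 ^ n dvd fst (z (Suc n)) i - fst (z n) i"
    by (simp add: minus_mod_eq_mult_div)
  moreover have "(2::int) * 3 ^ s dvd 2 * 3 ^ n"
    using step by (intro mult_dvd_mono le_imp_power_dvd) auto
  ultimately have "2 * 3 ^ s dvd fst (z (Suc n)) i - fst (z n) i" by (rule dvd_trans[rotated])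
  from dvd_add[OF this step.IH] show ?case by simp
qed simp

section \<open>The grid inside the Cayley graph, and the random double ray\<close>

lemma (in comm_group) grid_edges:
  assumes gc: "grid_coordinates S H d m \<phi> w" and S: "S \<subseteq> carrier G"
    and e: "e \<in> lattice_edges d m" and u: "u \<in> carrier G"
  shows "(\<lambda>(x, f). u \<otimes> (\<phi> x \<otimes> w f)) ` e \<in> edges (cayley_graph G S)"
proof -
  note c = grid_coordinatesD(3,6)[OF gc]
  have I: "{h, h \<otimes> s} \<in> edges (cayley_graph G S)" if "h \<in> carrier G" "s \<in> S" for h s
    unfolding cayley_graph_def using that by auto
  from e consider x f where "e = {(x, f), (x, Suc f)}" "(x, Suc f) \<in> cells d m"
    | x f i where "e = {(x, f), (x(i := x i + 1), f)}" "(x, f) \<in> cells d m" "i < d"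
    unfolding lattice_edges_def column_edges_def by blast
  then show ?thesis
  proof cases
    case 1
    then have "Suc f < m" by (simp add: cells_def)
    then obtain s where s: "s \<in> S" "w (Suc f) = w f \<otimes> s" using grid_coordinatesD(7)[OF gc] by blast
    then have "s \<in> carrier G" using S by blast
    then have "u \<otimes> (\<phi> x \<otimes> w (Suc f)) = u \<otimes> (\<phi> x \<otimes> w f) \<otimes> s" using c u by (simp add: s(2) m_assoc)
    then show ?thesis using I[of "u \<otimes> (\<phi> x \<otimes> w f)" s] c u s(1) by (simp add: 1(1))
  next
    case 2
    let ?s = "\<phi> (\<lambda>j. of_bool (j = i))"
    have s: "?s \<in> S" by (rule grid_coordinatesD(5)[OF gc 2(3)])
    have "\<phi> (x(i := x i + 1)) = \<phi> (\<lambda>j. x j + of_bool (j = i))"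
      by (rule grid_coordinatesD(4)[OF gc]) simp
    also have "\<dots> = \<phi> x \<otimes> ?s" by (rule grid_coordinatesD(2)[OF gc])
    finally have "u \<otimes> (\<phi> (x(i := x i + 1)) \<otimes> w f) = u \<otimes> (\<phi> x \<otimes> w f) \<otimes> ?s"
      using c u by (simp add: m_ac)
    then show ?thesis using I[of "u \<otimes> (\<phi> x \<otimes> w f)" ?s] c u s by (simp add: 2(1))
  qed
qed

lemma (in comm_group) subgroup_generated_by_steps:
  assumes S: "S \<subseteq> carrier G" and H: "subgroup H G" "S \<subseteq> H" and conn: "graph_connected (cayley_graph G S)"
  shows "H = carrier G"
proof
  show "H \<subseteq> carrier G" by (rule subgroup.subset[OF H(1)])
  show "carrier G \<subseteq> H"
  proof
    fix g assume "g \<in> carrier G"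
    then have "(\<one>, g) \<in> {(x, y). {x, y} \<in> edges (cayley_graph G S)}\<^sup>*"
      using conn by (simp add: graph_connected_def cayley_graph_def)
    then show "g \<in> H"
    proof (induction rule: rtrancl_induct)
      case base
      show ?case by (rule subgroup.one_closed[OF H(1)])
    next
      case (step y z)
      then obtain h s where hs: "{y, z} = {h, h \<otimes> s}" "h \<in> carrier G" "s \<in> S"
        by (auto simp: cayley_graph_def)
      have sH: "s \<in> H" and sc: "s \<in> carrier G" using hs(3) H(2) S by auto
      from hs(1) consider "y = h" "z = h \<otimes> s" | "z = h" "y = h \<otimes> s" by (auto simp: doubleton_eq_iff)
      then show ?case
      proof cases
        case 1
        then show ?thesis using step.IH sH subgroup.m_closed[OF H(1)] by simp
      next
        case 2
        then have "z = y \<otimes> inv s" using hs(2) sc by (simp add: m_assoc)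
        then show ?thesis using step.IH sH subgroup.m_closed[OF H(1)] subgroup.m_inv_closed[OF H(1)] by simp
      qed
    qed
  qed
qed

lemma (in comm_group) finite_steps:
  assumes "S \<subseteq> carrier G" "locally_finite (cayley_graph G S)"
  shows "finite S"
proof (rule finite_subset)
  show "S \<subseteq> neighbours (cayley_graph G S) \<one>"
  proof
    fix s assume "s \<in> S"
    then have "{\<one>, s} = {\<one>, \<one> \<otimes> s}" "s \<in> S" using assms(1) by auto
    then show "s \<in> neighbours (cayley_graph G S) \<one>"
      unfolding neighbours_def cayley_graph_def by auto
  qed
  show "finite (neighbours (cayley_graph G S) \<one>)"
    using assms(2) by (simp add: locally_finite_def cayley_graph_def)
qed

text \<open>Left multiplication carries the grid based at \<open>w f\<close> to the grid based at
  some other \<open>w f'\<close>, up to a shift of the lattice. Hence the base point is chosen at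
  random too, uniformly among the \<open>m\<close> representatives.\<close>

theorem (in comm_group) invariant_random_double_ray:
  fixes S :: "'a set"
  assumes inf: "infinite (carrier G)" and S: "S \<subseteq> carrier G" and inv: "\<And>s. s \<in> S \<Longrightarrow> inv s \<in> S"
    and conn: "graph_connected (cayley_graph G S)" and lf: "locally_finite (cayley_graph G S)"
  shows "\<exists>(M :: 'a set set measure) R. random_spanning_double_ray (cayley_graph G S) M R \<and>
    invariant_measure G (translate G) (distr M (edge_space (cayley_graph G S)) R)"
proof -
  let ?G = "cayley_graph G S"
  obtain H d m \<phi> w where H: "subgroup H G" "S \<subseteq> H" "grid_coordinates S H d m \<phi> w"
    using grid_coordinates_exist[OF finite_steps[OF S lf] order.refl S inv] by blast
  have gc: "grid_coordinates S (carrier G) d m \<phi> w"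
    using H(3) subgroup_generated_by_steps[OF S H(1,2) conn] by simp
  note \<phi>c = grid_coordinatesD(3)[OF gc] and wc = grid_coordinatesD(6)[OF gc]
  have m: "m > 0" by (rule grid_coordinatesD(1)[OF gc])
  \<comment> \<open>Without a lattice direction there would be only \<open>m\<close> group
    elements.\<close>
  have d: "d > 0"
  proof (rule ccontr)
    assume "\<not> d > 0"
    then have "cells d m = (\<lambda>f. (\<lambda>_. 0, f)) ` {..<m}" by (auto simp: cells_def)
    then have "finite (cells d m)" by simp
    then show False using inf bij_betw_finite[OF grid_coordinatesD(8)[OF gc]] by simp
  qed
  define \<Theta> where "\<Theta> u = (\<lambda>(x, f). u \<otimes> (\<phi> x \<otimes> w f))" for u
  have \<Theta>_edge: "\<Theta> u ` e \<in> edges ?G" if "u \<in> carrier G" "e \<in> lattice_edges d m" for u e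
    unfolding \<Theta>_def by (rule grid_edges[OF gc S that(2,1)])
  have \<Theta>_bij: "bij_betw (\<Theta> u) (cells d m) (verts ?G)" if u: "u \<in> carrier G" for u
  proof -
    have "bij_betw (\<lambda>x. u \<otimes> x) (carrier G) (carrier G)"
    proof (rule bij_betwI[where g = "\<lambda>x. inv u \<otimes> x"])
    qed (use u in \<open>auto simp: m_assoc[symmetric]\<close>)
    from bij_betw_trans[OF grid_coordinatesD(8)[OF gc] this] show ?thesis
      by (simp add: \<Theta>_def cayley_graph_def comp_def case_prod_beta')
  qed
  obtain M :: "real measure" and Z where us: "uniform_sequence M (residue_box d m) Z"
    and "\<forall>k. \<forall>\<omega>\<in>space M. reduce d k (Z (Suc k) \<omega>) = Z k \<omega>"
    by (rule exE[OF odometer_exists[OF m, of d]], elim exE conjE) (rule that)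
  then have red: "\<And>k \<omega>. \<omega> \<in> space M \<Longrightarrow> reduce d k (Z (Suc k) \<omega>) = Z k \<omega>" by simp
  interpret uniform_sequence M "residue_box d m" Z by (rule us)
  define F where "F k = (\<lambda>(a, f). (`) (\<Theta> (w f)) ` partial_curve d m k a)" for k
  define full where "full \<omega> = column_edges d m \<union> (\<Union>s. glue_edges d m s (fst (Z (Suc s) \<omega>)))" for \<omega>
  define R where "R \<omega> = (`) (\<Theta> (w (snd (Z 0 \<omega>)))) ` full \<omega>" for \<omega>
  have full_sub: "full \<omega> \<subseteq> lattice_edges d m" for \<omega>
  proof -
    have "column_edges d m \<subseteq> lattice_edges d m" unfolding lattice_edges_def by (rule Un_upper1)
    then show ?thesis unfolding full_def using glue_edges_subset[OF d] by blast
  qed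
  have R_sub: "R \<omega> \<subseteq> edges ?G" for \<omega>
    unfolding R_def using \<Theta>_edge[OF wc] full_sub[of \<omega>] by blast
  have F_sub: "F k b \<subseteq> edges ?G" for k b
    unfolding F_def using \<Theta>_edge[OF wc] partial_curve_subset[OF d, of m k] by (cases b) (simp, blast)
  have partial: "partial_curve d m k (fst (Z k \<omega>)) =
      column_edges d m \<union> (\<Union>s<k. glue_edges d m s (fst (Z (Suc s) \<omega>)))" if "\<omega> \<in> space M" for k \<omega>
  proof -
    have "glue_edges d m s (fst (Z k \<omega>)) = glue_edges d m s (fst (Z (Suc s) \<omega>))" if "s < k" for s
      by (rule glue_edges_cong[OF d], rule reduce_sequence_cong[of d "\<lambda>k. Z k \<omega>"])
        (use red \<open>\<omega> \<in> space M\<close> that in auto)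
    then show ?thesis by (simp add: partial_curve_def)
  qed
  have snd_Z: "snd (Z k \<omega>) = snd (Z 0 \<omega>)" if "\<omega> \<in> space M" for k \<omega>
  proof (induction k)
    case (Suc k)
    have "snd (reduce d k (Z (Suc k) \<omega>)) = snd (Z (Suc k) \<omega>)"
      by (simp add: reduce_def case_prod_beta)
    with Suc show ?case by (simp only: red[OF that])
  qed simp
  have FZ: "F k (Z k \<omega>) = (`) (\<Theta> (w (snd (Z 0 \<omega>)))) `
      (column_edges d m \<union> (\<Union>s<k. glue_edges d m s (fst (Z (Suc s) \<omega>))))" if "\<omega> \<in> space M" for k \<omega>
  proof -
    have "F k (Z k \<omega>) = (`) (\<Theta> (w (snd (Z k \<omega>)))) ` partial_curve d m k (fst (Z k \<omega>))"
      by (simp add: F_def case_prod_beta)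
    then show ?thesis by (simp only: partial[OF that] snd_Z[OF that, of k])
  qed
  have conv: "\<exists>K. \<forall>k\<ge>K. e \<in> F k (Z k \<omega>) \<longleftrightarrow> e \<in> R \<omega>" if \<omega>: "\<omega> \<in> space M" for \<omega> e
  proof (cases "e \<in> R \<omega>")
    case True
    then obtain e0 where e0: "e = \<Theta> (w (snd (Z 0 \<omega>))) ` e0" "e0 \<in> full \<omega>" by (auto simp: R_def)
    obtain s where s: "e0 \<in> column_edges d m \<union> glue_edges d m s (fst (Z (Suc s) \<omega>))"
      using e0(2) by (auto simp: full_def)
    have "e \<in> F k (Z k \<omega>)" if "k \<ge> Suc s" for k
      unfolding FZ[OF \<omega>] e0(1) by (rule imageI) (use s that in auto)
    then show ?thesis using True by blast
  next
    case False
    have "F k (Z k \<omega>) \<subseteq> R \<omega>" for k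
      unfolding FZ[OF \<omega>] R_def full_def by (rule image_mono) blast
    then show ?thesis using False by blast
  qed
  have generic: "AE \<omega> in M. \<exists>s. \<not> side d s i dvd y + fst (Z s \<omega>) i" if i: "i < d" for i y
  proof -
    \<comment> \<open>It suffices to look at the stages \<open>k * d\<close>, where each side equals
      \<open>3 ^ k\<close>.\<close>
    have "AE \<omega> in M. \<exists>k. \<not> int (3 ^ k) dvd y + fst (Z (k * d) \<omega>) i"
    proof (rule AE_ex_not)
      fix k :: nat
      have "k \<le> k * d" using d by simp
      then have "(3::int) ^ k dvd 2 * 3 ^ (k * d)" by (intro dvd_mult le_imp_power_dvd)
      then show "3 ^ k * card {b \<in> residue_box d m (k * d). int (3 ^ k) dvd y + fst b i}
          \<le> card (residue_box d m (k * d))"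
        by (intro card_residue_class[OF i, where h = "\<lambda>a. y + a i"]) simp_all
      show "k < 3 ^ k" by (rule power_gt_expt) simp
    qed
    then show ?thesis
    proof (rule AE_mp, intro AE_I2 impI)
      fix \<omega> assume "\<exists>k. \<not> int (3 ^ k) dvd y + fst (Z (k * d) \<omega>) i"
      then show "\<exists>s. \<not> side d s i dvd y + fst (Z s \<omega>) i"
        using side_full_cycles[OF i] by (metis of_nat_numeral of_nat_power)
    qed
  qed
  have "AE \<omega> in M. \<forall>i y. i < d \<longrightarrow> (\<exists>s. \<not> side d s i dvd y + fst (Z s \<omega>) i)"
    unfolding AE_all_countable by (intro allI impI AE_impI generic)
  then have good: "AE \<omega> in M. spanning_double_ray ?G (spanning_subgraph ?G (R \<omega>))"
  proof (rule AE_mp, intro AE_I2 impI)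
    fix \<omega> assume \<omega>: "\<omega> \<in> space M" and gen: "\<forall>i y. i < d \<longrightarrow> (\<exists>s. \<not> side d s i dvd y + fst (Z s \<omega>) i)"
    interpret folded_curve d m "\<lambda>s. fst (Z s \<omega>)"
      using d m gen reduce_sequence_cong[of d "\<lambda>k. Z k \<omega>", OF red[OF \<omega>]] by unfold_locales simp_all
    have full: "full \<omega> = curve" by (simp add: full_def curve_def)
    show "spanning_double_ray ?G (spanning_subgraph ?G (R \<omega>))"
      unfolding R_def full
    proof (rule double_ray_transfer[OF \<Theta>_bij[OF wc]])
      show "\<exists>u\<in>cells d m. \<exists>v\<in>cells d m. e = {u, v}" if "e \<in> curve" for e
        using lattice_edge_cells that curve_subset by blast
      show "(`) (\<Theta> (w (snd (Z 0 \<omega>)))) ` curve \<subseteq> edges ?G"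
        using \<Theta>_edge[OF wc] curve_subset by blast
      show "card {u. {v, u} \<in> curve} = 2" if "v \<in> cells d m" for v
        by (rule card_curve_neighbours[OF that])
      show "connected_via curve u v" if "u \<in> cells d m" "v \<in> cells d m" for u v
        using conn_all[of "fst u" "snd u" "fst v" "snd v"] that by simp
    qed
  qed
  have meas: "R \<in> M \<rightarrow>\<^sub>M edge_space ?G"
    by (rule measurable_limit[where F = F and R = R, OF R_sub F_sub conv])
  have invariant: "distr (distr M (edge_space ?G) R) (edge_space ?G) (translate G g) = distr M (edge_space ?G) R"
    if g: "g \<in> carrier G" for g
  proof (rule invariant_limit[where F = F and R = R, OF R_sub F_sub conv
        translate_vimage_cylinder[OF g S] measurable_translate[OF g S]])
    fix k
    \<comment> \<open>The coordinates of \<open>g \<otimes> w f\<close> tell what \<open>g\<close>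
      does to the grid based at \<open>w f\<close>: the new base point is \<open>w (n f)\<close>,
      and the lattice is shifted by \<open>v f\<close>.\<close>
    have "\<exists>v f'. (v, f') \<in> cells d m \<and> g \<otimes> w f = \<phi> v \<otimes> w f'" for f
      using grid_coordinates_surj[OF gc, of "g \<otimes> w f"] g wc by (metis m_closed)
    then obtain v n where vn: "\<And>f. (v f, n f) \<in> cells d m" "\<And>f. g \<otimes> w f = \<phi> (v f) \<otimes> w (n f)"
      by metis
    define \<pi> where "\<pi> = (\<lambda>(a, f). reduce d k (\<lambda>i. a i - v f i, n f))"
    have "bij_betw \<pi> (residue_box d m k) (residue_box d m k)"
      unfolding \<pi>_def
    proof (rule bij_betw_residue_box_shift)
      show "n f < m" if "f < m" for f using vn(1)[of f] by (simp add: cells_def)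
      \<comment> \<open>If \<open>w f\<close> and \<open>w h\<close> are sent to the same base
        point, cancelling \<open>g\<close> leaves them equal up to lattice vectors, and coordinates
        are unique.\<close>
      show "f = h" if fh: "f < m" "h < m" and n: "n f = n h" for f h
      proof -
        have "g \<otimes> (\<phi> (v h) \<otimes> w f) = \<phi> (v h) \<otimes> (g \<otimes> w f)" using g \<phi>c wc by (simp add: m_ac)
        also have "\<dots> = \<phi> (v f) \<otimes> (g \<otimes> w h)" unfolding vn(2) n using \<phi>c wc by (simp add: m_ac)
        also have "\<dots> = g \<otimes> (\<phi> (v f) \<otimes> w h)" using g \<phi>c wc by (simp add: m_ac)
        finally have "\<phi> (v h) \<otimes> w f = \<phi> (v f) \<otimes> w h" using g \<phi>c wc by simp
        from grid_coordinates_inj(1)[OF gc fh this] show ?thesis .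
      qed
    qed
    moreover have "translate G g (F k b) = F k (\<pi> b)" for b
    proof -
      obtain a f where b: "b = (a, f)" by (cases b)
      have v0: "\<forall>i\<ge>d. v f i = 0" using vn(1)[of f] by (simp add: cells_def)
      let ?c = "\<lambda>i\<in>{..<d}. (a i - v f i) mod (2 * 3 ^ k)"
      have "partial_curve d m k ?c = partial_curve d m k (\<lambda>i. a i - v f i)"
      proof (rule partial_curve_cong[OF d])
        fix i assume "i < d"
        have "2 * 3 ^ k dvd (a i - v f i) mod (2 * 3 ^ k) - (a i - v f i)"
          by (simp only: mod_eq_dvd_iff[symmetric] mod_mod_trivial)
        then show "2 * 3 ^ k dvd ?c i - (a i - v f i)" using \<open>i < d\<close> by simp
      qed
      also have "\<dots> = (`) (shift (v f)) ` partial_curve d m k a"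
        by (rule shift_partial_curve[OF v0, symmetric])
      finally have pc: "partial_curve d m k ?c = (`) (shift (v f)) ` partial_curve d m k a" .
      have \<Theta>: "\<Theta> (w (n f)) (shift (v f) p) = g \<otimes> \<Theta> (w f) p" for p
      proof -
        obtain x l where p: "p = (x, l)" by (cases p)
        have "\<Theta> (w (n f)) (shift (v f) p) = (\<phi> (v f) \<otimes> w (n f)) \<otimes> (\<phi> x \<otimes> w l)"
          using \<phi>c wc by (simp add: p \<Theta>_def shift_def grid_coordinatesD(2)[OF gc] m_ac)
        also have "\<dots> = g \<otimes> \<Theta> (w f) p"
          unfolding vn(2)[symmetric] using \<phi>c wc g by (simp add: p \<Theta>_def m_assoc)
        finally show ?thesis .
      qed
      have "F k (\<pi> b) = (`) (\<Theta> (w (n f))) ` (`) (shift (v f)) ` partial_curve d m k a"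
        by (simp add: F_def \<pi>_def b reduce_def pc)
      also have "\<dots> = (\<lambda>e. (\<lambda>p. g \<otimes> \<Theta> (w f) p) ` e) ` partial_curve d m k a"
        by (simp only: image_image \<Theta>)
      also have "\<dots> = translate G g (F k b)"
        by (simp add: translate_def F_def b image_image)
      finally show ?thesis ..
    qed
    ultimately show "\<exists>\<pi>. bij_betw \<pi> (residue_box d m k) (residue_box d m k) \<and>
        (\<forall>b\<in>residue_box d m k. translate G g (F k b) = F k (\<pi> b))" by blast
  qed
  \<comment> \<open>The sample space becomes the type of edge sets, with the identity as the random
    subgraph.\<close>
  show ?thesis
  proof (rule push_forward_final[OF prob_space_axioms, where f = R])
    fix N :: "'a set set measure"
    assume N: "prob_space N" "\<And>P. AE \<omega> in M. P (R \<omega>) \<Longrightarrow> AE y in N. P y"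
      "\<And>h (K :: 'a set set measure). (\<lambda>\<omega>. h (R \<omega>)) \<in> M \<rightarrow>\<^sub>M K \<Longrightarrow> h \<in> N \<rightarrow>\<^sub>M K"
      "\<And>h (K :: 'a set set measure). (\<lambda>\<omega>. h (R \<omega>)) \<in> M \<rightarrow>\<^sub>M K \<Longrightarrow> distr N K h = distr M K (\<lambda>\<omega>. h (R \<omega>))"
    have "random_spanning_double_ray ?G N (\<lambda>F. F)"
      unfolding random_spanning_double_ray_def using N(1) N(3)[of "\<lambda>F. F", OF meas] N(2)[OF good] by simp
    moreover have "distr N (edge_space ?G) (\<lambda>F. F) = distr M (edge_space ?G) R"
      using N(4)[of "\<lambda>F. F", OF meas] .
    moreover have "invariant_measure G (translate G) (distr M (edge_space ?G) R)"
      by (rule invariant_measure_edge_spaceI) (use measurable_translate[OF _ S] invariant in auto)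
    ultimately show ?thesis by metis
  qed
qed

section \<open>Two-coloured square grid\<close>

text \<open>Start from the decomposition of the grid into its rows (red) and its columns (blue), and swap the
  two colours on the four edges of every square whose upper right corner \<open>(u, v)\<close> is marked; this
  preserves all degrees. In 3-adically shifted coordinates, \<open>(u, v)\<close> is marked iff \<open>u\<close> and \<open>v\<close> have the
  same 3-adic valuation and the same last nonzero digit. The marks of valuation \<open>k\<close> join the red
  rays in three consecutive horizontal strips of width \<open>3^k\<close> to a single one, and simultaneously the
  blue rays in three consecutive vertical strips.\<close>

definition marked_level :: "nat \<Rightarrow> int \<Rightarrow> int \<Rightarrow> int \<Rightarrow> int \<Rightarrow> bool" where
  "marked_level k X Y u v \<longleftrightarrow> 3 ^ k dvd u + X \<and> \<not> 3 ^ Suc k dvd u + X \<and>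
     3 ^ k dvd v + Y \<and> \<not> 3 ^ Suc k dvd v + Y \<and> 3 ^ Suc k dvd (u + X) - (v + Y)"

text \<open>The square with upper right corner \<open>(u, v)\<close> has lower left corner
  \<open>(u - 1, v - 1)\<close>. A horizontal edge stops being red if the square below or above it
  is marked; a vertical edge becomes red if the square to its left or right is marked.\<close>

definition red :: "(int \<Rightarrow> int \<Rightarrow> bool) \<Rightarrow> (int \<times> int) set set" where
  "red Q = {{(x, y), (x + 1, y)} | x y. \<not> Q (x + 1) y \<and> \<not> Q (x + 1) (y + 1)} \<union>
     {{(x, y), (x, y + 1)} | x y. Q x (y + 1) \<or> Q (x + 1) (y + 1)}"

definition grid_edges_set :: "(int \<times> int) set set" where
  "grid_edges_set = {{(x, y), (x + 1, y)} | x y. True} \<union> {{(x, y), (x, y + 1)} | x y. True}"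

lemma horizontal_red_iff: "{(x, y), (x + 1, y)} \<in> red Q \<longleftrightarrow> \<not> Q (x + 1) y \<and> \<not> Q (x + 1) (y + 1)"
  unfolding red_def by (auto simp: doubleton_eq_iff)

lemma vertical_red_iff: "{(x, y), (x, y + 1)} \<in> red Q \<longleftrightarrow> Q x (y + 1) \<or> Q (x + 1) (y + 1)"
  unfolding red_def by (auto simp: doubleton_eq_iff)

lemma red_subset: "red Q \<subseteq> grid_edges_set"
  unfolding red_def grid_edges_set_def by blast

text \<open>Reflection in the diagonal exchanges rows and columns, so what holds for red holds for
  blue with the coordinates exchanged.\<close>

lemma blue_eq: "grid_edges_set - red Q = (`) prod.swap ` red (\<lambda>u v. Q v u)"
proof
  show "grid_edges_set - red Q \<subseteq> (`) prod.swap ` red (\<lambda>u v. Q v u)"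
  proof
    fix e assume e: "e \<in> grid_edges_set - red Q"
    then consider x y where "e = {(x, y), (x + 1, y)}" | x y where "e = {(x, y), (x, y + 1)}"
      unfolding grid_edges_set_def by blast
    then show "e \<in> (`) prod.swap ` red (\<lambda>u v. Q v u)"
    proof cases
      case 1
      then have "{(y, x), (y, x + 1)} \<in> red (\<lambda>u v. Q v u)"
        using e horizontal_red_iff[of x y Q] by (simp add: vertical_red_iff)
      moreover have "e = prod.swap ` {(y, x), (y, x + 1)}" using 1 by simp
      ultimately show ?thesis by blast
    next
      case 2
      then have "{(y, x), (y + 1, x)} \<in> red (\<lambda>u v. Q v u)"
        using e vertical_red_iff[of x y Q] by (simp add: horizontal_red_iff)
      moreover have "e = prod.swap ` {(y, x), (y + 1, x)}" using 2 by simp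
      ultimately show ?thesis by blast
    qed
  qed
  show "(`) prod.swap ` red (\<lambda>u v. Q v u) \<subseteq> grid_edges_set - red Q"
  proof
    fix e assume "e \<in> (`) prod.swap ` red (\<lambda>u v. Q v u)"
    then obtain e' where e': "e = prod.swap ` e'" "e' \<in> red (\<lambda>u v. Q v u)" by blast
    then consider x y where "e' = {(x, y), (x + 1, y)}" "\<not> Q y (x + 1)" "\<not> Q (y + 1) (x + 1)"
      | x y where "e' = {(x, y), (x, y + 1)}" "Q (y + 1) x \<or> Q (y + 1) (x + 1)"
      unfolding red_def by blast
    then show "e \<in> grid_edges_set - red Q"
    proof cases
      case 1
      then have "e = {(y, x), (y, x + 1)}" using e'(1) by simp
      then show ?thesis using 1(2,3) vertical_red_iff[of y x Q] unfolding grid_edges_set_def by blast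
    next
      case 2
      then have "e = {(y, x), (y + 1, x)}" using e'(1) by simp
      then show ?thesis using 2(2) horizontal_red_iff[of y x Q] unfolding grid_edges_set_def by blast
    qed
  qed
qed

lemma red_neighbour_iff:
  "{(x, y), u} \<in> red Q \<longleftrightarrow>
     u = (x + 1, y) \<and> \<not> Q (x + 1) y \<and> \<not> Q (x + 1) (y + 1) \<or>
     u = (x - 1, y) \<and> \<not> Q x y \<and> \<not> Q x (y + 1) \<or>
     u = (x, y + 1) \<and> (Q x (y + 1) \<or> Q (x + 1) (y + 1)) \<or>
     u = (x, y - 1) \<and> (Q x y \<or> Q (x + 1) y)" (is "_ \<longleftrightarrow> ?right \<or> ?left \<or> ?up \<or> ?down")
proof
  assume "{(x, y), u} \<in> red Q"
  then consider x' y' where "{(x, y), u} = {(x', y'), (x' + 1, y')}" "\<not> Q (x' + 1) y'" "\<not> Q (x' + 1) (y' + 1)"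
    | x' y' where "{(x, y), u} = {(x', y'), (x', y' + 1)}" "Q x' (y' + 1) \<or> Q (x' + 1) (y' + 1)"
    unfolding red_def by blast
  then show "?right \<or> ?left \<or> ?up \<or> ?down"
    by cases (auto simp: doubleton_eq_iff)
next
  have left: "{(x, y), (x - 1, y)} = {(x - 1, y), (x - 1 + 1, y)}" by auto
  have low: "{(x, y), (x, y - 1)} = {(x, y - 1), (x, y - 1 + 1)}" by auto
  assume "?right \<or> ?left \<or> ?up \<or> ?down"
  then show "{(x, y), u} \<in> red Q"
  proof (elim disjE)
    assume ?right then show ?thesis using horizontal_red_iff[of x y Q] by simp
  next
    assume ?left then show ?thesis using horizontal_red_iff[of "x - 1" y Q] left by simp
  next
    assume ?up then show ?thesis using vertical_red_iff[of x y Q] by simp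
  next
    assume ?down then show ?thesis using vertical_red_iff[of x "y - 1" Q] low by simp
  qed
qed

text \<open>Of the four squares around a vertex, no two that share an edge are marked. So none, one
  or two opposite ones are, and each of them replaces one of the two horizontal edges at the vertex
  by a vertical one.\<close>

lemma card_red_neighbours:
  assumes Q: "\<And>u v. Q u v \<Longrightarrow> \<not> Q (u + 1) v" "\<And>u v. Q u v \<Longrightarrow> \<not> Q u (v + 1)"
  shows "card {u. {p, u} \<in> red Q} = 2"
proof -
  obtain x y where p: "p = (x, y)" by (cases p)
  note mem = red_neighbour_iff[of x y _ Q, folded p]
  have two: "card {u. {p, u} \<in> red Q} = 2" if "a \<noteq> b" "\<And>u. {p, u} \<in> red Q \<longleftrightarrow> u = a \<or> u = b" for a b
  proof -
    have "{u. {p, u} \<in> red Q} = {a, b}" using that(2) by blast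
    then show ?thesis using that(1) by simp
  qed
  have n: "Q x y \<Longrightarrow> \<not> Q (x + 1) y" "Q x y \<Longrightarrow> \<not> Q x (y + 1)"
    "Q x (y + 1) \<Longrightarrow> \<not> Q (x + 1) (y + 1)" "Q (x + 1) y \<Longrightarrow> \<not> Q (x + 1) (y + 1)"
    using Q by blast+
  consider "Q x y" "Q (x + 1) (y + 1)" | "Q x y" "\<not> Q (x + 1) (y + 1)"
    | "\<not> Q x y" "Q (x + 1) (y + 1)" | "\<not> Q x y" "\<not> Q (x + 1) (y + 1)" "Q (x + 1) y" "Q x (y + 1)"
    | "\<not> Q x y" "\<not> Q (x + 1) (y + 1)" "Q (x + 1) y" "\<not> Q x (y + 1)"
    | "\<not> Q x y" "\<not> Q (x + 1) (y + 1)" "\<not> Q (x + 1) y" "Q x (y + 1)"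
    | "\<not> Q x y" "\<not> Q (x + 1) (y + 1)" "\<not> Q (x + 1) y" "\<not> Q x (y + 1)" by blast
  then show ?thesis
  proof cases
    case 1 then show ?thesis by (intro two[of "(x, y + 1)" "(x, y - 1)"]) (use n mem in \<open>simp, blast\<close>)
  next
    case 2 then show ?thesis by (intro two[of "(x + 1, y)" "(x, y - 1)"]) (use n mem in \<open>simp, blast\<close>)
  next
    case 3 then show ?thesis by (intro two[of "(x - 1, y)" "(x, y + 1)"]) (use n mem in \<open>simp, blast\<close>)
  next
    case 4 then show ?thesis by (intro two[of "(x, y + 1)" "(x, y - 1)"]) (use n mem in \<open>simp, blast\<close>)
  next
    case 5 then show ?thesis by (intro two[of "(x - 1, y)" "(x, y - 1)"]) (use n mem in \<open>simp, blast\<close>)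
  next
    case 6 then show ?thesis by (intro two[of "(x + 1, y)" "(x, y + 1)"]) (use n mem in \<open>simp, blast\<close>)
  next
    case 7 then show ?thesis by (intro two[of "(x + 1, y)" "(x - 1, y)"]) (use n mem in \<open>simp, blast\<close>)
  qed
qed

text \<open>Cut the red rays at all edges that marks of valuation at least \<open>k\<close> can affect. For
  \<open>n = 3^k\<close> with \<open>k > 0\<close>, each resulting segment fills the set of vertices with a common value of
  \<open>parallelogram n\<close>.\<close>

definition parallelogram :: "int \<Rightarrow> int \<times> int \<Rightarrow> int \<times> int" where
  "parallelogram n = (\<lambda>(x, y). (y div n, (2 * x + y + 1) div n))"

lemma parallelogram_eqI:
  assumes "y = n * j + r" "0 \<le> r" "r < n" "2 * x + y + 1 = n * t + r'" "0 \<le> r'" "r' < n"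
  shows "parallelogram n (x, y) = (j, t)"
  unfolding parallelogram_def prod.case
  using int_div_pos_eq[OF assms(1-3)] int_div_pos_eq[OF assms(4-6)] by simp

section \<open>Merging parallelograms, for an abstract connectivity relation\<close>

locale grid_equivalence =
  fixes C :: "int \<times> int \<Rightarrow> int \<times> int \<Rightarrow> bool"
  assumes refl: "C p p" and sym: "C p q \<Longrightarrow> C q p" and trans: "C p q \<Longrightarrow> C q r \<Longrightarrow> C p r"
begin

lemma link: "C a a' \<Longrightarrow> C b b' \<Longrightarrow> C a b \<Longrightarrow> C a' b'"
  using sym trans by blast

lemma chain:
  assumes "\<And>x::int. C (f x) (f (x + 1))"
  shows "C (f a) (f b)"
proof -
  have up: "C (f a) (f (a + int k))" for a k
  proof (induction k)
    case 0
    then show ?case using refl by simp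
  next
    case (Suc k)
    have "C (f (a + int k)) (f (a + int (Suc k)))" using assms[of "a + int k"] by (simp add: ac_simps)
    with Suc show ?case by (rule trans)
  qed
  show ?thesis
  proof (cases "a \<le> b")
    case True
    then show ?thesis using up[of a "nat (b - a)"] by simp
  next
    case False
    then have "C (f b) (f a)" using up[of b "nat (a - b)"] by simp
    then show ?thesis by (rule sym)
  qed
qed

text \<open>Nine parallelograms are merged into one: three in a row for each of three strips, then
  the strips. \<open>B\<close> and \<open>T\<close> pass an unmarked corner
  \<open>(n * i, n * j)\<close> along the row just above or just below the cut between strips;
  \<open>L\<close> and \<open>R\<close> climb along the sides of a marked square.\<close>

lemma parallelogram_triple:
  assumes n: "n \<ge> 2" and IH: "\<And>p q. parallelogram n p = parallelogram n q \<Longrightarrow> C p q"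
    and B: "\<And>i j. \<not> 3 dvd i - j \<Longrightarrow> C (n * i - 1, n * j) (n * i, n * j)"
    and T: "\<And>i j. \<not> 3 dvd i - j \<Longrightarrow> C (n * i - 1, n * j - 1) (n * i, n * j - 1)"
    and L: "\<And>i j. 3 dvd i - j \<Longrightarrow> \<not> 3 dvd j \<Longrightarrow> C (n * i - 1, n * j - 1) (n * i - 1, n * j)"
    and R: "\<And>i j. 3 dvd i - j \<Longrightarrow> \<not> 3 dvd j \<Longrightarrow> C (n * i, n * j - 1) (n * i, n * j)"
    and eq: "parallelogram (3 * n) p = parallelogram (3 * n) q"
  shows "C p q"
proof -
  define pt where "pt j t = ((n * t - n * j) div 2, n * j)" for j t
  have rep: "C p (pt j t)" if "parallelogram n p = (j, t)" for p j t
  proof (rule IH)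
    let ?x = "(n * t - n * j) div 2"
    have "parallelogram n (?x, n * j) = (j, t)"
    proof (cases "even (n * t - n * j)")
      case True
      then have "2 * ?x = n * t - n * j" by simp
      then show ?thesis using n by (intro parallelogram_eqI[of _ _ _ 0 _ _ 1]) simp_all
    next
      case False
      then have "2 * ?x + 1 = n * t - n * j" by (rule odd_two_times_div_two_succ)
      then show ?thesis using n by (intro parallelogram_eqI[of _ _ _ 0 _ _ 0]) simp_all
    qed
    then show "parallelogram n p = parallelogram n (pt j t)" using that by (simp add: pt_def)
  qed
  \<comment> \<open>The segments \<open>t - 1\<close> and \<open>t\<close> of strip \<open>j\<close>
    are separated at a corner on the bottom or on the top of the strip, depending on the parity of
    \<open>t - j\<close>; the summand 1 in \<open>parallelogram\<close> places the left and right
    vertices of the corner square on different sides of the cut. Modulo 3, \<open>t\<close> is minus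
    the difference of the two corner indices, so \<open>B\<close> or \<open>T\<close> applies when 3
    does not divide \<open>t\<close>.\<close>
  have strip: "C (pt j (t - 1)) (pt j t)" if "\<not> 3 dvd t" for j t
  proof (cases "even (t - j)")
    case True
    then obtain i where i: "t = j + 2 * i" by (metis evenE diff_eq_eq add.commute)
    have "\<not> 3 dvd i - j" using that i by presburger
    from B[OF this] show ?thesis
    proof (rule link[rotated 2])
      show "C (n * i - 1, n * j) (pt j (t - 1))"
        using n by (intro rep parallelogram_eqI[of _ _ _ 0 _ _ "n - 1"]) (simp_all add: i algebra_simps)
      show "C (n * i, n * j) (pt j t)"
        using n by (intro rep parallelogram_eqI[of _ _ _ 0 _ _ 1]) (simp_all add: i algebra_simps)
    qed
  next
    case False
    then obtain i where "t - j = 2 * i + 1" by (rule oddE)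
    then have i: "t = j + 2 * i + 1" by simp
    have "\<not> 3 dvd i - (j + 1)" using that i by presburger
    from T[OF this] show ?thesis
    proof (rule link[rotated 2])
      show "C (n * i - 1, n * (j + 1) - 1) (pt j (t - 1))"
        using n by (intro rep parallelogram_eqI[of _ _ _ "n - 1" _ _ "n - 2"]) (simp_all add: i algebra_simps)
      show "C (n * i, n * (j + 1) - 1) (pt j t)"
        using n by (intro rep parallelogram_eqI[of _ _ _ "n - 1" _ _ 0]) (simp_all add: i algebra_simps)
    qed
  qed
  have strip3: "C (pt j t) (pt j (3 * (t div 3)))" for j t
  proof -
    let ?s = "3 * (t div 3)"
    have "\<not> 3 dvd ?s + 1" "\<not> 3 dvd ?s + 2" by presburger+
    from strip[OF this(1), of j] strip[OF this(2), of j]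
    have 1: "C (pt j ?s) (pt j (?s + 1))" and 2: "C (pt j (?s + 1)) (pt j (?s + 2))"
      by (simp_all add: ac_simps)
    have "C (pt j r) (pt j ?s)" if "r = ?s \<or> r = ?s + 1 \<or> r = ?s + 2" for r
      using that refl sym[OF 1] sym[OF trans[OF 1 2]] by blast
    moreover have "t = ?s \<or> t = ?s + 1 \<or> t = ?s + 2" by presburger
    ultimately show ?thesis by blast
  qed
  \<comment> \<open>By \<open>strip3\<close> a single vertical link suffices. Since 3 is odd, the
    segment from \<open>3 * t\<close> to \<open>3 * t + 2\<close> has exactly one end at a corner on
    the boundary to strip \<open>j + 1\<close>: at a right end the link is the left side of the
    marked square, at a left end the right side.\<close>
  have vert: "C (pt j (3 * t)) (pt (j + 1) (3 * t))" if "\<not> 3 dvd j + 1" for j t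
  proof -
    have "\<exists>s. s div 3 = t \<and> C (pt j s) (pt (j + 1) s)"
    proof (cases "even (3 * t + 2 - j)")
      case True
      then obtain i where "3 * t + 2 - j = 2 * i" by (rule evenE)
      then have i: "3 * t + 2 = j + 2 * i" by simp
      have "3 dvd i - (j + 1)" using i by presburger
      from L[OF this that] have "C (pt j (j + 2 * i)) (pt (j + 1) (j + 2 * i))"
      proof (rule link[rotated 2])
        show "C (n * i - 1, n * (j + 1) - 1) (pt j (j + 2 * i))"
          using n by (intro rep parallelogram_eqI[of _ _ _ "n - 1" _ _ "n - 2"]) (simp_all add: algebra_simps)
        show "C (n * i - 1, n * (j + 1)) (pt (j + 1) (j + 2 * i))"
          using n by (intro rep parallelogram_eqI[of _ _ _ 0 _ _ "n - 1"]) (simp_all add: algebra_simps)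
      qed
      then show ?thesis using i by (intro exI[of _ "3 * t + 2"]) simp
    next
      case False
      then obtain i where "3 * t + 2 - j = 2 * i + 1" by (rule oddE)
      then have i: "3 * t = j + 2 * (i - 1) + 1" by simp
      have "3 dvd (i - 1) - (j + 1)" using i by presburger
      from R[OF this that] have "C (pt j (j + 2 * (i - 1) + 1)) (pt (j + 1) (j + 2 * (i - 1) + 1))"
      proof (rule link[rotated 2])
        show "C (n * (i - 1), n * (j + 1) - 1) (pt j (j + 2 * (i - 1) + 1))"
          using n by (intro rep parallelogram_eqI[of _ _ _ "n - 1" _ _ 0]) (simp_all add: algebra_simps)
        show "C (n * (i - 1), n * (j + 1)) (pt (j + 1) (j + 2 * (i - 1) + 1))"
          using n by (intro rep parallelogram_eqI[of _ _ _ 0 _ _ 1]) (simp_all add: algebra_simps)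
      qed
      then show ?thesis unfolding i[symmetric] by (intro exI[of _ "3 * t"]) simp
    qed
    then obtain s where s: "s div 3 = t" "C (pt j s) (pt (j + 1) s)" by blast
    from strip3[of j s] strip3[of "j + 1" s] s(2) show ?thesis unfolding s(1) by (rule link)
  qed
  have vert3: "C (pt j (3 * t)) (pt (3 * (j div 3)) (3 * t))" for j t
  proof -
    let ?i = "3 * (j div 3)"
    have 1: "C (pt ?i (3 * t)) (pt (?i + 1) (3 * t))" by (rule vert) presburger
    have "C (pt (?i + 1) (3 * t)) (pt (?i + 1 + 1) (3 * t))" by (rule vert) presburger
    then have 2: "C (pt (?i + 1) (3 * t)) (pt (?i + 2) (3 * t))" by (simp add: ac_simps)
    have "C (pt r (3 * t)) (pt ?i (3 * t))" if "r = ?i \<or> r = ?i + 1 \<or> r = ?i + 2" for r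
      using that refl sym[OF 1] sym[OF trans[OF 1 2]] by blast
    moreover have "j = ?i \<or> j = ?i + 1 \<or> j = ?i + 2" by presburger
    ultimately show ?thesis by blast
  qed
  have canon: "C p (pt (3 * J) (3 * t))" if "parallelogram (3 * n) p = (J, t)" for p J t
  proof -
    obtain j s where js: "parallelogram n p = (j, s)" by (metis surj_pair)
    have "y div (3 * n) = y div n div 3" for y
      using n by (metis zdiv_zmult2_eq mult.commute zero_le_numeral)
    then have "J = j div 3" "t = s div 3"
      using that js by (cases p; simp add: parallelogram_def)+
    then show ?thesis using trans[OF rep[OF js] trans[OF strip3 vert3]] by simp
  qed
  obtain J t where Jt: "parallelogram (3 * n) q = (J, t)" by (metis surj_pair)
  show ?thesis using trans[OF canon sym[OF canon[OF Jt]]] eq Jt by simp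
qed

text \<open>For \<open>n = 1\<close> the bottom and top rows of a strip coincide, so a horizontal
  edge must avoid marked squares on both sides; hence the first merging is done directly.\<close>

lemma parallelogram_3:
  assumes H: "\<And>u y. \<not> 3 dvd u - y \<Longrightarrow> \<not> 3 dvd u - (y + 1) \<Longrightarrow> C (u - 1, y) (u, y)"
    and L: "\<And>u v. 3 dvd u - v \<Longrightarrow> \<not> 3 dvd v \<Longrightarrow> C (u - 1, v - 1) (u - 1, v)"
    and R: "\<And>u v. 3 dvd u - v \<Longrightarrow> \<not> 3 dvd v \<Longrightarrow> C (u, v - 1) (u, v)"
    and eq: "parallelogram 3 p = parallelogram 3 q"
  shows "C p q"
proof -
  define pt where "pt j t = ((3 * t - j) div 2, j)" for j t :: int
  \<comment> \<open>Each row of the parallelogram has one or two vertices, and \<open>pt y t\<close>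
    is the left one.\<close>
  have rep: "C (x, y) (pt y t)" if "3 * t \<le> 2 * x + y + 1" "2 * x + y + 1 < 3 * t + 3" for x y t
  proof -
    have "x = (3 * t - y) div 2 \<or> x - 1 = (3 * t - y) div 2 \<and> 2 * x + y + 1 = 3 * t + 2"
      using that by presburger
    then show ?thesis
    proof
      assume "x = (3 * t - y) div 2"
      then show ?thesis using refl by (simp add: pt_def)
    next
      assume x: "x - 1 = (3 * t - y) div 2 \<and> 2 * x + y + 1 = 3 * t + 2"
      then have "\<not> 3 dvd x - y" "\<not> 3 dvd x - (y + 1)" by presburger+
      from sym[OF H[OF this]] show ?thesis using x by (simp add: pt_def)
    qed
  qed
  have vert: "C (pt j t) (pt (j + 1) t)" if "\<not> 3 dvd j + 1" for j t
  proof (cases "even (3 * t + 2 - j)")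
    case True
    then obtain u where "3 * t + 2 - j = 2 * u" by (rule evenE)
    then have u: "3 * t + 2 = j + 2 * u" by simp
    have "3 dvd u - (j + 1)" using u by presburger
    from L[OF this that] have e: "C (u - 1, j) (u - 1, j + 1)" by simp
    have "C (u - 1, j) (pt j t)" using u by (intro rep) presburger+
    moreover have "C (u - 1, j + 1) (pt (j + 1) t)" using u by (intro rep) presburger+
    ultimately show ?thesis using e by (rule link)
  next
    case False
    then obtain u where "3 * t + 2 - j = 2 * u + 1" by (rule oddE)
    then have u: "3 * t = j + 2 * (u - 1) + 1" by simp
    have "3 dvd (u - 1) - (j + 1)" using u by presburger
    from R[OF this that] have e: "C (u - 1, j) (u - 1, j + 1)" by simp
    have "C (u - 1, j) (pt j t)" using u by (intro rep) presburger+
    moreover have "C (u - 1, j + 1) (pt (j + 1) t)" using u by (intro rep) presburger+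
    ultimately show ?thesis using e by (rule link)
  qed
  have vert3: "C (pt j t) (pt (3 * (j div 3)) t)" for j t
  proof -
    let ?i = "3 * (j div 3)"
    have 1: "C (pt ?i t) (pt (?i + 1) t)" by (rule vert) presburger
    have "C (pt (?i + 1) t) (pt (?i + 1 + 1) t)" by (rule vert) presburger
    then have 2: "C (pt (?i + 1) t) (pt (?i + 2) t)" by (simp add: ac_simps)
    have "C (pt r t) (pt ?i t)" if "r = ?i \<or> r = ?i + 1 \<or> r = ?i + 2" for r
      using that refl sym[OF 1] sym[OF trans[OF 1 2]] by blast
    moreover have "j = ?i \<or> j = ?i + 1 \<or> j = ?i + 2" by presburger
    ultimately show ?thesis by blast
  qed
  have canon: "C p (pt (3 * J) t)" if "parallelogram 3 p = (J, t)" for p J t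
  proof -
    obtain x y where p: "p = (x, y)" by (cases p)
    have Jt: "J = y div 3" "t = (2 * x + y + 1) div 3" using that by (simp_all add: p parallelogram_def)
    then have "C (x, y) (pt y t)" by (intro rep) presburger+
    then show ?thesis using trans vert3[of y t] by (simp add: p Jt(1))
  qed
  obtain J t where Jt: "parallelogram 3 q = (J, t)" by (metis surj_pair)
  show ?thesis using trans[OF canon sym[OF canon[OF Jt]]] eq Jt by simp
qed

end

section \<open>Marks determined by two 3-adic shifts\<close>

definition marked :: "(nat \<Rightarrow> int) \<Rightarrow> (nat \<Rightarrow> int) \<Rightarrow> int \<Rightarrow> int \<Rightarrow> bool" where
  "marked X Y u v \<longleftrightarrow> (\<exists>k. marked_level k (X (Suc k)) (Y (Suc k)) u v)"

lemma marked_transpose: "marked X Y v u \<longleftrightarrow> marked Y X u v"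
proof -
  have "marked_level k A B v u \<longleftrightarrow> marked_level k B A u v" for k A B
    using dvd_diff_commute unfolding marked_level_def by blast
  then show ?thesis by (simp add: marked_def)
qed

locale adic_shifts =
  fixes X Y :: "nat \<Rightarrow> int"
  assumes X_Suc: "3 ^ k dvd X (Suc k) - X k" and Y_Suc: "3 ^ k dvd Y (Suc k) - Y k"
begin

lemma adic_diff:
  assumes "\<And>k. 3 ^ k dvd W (Suc k) - W k" "l \<le> k"
  shows "(3::int) ^ l dvd W k - W l"
  using assms(2)
proof (induction k rule: dec_induct)
  case (step k)
  have "(3::int) ^ l dvd W (Suc k) - W k"
    using assms(1)[of k] le_imp_power_dvd[of l k "3::int"] step(1) by (meson dvd_trans)
  from dvd_add[OF this step.IH] show ?case by simp
qed simp

lemma X_dvd: "l \<le> k \<Longrightarrow> 3 ^ l dvd u + X k \<longleftrightarrow> 3 ^ l dvd u + X l"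
  using adic_diff[of X l k, OF X_Suc] dvd_add_right_iff[of "3 ^ l" "X k - X l" "u + X l"]
  by (simp add: algebra_simps)

lemma Y_dvd: "l \<le> k \<Longrightarrow> 3 ^ l dvd v + Y k \<longleftrightarrow> 3 ^ l dvd v + Y l"
  using adic_diff[of Y l k, OF Y_Suc] dvd_add_right_iff[of "3 ^ l" "Y k - Y l" "v + Y l"]
  by (simp add: algebra_simps)

text \<open>For \<open>l < k\<close> the divisibility contradicts the valuation \<open>l\<close>;
  for \<open>l = k\<close> the congruence is part of being marked; for \<open>l > k\<close> both
  terms are divisible by \<open>3 ^ Suc k\<close>. By contraposition a square is seen to be unmarked
  at all levels from residues of stage \<open>Suc k\<close> alone.\<close>

lemma marked_levelD:
  assumes "marked_level l (X (Suc l)) (Y (Suc l)) u v" and "3 ^ k dvd u + X (Suc k)" "3 ^ k dvd v + Y (Suc k)"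
  shows "3 ^ Suc k dvd (u + X (Suc k)) - (v + Y (Suc k))"
proof -
  consider "l < k" | "l = k" | "Suc k \<le> l" by linarith
  then show ?thesis
  proof cases
    case 1
    then have "(3::int) ^ Suc l dvd 3 ^ k" by (intro le_imp_power_dvd) simp
    then have "3 ^ Suc l dvd u + X (Suc k)" using assms(2) by (rule dvd_trans)
    then have "3 ^ Suc l dvd u + X (Suc l)" using X_dvd[of "Suc l" "Suc k" u] 1 by simp
    then show ?thesis using assms(1) by (simp add: marked_level_def)
  next
    case 2
    then show ?thesis using assms(1) by (simp add: marked_level_def)
  next
    case 3
    have p: "(3::int) ^ Suc k dvd 3 ^ l" using 3 by (rule le_imp_power_dvd)
    have "3 ^ Suc k dvd u + X (Suc l)" "3 ^ Suc k dvd v + Y (Suc l)"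
      using assms(1) dvd_trans[OF p] unfolding marked_level_def by blast+
    then have "3 ^ Suc k dvd u + X (Suc k)" "3 ^ Suc k dvd v + Y (Suc k)"
      using X_dvd[of "Suc k" "Suc l" u] Y_dvd[of "Suc k" "Suc l" v] 3 by simp_all
    then show ?thesis by (rule dvd_diff)
  qed
qed

lemma not_markedI:
  assumes "3 ^ k dvd u + X (Suc k)" "3 ^ k dvd v + Y (Suc k)"
    "\<not> 3 ^ Suc k dvd (u + X (Suc k)) - (v + Y (Suc k))"
  shows "\<not> marked X Y u v"
  using marked_levelD[OF _ assms(1,2)] assms(3) unfolding marked_def by blast

lemma not_marked_0: "\<not> 3 dvd (u + X (Suc k)) - (v + Y (Suc k)) \<Longrightarrow> \<not> marked X Y u v"
proof (rule not_markedI[of 0])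
  assume *: "\<not> 3 dvd (u + X (Suc k)) - (v + Y (Suc k))"
  have "3 dvd X (Suc k) - X 1" "3 dvd Y (Suc k) - Y 1"
    using adic_diff[of X 1 "Suc k", OF X_Suc] adic_diff[of Y 1 "Suc k", OF Y_Suc] by simp_all
  with * show "\<not> 3 ^ Suc 0 dvd (u + X (Suc 0)) - (v + Y (Suc 0))" by simp presburger
qed simp_all

text \<open>The valuation of the first coordinate follows from that of the second and the
  congruence.\<close>

lemma markedI:
  assumes "3 ^ k dvd v + Y (Suc k)" "\<not> 3 ^ Suc k dvd v + Y (Suc k)"
    "3 ^ Suc k dvd (u + X (Suc k)) - (v + Y (Suc k))"
  shows "marked X Y u v"
proof -
  let ?a = "u + X (Suc k)" and ?b = "v + Y (Suc k)"
  have "(3::int) ^ k dvd 3 ^ Suc k" by simp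
  then have "3 ^ k dvd ?a - ?b" using assms(3) by (rule dvd_trans)
  from dvd_add[OF this assms(1)] have "3 ^ k dvd ?a" by simp
  moreover have "\<not> 3 ^ Suc k dvd ?a"
  proof
    assume "3 ^ Suc k dvd ?a"
    from dvd_diff[OF this assms(3)] have "3 ^ Suc k dvd ?b" by simp
    with assms(2) show False ..
  qed
  ultimately have "marked_level k (X (Suc k)) (Y (Suc k)) u v"
    unfolding marked_level_def using assms by blast
  then show ?thesis unfolding marked_def by blast
qed

text \<open>Two marked squares never share an edge, so no edge is swapped twice.\<close>

lemma marked_not_adjacent_X: "marked X Y u v \<Longrightarrow> \<not> marked X Y (u + 1) v"
proof
  assume "marked X Y u v" and "marked X Y (u + 1) v"
  then obtain l where l: "marked_level l (X (Suc l)) (Y (Suc l)) u v" unfolding marked_def by blast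
  have d: "3 ^ l dvd u + X (Suc l)" "3 ^ l dvd v + Y (Suc l)" "\<not> 3 ^ Suc l dvd v + Y (Suc l)"
    "3 ^ Suc l dvd (u + X (Suc l)) - (v + Y (Suc l))"
    using l unfolding marked_level_def by blast+
  obtain k where k: "marked_level k (X (Suc k)) (Y (Suc k)) (u + 1) v"
    using \<open>marked X Y (u + 1) v\<close> unfolding marked_def by blast
  have e: "3 ^ k dvd u + 1 + X (Suc k)" "3 ^ k dvd v + Y (Suc k)" "\<not> 3 ^ Suc k dvd v + Y (Suc k)"
    "3 ^ Suc k dvd (u + 1 + X (Suc k)) - (v + Y (Suc k))"
    using k unfolding marked_level_def by blast+
  have "\<not> k < l" if "3 ^ l dvd v + Y (Suc l)" "\<not> 3 ^ Suc k dvd v + Y (Suc k)" for k l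
  proof
    assume "k < l"
    then have "(3::int) ^ Suc k dvd 3 ^ l" by (intro le_imp_power_dvd) simp
    then have "3 ^ Suc k dvd v + Y (Suc l)" using that(1) by (rule dvd_trans)
    then show False using that(2) Y_dvd[of "Suc k" "Suc l" v] \<open>k < l\<close> by simp
  qed
  \<comment> \<open>Both marks have the same \<open>v\<close>, whose valuation is the level. At
    equal levels the two congruences differ by 1.\<close>
  from this[OF d(2) e(3)] this[OF e(2) d(3)] have "k = l" by simp
  from dvd_diff[OF e(4)[unfolded this] d(4)] have "(3::int) ^ Suc l dvd 1" by (simp add: algebra_simps)
  then have "(3::int) dvd 1" unfolding power_Suc by (rule dvd_mult_left)
  then show False by simp
qed

end

lemma (in adic_shifts) adic_shifts_swap: "adic_shifts Y X"
  by unfold_locales (rule Y_Suc, rule X_Suc)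

lemma (in adic_shifts) marked_not_adjacent_Y: "marked X Y u v \<Longrightarrow> \<not> marked X Y u (v + 1)"
  using adic_shifts.marked_not_adjacent_X[OF adic_shifts_swap] marked_transpose by blast

text \<open>\<open>Y\<close> locates the boundaries of the strips and \<open>2 * X + Y\<close> the
  slanted sides of the parallelograms; no such boundary may stay at a fixed place at all
  scales.\<close>

locale generic_adic_shifts = adic_shifts +
  assumes generic_Y: "\<exists>k. \<not> 3 ^ k dvd w + Y k"
    and generic_Z: "\<exists>k. \<not> 3 ^ k dvd w + (2 * X k + Y k)"
begin

abbreviation Q where "Q \<equiv> marked X Y"

text \<open>Connection by red edges, in coordinates shifted by \<open>X k\<close> and
  \<open>Y k\<close>, where the parallelograms of stage \<open>k\<close> are aligned with the
  origin.\<close>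

definition conn :: "nat \<Rightarrow> int \<times> int \<Rightarrow> int \<times> int \<Rightarrow> bool" where
  "conn k p q \<longleftrightarrow> connected_via (red Q) (fst p - X k, snd p - Y k) (fst q - X k, snd q - Y k)"

sublocale grid_equivalence "conn k" for k
  by unfold_locales (auto simp: conn_def intro: connected_via_sym connected_via_trans)

lemma conn_horizontal:
  "\<not> Q (u - X k) (v - Y k) \<Longrightarrow> \<not> Q (u - X k) (v + 1 - Y k) \<Longrightarrow> conn k (u - 1, v) (u, v)"
  using horizontal_red_iff[of "u - 1 - X k" "v - Y k" Q]
  unfolding conn_def by (intro connected_via_edge) (simp add: algebra_simps)

lemma conn_vertical:
  assumes "Q (u - X k) (v - Y k)"
  shows "conn k (u - 1, v - 1) (u - 1, v)" "conn k (u, v - 1) (u, v)"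
  using vertical_red_iff[of "u - 1 - X k" "v - 1 - Y k" Q] vertical_red_iff[of "u - X k" "v - 1 - Y k" Q] assms
  unfolding conn_def by (auto intro!: connected_via_edge simp: algebra_simps)

lemma conn_parallelogram_base:
  assumes "parallelogram 3 p = parallelogram 3 q"
  shows "conn 1 p q"
proof (rule parallelogram_3[OF _ _ _ assms])
  fix u v :: int
  show "conn 1 (u - 1, v) (u, v)" if "\<not> 3 dvd u - v" "\<not> 3 dvd u - (v + 1)"
    using that by (intro conn_horizontal not_marked_0[of _ 0]) simp_all
  assume *: "3 dvd u - v" "\<not> 3 dvd v"
  have "Q (u - X 1) (v - Y 1)" by (rule markedI[of 0]) (use * in simp_all)
  then show "conn 1 (u - 1, v - 1) (u - 1, v)" "conn 1 (u, v - 1) (u, v)" by (rule conn_vertical)+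
qed

text \<open>At multiples of \<open>3 ^ k\<close>, marks needed for the merging are decided modulo 3.
  The squares directly above and below, treated by \<open>off\<close>, are unmarked because 3
  divides \<open>3 ^ k\<close> but not the offset.\<close>

lemma conn_parallelogram_step:
  assumes IH: "\<And>p q. parallelogram (3 ^ k) p = parallelogram (3 ^ k) q \<Longrightarrow> conn (Suc k) p q"
    and k: "k > 0" and eq: "parallelogram (3 ^ Suc k) p = parallelogram (3 ^ Suc k) q"
  shows "conn (Suc k) p q"
proof -
  let ?n = "3 ^ k :: int"
  have n3: "3 dvd ?n" using k by simp
  have n: "?n \<ge> 2"
  proof -
    obtain l where "k = Suc l" using k by (cases k) simp_all
    then have "?n = 3 * 3 ^ l" by simp
    moreover have "(1::int) \<le> 3 ^ l" by simp
    ultimately show ?thesis by linarith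
  qed
  have cancel: "3 ^ Suc k dvd ?n * c \<longleftrightarrow> 3 dvd c" for c by (simp add: mult.commute[of 3])
  have no: "\<not> Q (?n * i - X (Suc k)) (?n * j - Y (Suc k))" if "\<not> 3 dvd i - j" for i j
  proof (rule not_markedI[of k])
    show "\<not> 3 ^ Suc k dvd ?n * i - X (Suc k) + X (Suc k) - (?n * j - Y (Suc k) + Y (Suc k))"
      using that cancel[of "i - j"] by (simp add: right_diff_distrib)
  qed simp_all
  have yes: "Q (?n * i - X (Suc k)) (?n * j - Y (Suc k))" if "3 dvd i - j" "\<not> 3 dvd j" for i j
  proof (rule markedI[of k])
    show "3 ^ Suc k dvd ?n * i - X (Suc k) + X (Suc k) - (?n * j - Y (Suc k) + Y (Suc k))"
      using that(1) cancel[of "i - j"] by (simp add: right_diff_distrib)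
    show "\<not> 3 ^ Suc k dvd ?n * j - Y (Suc k) + Y (Suc k)" using that(2) cancel[of j] by simp
  qed simp
  have off: "\<not> Q (?n * i - X (Suc k)) (?n * j + e - Y (Suc k))" if "e = 1 \<or> e = - 1" for i j e
  proof (rule not_marked_0[of _ k])
    have "3 dvd ?n * (i - j)" using n3 by simp
    then have "3 dvd ?n * i - ?n * j" by (simp add: right_diff_distrib)
    moreover have "\<not> 3 dvd e" using that by auto
    ultimately show "\<not> 3 dvd ?n * i - X (Suc k) + X (Suc k) - (?n * j + e - Y (Suc k) + Y (Suc k))"
      by presburger
  qed
  show ?thesis
  proof (rule parallelogram_triple[OF n IH])
    show "conn (Suc k) (?n * i - 1, ?n * j) (?n * i, ?n * j)" if "\<not> 3 dvd i - j" for i j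
      using no[OF that] off[of 1 i j] by (intro conn_horizontal) simp_all
    show "conn (Suc k) (?n * i - 1, ?n * j - 1) (?n * i, ?n * j - 1)" if "\<not> 3 dvd i - j" for i j
      using no[OF that] off[of "- 1" i j] by (intro conn_horizontal) simp_all
    show "conn (Suc k) (?n * i - 1, ?n * j - 1) (?n * i - 1, ?n * j)"
      "conn (Suc k) (?n * i, ?n * j - 1) (?n * i, ?n * j)" if "3 dvd i - j" "\<not> 3 dvd j" for i j
      using yes[OF that] by (rule conn_vertical)+
    show "parallelogram (3 * ?n) p = parallelogram (3 * ?n) q" using eq by simp
  qed
qed

lemma conn_parallelogram:
  assumes "k > 0" "parallelogram (3 ^ k) p = parallelogram (3 ^ k) q"
  shows "conn k p q"
  using assms
proof (induction k arbitrary: p q)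
  case (Suc k)
  show ?case
  proof (cases "k = 0")
    case True
    then show ?thesis using conn_parallelogram_base Suc.prems by simp
  next
    case False
    show ?thesis
    proof (rule conn_parallelogram_step[OF _ _ Suc.prems(2)])
      show "k > 0" using False by simp
      fix p q :: "int \<times> int" assume pq: "parallelogram (3 ^ k) p = parallelogram (3 ^ k) q"
      let ?n = "3 ^ k :: int"
      obtain c where c: "X (Suc k) - X k = ?n * c" using X_Suc by (rule dvdE)
      obtain e where e: "Y (Suc k) - Y k = ?n * e" using Y_Suc by (rule dvdE)
      let ?f = "\<lambda>p :: int \<times> int. (fst p - ?n * c, snd p - ?n * e)"
      \<comment> \<open>Passing to the shifts of stage \<open>Suc k\<close> moves points by
        multiples of \<open>3 ^ k\<close>, which maps parallelograms to parallelograms.\<close>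
      have par: "parallelogram ?n (?f p) =
          (fst (parallelogram ?n p) - e, snd (parallelogram ?n p) - (2 * c + e))" for p
      proof -
        obtain x y where p: "p = (x, y)" by (cases p)
        have 1: "y - ?n * e = y + ?n * (- e)"
          and 2: "2 * (x - ?n * c) + (y - ?n * e) + 1 = 2 * x + y + 1 + ?n * (- (2 * c + e))"
          by (simp_all add: algebra_simps)
        have "(y - ?n * e) div ?n = - e + y div ?n"
          unfolding 1 by (rule div_mult_self2) simp
        moreover have "(2 * (x - ?n * c) + (y - ?n * e) + 1) div ?n = - (2 * c + e) + (2 * x + y + 1) div ?n"
          unfolding 2 by (rule div_mult_self2) simp
        ultimately show ?thesis by (simp only: p parallelogram_def prod.case fst_conv snd_conv) simp
      qed
      have "conn k (?f p) (?f q)" using Suc.IH[OF _ ] False par pq by simp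
      moreover have "fst p - ?n * c - X k = fst p - X (Suc k)" "snd p - ?n * e - Y k = snd p - Y (Suc k)" for p :: "int \<times> int"
        using c e by simp_all
      ultimately show "conn (Suc k) p q" by (simp add: conn_def)
    qed
  qed
qed simp

lemma generic_large:
  assumes W: "\<And>k. 3 ^ k dvd W (Suc k) - W k" and gen: "\<And>w. \<exists>k. \<not> (3::int) ^ k dvd w + W k"
  shows "\<exists>K. \<forall>k\<ge>K. \<not> (3::int) ^ k dvd w + W k"
proof -
  obtain K where K: "\<not> 3 ^ K dvd w + W K" using gen by blast
  have "\<not> 3 ^ k dvd w + W k" if "k \<ge> K" for k
  proof
    assume "3 ^ k dvd w + W k"
    then have "3 ^ K dvd w + W k" using le_imp_power_dvd[OF that, of "3::int"] by (rule dvd_trans[rotated])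
    from dvd_diff[OF this adic_diff[of W, OF W that]] K show False by simp
  qed
  then show ?thesis by blast
qed

text \<open>For \<open>z = 2 * x + y + 1\<close>, a unit step in \<open>y\<close> changes
  \<open>z\<close> by 1 and a unit step in \<open>x\<close> changes it by 2; hence the offsets 1 and
  2.\<close>

lemma eventually_same_parallelogram:
  "\<exists>k>0. (y + Y k) div 3 ^ k = (y + 1 + Y k) div 3 ^ k \<and>
     (z + (2 * X k + Y k)) div 3 ^ k = (z + 1 + (2 * X k + Y k)) div 3 ^ k \<and>
     (z + (2 * X k + Y k)) div 3 ^ k = (z + 2 + (2 * X k + Y k)) div 3 ^ k"
proof -
  let ?W = "\<lambda>k. 2 * X k + Y k"
  have W: "3 ^ k dvd ?W (Suc k) - ?W k" for k
    using dvd_add[OF dvd_mult[OF X_Suc[of k], of 2] Y_Suc[of k]] by (simp add: algebra_simps)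
  obtain K1 where K1: "\<And>k. k \<ge> K1 \<Longrightarrow> \<not> 3 ^ k dvd y + 1 + Y k"
    using generic_large[of Y "y + 1", OF Y_Suc generic_Y] by blast
  obtain K2 where K2: "\<And>k. k \<ge> K2 \<Longrightarrow> \<not> 3 ^ k dvd z + 1 + ?W k"
    using generic_large[of ?W "z + 1", OF W generic_Z] by blast
  obtain K3 where K3: "\<And>k. k \<ge> K3 \<Longrightarrow> \<not> 3 ^ k dvd z + 2 + ?W k"
    using generic_large[of ?W "z + 2", OF W generic_Z] by blast
  define k where "k = Suc (max K1 (max K2 K3))"
  have k: "k > 0" "k \<ge> K1" "k \<ge> K2" "k \<ge> K3" by (simp_all add: k_def)
  let ?n = "3 ^ k :: int"
  have div: "(a + 1) div ?n = a div ?n" if "\<not> ?n dvd a + 1" for a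
    using that by (intro div_add_1_eq) simp_all
  have 1: "(y + Y k + 1) div ?n = (y + Y k) div ?n"
    using K1[OF k(2)] by (intro div) (simp add: ac_simps)
  have 2: "(z + ?W k + 1) div ?n = (z + ?W k) div ?n"
    using K2[OF k(3)] by (intro div) (simp add: ac_simps)
  have 3: "(z + ?W k + 1 + 1) div ?n = (z + ?W k + 1) div ?n"
    using K3[OF k(4)] by (intro div) (simp add: ac_simps)
  have eqs: "y + 1 + Y k = y + Y k + 1" "z + 1 + ?W k = z + ?W k + 1" "z + 2 + ?W k = z + ?W k + 1 + 1"
    by simp_all
  show ?thesis by (intro exI[of _ k] conjI k(1)) (simp_all only: eqs 1 2 3)
qed

lemma red_connected: "connected_via (red Q) p q"
proof -
  let ?C = "connected_via (red Q)"
  interpret C: grid_equivalence ?C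
    by unfold_locales (auto intro: connected_via_sym connected_via_trans)
  have step: "?C (x, y) (x + 1, y)" "?C (x, y) (x, y + 1)" for x y
  proof -
    obtain k where k: "k > 0" "(y + Y k) div 3 ^ k = (y + 1 + Y k) div 3 ^ k"
      "(2 * x + y + 1 + (2 * X k + Y k)) div 3 ^ k = (2 * x + y + 1 + 1 + (2 * X k + Y k)) div 3 ^ k"
      "(2 * x + y + 1 + (2 * X k + Y k)) div 3 ^ k = (2 * x + y + 1 + 2 + (2 * X k + Y k)) div 3 ^ k"
      using eventually_same_parallelogram by blast
    have "parallelogram (3 ^ k) (x + X k, y + Y k) = parallelogram (3 ^ k) (x + 1 + X k, y + Y k)"
      "parallelogram (3 ^ k) (x + X k, y + Y k) = parallelogram (3 ^ k) (x + X k, y + 1 + Y k)"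
      using k by (simp_all add: parallelogram_def algebra_simps)
    from this[THEN conn_parallelogram[OF k(1)]]
    show "?C (x, y) (x + 1, y)" "?C (x, y) (x, y + 1)" by (simp_all add: conn_def)
  qed
  obtain x y x' y' where pq: "p = (x, y)" "q = (x', y')" by (metis surj_pair)
  have "?C (x, y) (x', y)" by (rule C.chain[where f = "\<lambda>x. (x, y)"]) (rule step)
  moreover have "?C (x', y) (x', y')" by (rule C.chain[where f = "\<lambda>y. (x', y)"]) (rule step)
  ultimately show ?thesis unfolding pq by (rule connected_via_trans)
qed

end

section \<open>Translations of the coloured grid, and the random decomposition\<close>

lemma carrier_Z2: "carrier Z2 = UNIV"
  by (simp add: Z2_def integer_group_def DirProd_def)

lemma mult_Z2: "(a, b) \<otimes>\<^bsub>Z2\<^esub> (c, d) = (a + c, b + d)"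
  by (simp add: Z2_def integer_group_def DirProd_def)

lemma group_Z2: "group Z2"
  unfolding Z2_def by (intro DirProd_group group_integer_group)

lemma edges_square_grid: "edges square_grid = grid_edges_set"
proof
  show "edges square_grid \<subseteq> grid_edges_set"
  proof
    fix e assume "e \<in> edges square_grid"
    then obtain g s where e: "e = {g, g \<otimes>\<^bsub>Z2\<^esub> s}" "s \<in> {(1, 0), (-1, 0), (0, 1), (0, -1)}"
      by (auto simp: square_grid_def cayley_graph_def)
    obtain x y where g: "g = (x, y)" by (cases g)
    have "{(x, y), (x - 1, y)} = {(x - 1, y), (x - 1 + 1, y)}" "{(x, y), (x, y - 1)} = {(x, y - 1), (x, y - 1 + 1)}"
      by auto
    with e(2) have "e = {(x, y), (x + 1, y)} \<or> e = {(x - 1, y), (x - 1 + 1, y)} \<or>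
        e = {(x, y), (x, y + 1)} \<or> e = {(x, y - 1), (x, y - 1 + 1)}"
      unfolding e(1) g by (elim insertE emptyE) (simp_all add: mult_Z2)
    then show "e \<in> grid_edges_set" unfolding grid_edges_set_def by blast
  qed
  show "grid_edges_set \<subseteq> edges square_grid"
  proof
    fix e assume "e \<in> grid_edges_set"
    then consider x y where "e = {(x, y), (x, y) \<otimes>\<^bsub>Z2\<^esub> (1, 0)}" | x y where "e = {(x, y), (x, y) \<otimes>\<^bsub>Z2\<^esub> (0, 1)}"
      unfolding grid_edges_set_def mult_Z2 by auto
    then show "e \<in> edges square_grid"
      unfolding square_grid_def cayley_graph_def graph.simps carrier_Z2 by cases blast+
  qed
qed

lemma translate_red: "translate Z2 (g, h) (red Q) = red (\<lambda>u v. Q (u - g) (v - h))"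
proof -
  have hor: "(\<lambda>p. (g, h) \<otimes>\<^bsub>Z2\<^esub> p) ` {(x, y), (x + 1, y)} = {(g + x, h + y), (g + x + 1, h + y)}" for x y
    by (simp add: mult_Z2 ac_simps)
  have ver: "(\<lambda>p. (g, h) \<otimes>\<^bsub>Z2\<^esub> p) ` {(x, y), (x, y + 1)} = {(g + x, h + y), (g + x, h + y + 1)}" for x y
    by (simp add: mult_Z2 ac_simps)
  show ?thesis
  proof
    show "translate Z2 (g, h) (red Q) \<subseteq> red (\<lambda>u v. Q (u - g) (v - h))"
    proof
      fix e assume "e \<in> translate Z2 (g, h) (red Q)"
      then obtain e' where e': "e = (\<lambda>p. (g, h) \<otimes>\<^bsub>Z2\<^esub> p) ` e'" "e' \<in> red Q"
        unfolding translate_def by blast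
      then consider x y where "e' = {(x, y), (x + 1, y)}" "\<not> Q (x + 1) y" "\<not> Q (x + 1) (y + 1)"
        | x y where "e' = {(x, y), (x, y + 1)}" "Q x (y + 1) \<or> Q (x + 1) (y + 1)"
        unfolding red_def by blast
      then show "e \<in> red (\<lambda>u v. Q (u - g) (v - h))"
      proof cases
        case 1
        then show ?thesis using horizontal_red_iff[of "g + x" "h + y" "\<lambda>u v. Q (u - g) (v - h)"]
          unfolding e'(1) 1(1) hor by (simp add: algebra_simps)
      next
        case 2
        then show ?thesis using vertical_red_iff[of "g + x" "h + y" "\<lambda>u v. Q (u - g) (v - h)"]
          unfolding e'(1) 2(1) ver by (simp add: algebra_simps)
      qed
    qed
    show "red (\<lambda>u v. Q (u - g) (v - h)) \<subseteq> translate Z2 (g, h) (red Q)"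
    proof
      fix e assume "e \<in> red (\<lambda>u v. Q (u - g) (v - h))"
      then consider x y where "e = {(x, y), (x + 1, y)}" "\<not> Q (x + 1 - g) (y - h)" "\<not> Q (x + 1 - g) (y + 1 - h)"
        | x y where "e = {(x, y), (x, y + 1)}" "Q (x - g) (y + 1 - h) \<or> Q (x + 1 - g) (y + 1 - h)"
        unfolding red_def by blast
      then show "e \<in> translate Z2 (g, h) (red Q)"
      proof cases
        case 1
        have "e = (\<lambda>p. (g, h) \<otimes>\<^bsub>Z2\<^esub> p) ` {(x - g, y - h), (x - g + 1, y - h)}"
          unfolding hor 1(1) by simp
        moreover have "{(x - g, y - h), (x - g + 1, y - h)} \<in> red Q"
          using 1(2,3) horizontal_red_iff[of "x - g" "y - h" Q] by (simp add: algebra_simps)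
        ultimately show ?thesis unfolding translate_def by blast
      next
        case 2
        have "e = (\<lambda>p. (g, h) \<otimes>\<^bsub>Z2\<^esub> p) ` {(x - g, y - h), (x - g, y - h + 1)}"
          unfolding ver 2(1) by simp
        moreover have "{(x - g, y - h), (x - g, y - h + 1)} \<in> red Q"
          using 2(2) vertical_red_iff[of "x - g" "y - h" Q] by (simp add: algebra_simps)
        ultimately show ?thesis unfolding translate_def by blast
      qed
    qed
  qed
qed

lemma marked_level_cong:
  assumes "3 ^ Suc j dvd A - A'" "3 ^ Suc j dvd B - B'"
  shows "marked_level j A B u v \<longleftrightarrow> marked_level j A' B' u v"
proof -
  have dvd: "d dvd w + C \<longleftrightarrow> d dvd w + C'" if "d dvd C - C'" for d w C C' :: int
  proof -
    have "w + C = (C - C') + (w + C')" by simp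
    then show ?thesis by (simp only: dvd_add_right_iff[OF that])
  qed
  have 1: "(3::int) ^ j dvd 3 ^ Suc j" by simp
  have eqs: "(u + A) - (v + B) = (u - v) + (A - B)" "(u + A') - (v + B') = (u - v) + (A' - B')"
    by simp_all
  have "3 ^ Suc j dvd (A - B) - (A' - B')"
    using dvd_diff[OF assms] by (simp add: algebra_simps)
  from dvd[OF this, of "u - v"]
  have "3 ^ Suc j dvd (u + A) - (v + B) \<longleftrightarrow> 3 ^ Suc j dvd (u + A') - (v + B')"
    unfolding eqs .
  then show ?thesis
    unfolding marked_level_def
    by (simp only: dvd[OF assms(1)] dvd[OF assms(2)] dvd[OF dvd_trans[OF 1 assms(1)]]
        dvd[OF dvd_trans[OF 1 assms(2)]])
qed

lemma marked_level_shift: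
  "marked_level j (A - g) (B - h) u v \<longleftrightarrow> marked_level j A B (u - g) (v - h)"
  by (simp add: marked_level_def algebra_simps)

context group
begin

text \<open>Thus the blue class moves along with the red one, and invariance of the pair reduces to
  that of red.\<close>

lemma translate_complement:
  assumes g: "g \<in> carrier G" and S: "S \<subseteq> carrier G" and F: "F \<subseteq> edges (cayley_graph G S)"
  shows "translate G g (edges (cayley_graph G S) - F) = edges (cayley_graph G S) - translate G g F"
proof -
  let ?E = "edges (cayley_graph G S)"
  have "e \<in> translate G g (?E - F) \<longleftrightarrow> e \<notin> translate G g F" if e: "e \<in> ?E" for e
  proof -
    have "(\<lambda>x. inv g \<otimes> x) ` e \<in> ?E" using translate_edge[OF inv_closed[OF g] S e] .
    then show ?thesis
      using mem_translate_iff[OF g S F e] mem_translate_iff[OF g S Diff_subset e, of F] by blast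
  qed
  moreover have "translate G g (?E - F) \<subseteq> ?E" by (rule translate_subset[OF g S Diff_subset])
  ultimately show ?thesis by blast
qed

end

lemma measurable_complement: "(\<lambda>F. edges G - F) \<in> edge_space G \<rightarrow>\<^sub>M edge_space G"
proof (rule measurable_edge_spaceI)
  let ?E = "edges G"
  show "?E - F \<subseteq> ?E" for F by (rule Diff_subset)
  fix A assume A: "A \<in> cylinder_sets G"
  obtain D where D: "finite D" "D \<subseteq> ?E"
    "\<And>F F'. F \<subseteq> ?E \<Longrightarrow> F' \<subseteq> ?E \<Longrightarrow> F \<inter> D = F' \<inter> D \<Longrightarrow> F \<in> A \<longleftrightarrow> F' \<in> A"
    using A by (rule cylinder_setsE) blast
  show "(\<lambda>F. ?E - F) -` A \<inter> Pow ?E \<in> cylinder_sets G"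
  proof (rule cylinder_setsI[OF Int_lower2 D(1,2)])
    fix F F' assume F: "F \<subseteq> ?E" "F' \<subseteq> ?E" "F \<inter> D = F' \<inter> D" "F \<in> (\<lambda>F. ?E - F) -` A \<inter> Pow ?E"
    have eq: "(?E - F) \<inter> D = (?E - F') \<inter> D" using F(3) by blast
    from F(4) have "?E - F \<in> A" by (rule IntD1[THEN vimageD])
    then have "?E - F' \<in> A" unfolding D(3)[OF Diff_subset Diff_subset eq] .
    then show "F' \<in> (\<lambda>F. ?E - F) -` A \<inter> Pow ?E"
      using F(2) by (intro IntI vimageI2 PowI)
  qed
qed

theorem invariant_double_ray_decomposition:
  "\<exists>(M :: ((int \<times> int) set set \<times> (int \<times> int) set set) measure) R1 R2.
      random_spanning_double_ray square_grid M R1 \<and>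
      random_spanning_double_ray square_grid M R2 \<and>
      (AE \<omega> in M. \<forall>e\<in>edges square_grid. (e \<in> R1 \<omega>) \<noteq> (e \<in> R2 \<omega>)) \<and>
      invariant_measure Z2 (translate_pair Z2)
        (distr M (edge_space square_grid \<Otimes>\<^sub>M edge_space square_grid) (\<lambda>\<omega>. (R1 \<omega>, R2 \<omega>)))"
proof -
  interpret Z2: group Z2 by (rule group_Z2)
  let ?E = "edges square_grid"
  let ?S = "{(1, 0), (-1, 0), (0, 1), (0, -1)} :: (int \<times> int) set"
  have S: "?S \<subseteq> carrier Z2" by (simp add: carrier_Z2)
  have E: "?E = grid_edges_set" by (rule edges_square_grid)
  obtain M :: "real measure" and Z where us: "uniform_sequence M (residue_box 2 1) Z"
    and "\<forall>k. \<forall>\<omega>\<in>space M. reduce 2 k (Z (Suc k) \<omega>) = Z k \<omega>"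
    by (rule exE[OF odometer_exists[OF zero_less_one, of 2]], elim exE conjE) (rule that)
  then have red: "\<And>k \<omega>. \<omega> \<in> space M \<Longrightarrow> reduce 2 k (Z (Suc k) \<omega>) = Z k \<omega>" by simp
  interpret uniform_sequence M "residue_box 2 1" Z by (rule us)
  define X where "X \<omega> k = fst (Z k \<omega>) 0" for \<omega> k
  define Y where "Y \<omega> k = fst (Z k \<omega>) 1" for \<omega> k
  \<comment> \<open>Marks of the levels below \<open>k\<close> are determined by the residues of
    stage \<open>k\<close>; the remaining levels are left unmarked for now.\<close>
  define F where "F k b = red (\<lambda>u v. \<exists>j<k. marked_level j (fst b 0) (fst b 1) u v)"
    for k and b :: cell
  define R where "R \<omega> = red (marked (X \<omega>) (Y \<omega>))" for \<omega>
  have R_sub: "R \<omega> \<subseteq> ?E" for \<omega> unfolding R_def E by (rule red_subset)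
  have F_sub: "F k b \<subseteq> ?E" for k b unfolding F_def E by (rule red_subset)
  have adic: "3 ^ l dvd X \<omega> k - X \<omega> l" "3 ^ l dvd Y \<omega> k - Y \<omega> l" if "\<omega> \<in> space M" "l \<le> k" for \<omega> k l
  proof -
    have "2 * 3 ^ l dvd fst (Z k \<omega>) i - fst (Z l \<omega>) i" if "i < 2" for i
      by (rule reduce_sequence_cong[of 2 "\<lambda>k. Z k \<omega>", OF red[OF \<open>\<omega> \<in> space M\<close>] that \<open>l \<le> k\<close>])
    from this[of 0, THEN dvd_mult_right] this[of 1, THEN dvd_mult_right]
    show "3 ^ l dvd X \<omega> k - X \<omega> l" "3 ^ l dvd Y \<omega> k - Y \<omega> l" by (simp_all add: X_def Y_def)
  qed
  have FZ: "F k (Z k \<omega>) = red (\<lambda>u v. \<exists>j<k. marked_level j (X \<omega> (Suc j)) (Y \<omega> (Suc j)) u v)"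
    if "\<omega> \<in> space M" for k \<omega>
  proof -
    have "(\<exists>j<k. marked_level j (X \<omega> k) (Y \<omega> k) u v) \<longleftrightarrow>
        (\<exists>j<k. marked_level j (X \<omega> (Suc j)) (Y \<omega> (Suc j)) u v)" for u v
      using marked_level_cong[OF adic[OF that]] Suc_leI by blast
    then show ?thesis unfolding F_def X_def[symmetric] Y_def[symmetric] by (simp only:)
  qed
  have conv: "\<exists>K. \<forall>k\<ge>K. e \<in> F k (Z k \<omega>) \<longleftrightarrow> e \<in> R \<omega>" if \<omega>: "\<omega> \<in> space M" and e: "e \<in> ?E" for \<omega> e
  proof -
    let ?P = "\<lambda>k u v. \<exists>j<k. marked_level j (X \<omega> (Suc j)) (Y \<omega> (Suc j)) u v"
    have ev: "\<forall>\<^sub>F k in sequentially. ?P k u v \<longleftrightarrow> marked (X \<omega>) (Y \<omega>) u v" for u v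
    proof (cases "marked (X \<omega>) (Y \<omega>) u v")
      case True
      then obtain j where j: "marked_level j (X \<omega> (Suc j)) (Y \<omega> (Suc j)) u v" unfolding marked_def by blast
      show ?thesis unfolding eventually_sequentially
        by (rule exI[of _ "Suc j"]) (use j True in \<open>auto intro: exI[of _ j]\<close>)
    next
      case False
      then show ?thesis unfolding marked_def by simp
    qed
    have "\<forall>\<^sub>F k in sequentially. e \<in> F k (Z k \<omega>) \<longleftrightarrow> e \<in> R \<omega>"
    proof -
      from e consider x y where "e = {(x, y), (x + 1, y)}" | x y where "e = {(x, y), (x, y + 1)}"
        unfolding E grid_edges_set_def by blast
      then show ?thesis
      proof cases
        case 1
        from ev[of "x + 1" y] ev[of "x + 1" "y + 1"] show ?thesis
          unfolding 1 FZ[OF \<omega>] R_def horizontal_red_iff by eventually_elim simp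
      next
        case 2
        from ev[of x "y + 1"] ev[of "x + 1" "y + 1"] show ?thesis
          unfolding 2 FZ[OF \<omega>] R_def vertical_red_iff by eventually_elim simp
      qed
    qed
    then show ?thesis by (simp add: eventually_sequentially)
  qed
  have generic: "AE \<omega> in M. \<exists>k. \<not> int (3 ^ k) dvd h (fst (Z k \<omega>))"
    if i: "i < 2" and h: "\<And>a z. h (a(i := z)) - h a = z - a i" for i and h :: "(nat \<Rightarrow> int) \<Rightarrow> int"
  proof (rule AE_ex_not[where t = "\<lambda>k. k"])
    fix k :: nat
    show "3 ^ k * card {b \<in> residue_box 2 1 k. int (3 ^ k) dvd h (fst b)} \<le> card (residue_box 2 1 k)"
    proof (rule card_residue_class[OF i])
      show "int (3 ^ k) dvd h (a(i := z)) - h a - (z - a i)" for a z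
        unfolding h by simp
    qed simp_all
    show "k < 3 ^ k" by (rule power_gt_expt) simp
  qed
  \<comment> \<open>The second and third conditions serve red; the first and fourth are their
    counterparts with the coordinates exchanged, for blue.\<close>
  let ?generic = "\<lambda>\<omega> w. (\<exists>k. \<not> int (3 ^ k) dvd w + fst (Z k \<omega>) 0) \<and>
      (\<exists>k. \<not> int (3 ^ k) dvd w + fst (Z k \<omega>) 1) \<and>
      (\<exists>k. \<not> int (3 ^ k) dvd w + (2 * fst (Z k \<omega>) 0 + fst (Z k \<omega>) 1)) \<and>
      (\<exists>k. \<not> int (3 ^ k) dvd w + (2 * fst (Z k \<omega>) 1 + fst (Z k \<omega>) 0))"
  have "AE \<omega> in M. \<forall>w. ?generic \<omega> w"
    unfolding AE_all_countable
  proof (intro allI AE_conjI)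
    fix w :: int
    show "AE \<omega> in M. \<exists>k. \<not> int (3 ^ k) dvd w + fst (Z k \<omega>) 0"
      by (rule generic[of 0 "\<lambda>a. w + a 0"]) simp_all
    show "AE \<omega> in M. \<exists>k. \<not> int (3 ^ k) dvd w + fst (Z k \<omega>) 1"
      by (rule generic[of 1 "\<lambda>a. w + a 1"]) simp_all
    \<comment> \<open>The coordinate that is varied is the one with coefficient 1.\<close>
    show "AE \<omega> in M. \<exists>k. \<not> int (3 ^ k) dvd w + (2 * fst (Z k \<omega>) 0 + fst (Z k \<omega>) 1)"
      by (rule generic[of 1 "\<lambda>a. w + (2 * a 0 + a 1)"]) simp_all
    show "AE \<omega> in M. \<exists>k. \<not> int (3 ^ k) dvd w + (2 * fst (Z k \<omega>) 1 + fst (Z k \<omega>) 0)"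
      by (rule generic[of 0 "\<lambda>a. w + (2 * a 1 + a 0)"]) simp_all
  qed
  then have good: "AE \<omega> in M. spanning_double_ray square_grid (spanning_subgraph square_grid (R \<omega>)) \<and>
      spanning_double_ray square_grid (spanning_subgraph square_grid (?E - R \<omega>))"
  proof (rule AE_mp, intro AE_I2 impI)
    fix \<omega> assume \<omega>: "\<omega> \<in> space M" and gen: "\<forall>w. ?generic \<omega> w"
    have verts: "verts square_grid = UNIV" by (simp add: square_grid_def cayley_graph_def carrier_Z2)
    have pair: "\<exists>u\<in>UNIV. \<exists>v\<in>UNIV. e = {u, v}" if "e \<in> red Q" for e Q
      using that unfolding red_def by blast
    have "generic_adic_shifts (X \<omega>) (Y \<omega>)"
      by unfold_locales (use adic[OF \<omega> le_SucI[OF order_refl]] gen in \<open>simp_all add: X_def Y_def\<close>)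
    then interpret A: generic_adic_shifts "X \<omega>" "Y \<omega>" .
    have "generic_adic_shifts (Y \<omega>) (X \<omega>)"
      by unfold_locales (use adic[OF \<omega> le_SucI[OF order_refl]] gen in \<open>simp_all add: X_def Y_def\<close>)
    then interpret B: generic_adic_shifts "Y \<omega>" "X \<omega>" .
    have tr: "(\<lambda>u v. marked (X \<omega>) (Y \<omega>) v u) = marked (Y \<omega>) (X \<omega>)"
      by (intro ext) (rule marked_transpose)
    have blue: "(`) prod.swap ` red (marked (Y \<omega>) (X \<omega>)) = ?E - R \<omega>"
      using blue_eq[of "marked (X \<omega>) (Y \<omega>)", unfolded tr] by (simp only: E R_def)
    have "spanning_double_ray square_grid (spanning_subgraph square_grid ((`) (\<lambda>p. p) ` R \<omega>))"
      unfolding R_def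
    proof (rule double_ray_transfer[of _ UNIV])
      show "bij_betw (\<lambda>p. p) UNIV (verts square_grid)" by (simp add: verts bij_betw_def)
      show "(`) (\<lambda>p. p) ` red (marked (X \<omega>) (Y \<omega>)) \<subseteq> ?E" using R_sub[of \<omega>] by (simp add: R_def)
      show "card {u. {v, u} \<in> red (marked (X \<omega>) (Y \<omega>))} = 2" for v
        by (rule card_red_neighbours[where Q = "marked (X \<omega>) (Y \<omega>)", OF A.marked_not_adjacent_X A.marked_not_adjacent_Y])
    qed (use pair A.red_connected in blast)+
    moreover have "spanning_double_ray square_grid
        (spanning_subgraph square_grid ((`) prod.swap ` red (marked (Y \<omega>) (X \<omega>))))"
    proof (rule double_ray_transfer[of _ UNIV])
      show "bij_betw prod.swap UNIV (verts square_grid)" by (simp add: verts)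
      show "(`) prod.swap ` red (marked (Y \<omega>) (X \<omega>)) \<subseteq> ?E"
        unfolding blue by (rule Diff_subset)
      show "card {u. {v, u} \<in> red (marked (Y \<omega>) (X \<omega>))} = 2" for v
        by (rule card_red_neighbours[where Q = "marked (Y \<omega>) (X \<omega>)", OF B.marked_not_adjacent_X B.marked_not_adjacent_Y])
    qed (use pair B.red_connected in blast)+
    ultimately show "spanning_double_ray square_grid (spanning_subgraph square_grid (R \<omega>)) \<and>
      spanning_double_ray square_grid (spanning_subgraph square_grid (?E - R \<omega>))"
      unfolding blue by simp
  qed
  let ?N = "edge_space square_grid"
  have meas: "R \<in> M \<rightarrow>\<^sub>M ?N"
    by (rule measurable_limit[where F = F and R = R, OF R_sub F_sub conv])
  have transl: "translate Z2 g \<in> ?N \<rightarrow>\<^sub>M ?N" for g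
    unfolding square_grid_def by (rule Z2.measurable_translate[OF _ S]) (simp add: carrier_Z2)
  have invariant: "distr (distr M ?N R) ?N (translate Z2 g) = distr M ?N R" for g
  proof (rule invariant_limit[where F = F and R = R, OF R_sub F_sub conv _ transl])
    show "translate Z2 g -` A \<inter> Pow ?E \<in> cylinder_sets square_grid" if "A \<in> cylinder_sets square_grid" for A
      using Z2.translate_vimage_cylinder[OF _ S, of g A] that by (simp add: square_grid_def carrier_Z2)
    fix k
    obtain g0 g1 where g: "g = (g0, g1)" by (cases g)
    define v where "v i = (if i = 0 then g0 else g1)" for i :: nat
    let ?\<pi> = "\<lambda>(a, f). reduce 2 k (\<lambda>i. a i - v i, f)"
    have "bij_betw ?\<pi> (residue_box 2 1 k) (residue_box 2 1 k)"
      by (rule bij_betw_residue_box_shift) auto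
    moreover have "translate Z2 g (F k b) = F k (?\<pi> b)" for b
    proof -
      obtain a f where b: "b = (a, f)" by (cases b)
      have "marked_level j (fst (?\<pi> b) 0) (fst (?\<pi> b) 1) u w \<longleftrightarrow> marked_level j (a 0) (a 1) (u - g0) (w - g1)"
        if "j < k" for j u w
      proof -
        have dvd: "3 ^ Suc j dvd c mod (2 * 3 ^ k) - c" for c :: int
        proof -
          have "(3::int) ^ Suc j dvd 2 * 3 ^ k" using that by (intro dvd_mult le_imp_power_dvd) simp
          moreover have "2 * 3 ^ k dvd c mod (2 * 3 ^ k) - c" by (simp only: mod_eq_dvd_iff[symmetric] mod_mod_trivial)
          ultimately show ?thesis by (rule dvd_trans)
        qed
        from marked_level_cong[OF dvd[of "a 0 - g0"] dvd[of "a 1 - g1"], of u w]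
        show ?thesis by (simp add: b reduce_def v_def marked_level_shift)
      qed
      then show ?thesis unfolding F_def g translate_red by (simp add: b cong: conj_cong)
    qed
    ultimately show "\<exists>\<pi>. bij_betw \<pi> (residue_box 2 1 k) (residue_box 2 1 k) \<and>
        (\<forall>b\<in>residue_box 2 1 k. translate Z2 g (F k b) = F k (\<pi> b))" by blast
  qed
  \<comment> \<open>The pair is a measurable function of red that commutes with translations, so
    invariance of the law of red carries over to the joint law.\<close>
  let ?c = "\<lambda>F. (F, ?E - F)"
  let ?N2 = "?N \<Otimes>\<^sub>M ?N"
  note [measurable] = meas transl measurable_complement
  have c: "?c \<in> ?N \<rightarrow>\<^sub>M ?N2" by measurable
  have cR: "(\<lambda>\<omega>. (R \<omega>, ?E - R \<omega>)) \<in> M \<rightarrow>\<^sub>M ?N2" by measurable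
  have inv2: "invariant_measure Z2 (translate_pair Z2) (distr M ?N2 (\<lambda>\<omega>. (R \<omega>, ?E - R \<omega>)))"
  proof (rule invariant_measure_edge_spaceI)
    fix g :: "int \<times> int" assume g: "g \<in> carrier Z2"
    have "(\<lambda>p. (translate Z2 g (fst p), translate Z2 g (snd p))) \<in> ?N2 \<rightarrow>\<^sub>M ?N2" by measurable
    then show t2: "translate_pair Z2 g \<in> ?N2 \<rightarrow>\<^sub>M ?N2"
      by (simp add: translate_pair_def map_prod_def case_prod_beta')
    have "distr (distr M ?N2 (\<lambda>\<omega>. (R \<omega>, ?E - R \<omega>))) ?N2 (translate_pair Z2 g) =
        distr M ?N2 (\<lambda>\<omega>. ?c (translate Z2 g (R \<omega>)))"
      unfolding distr_distr[OF t2 cR]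
    proof (rule distr_cong)
      fix \<omega>
      have "translate Z2 g (?E - R \<omega>) = ?E - translate Z2 g (R \<omega>)"
        using Z2.translate_complement[OF g S, of "R \<omega>"] R_sub[of \<omega>] by (simp add: square_grid_def)
      then show "(translate_pair Z2 g \<circ> (\<lambda>\<omega>. (R \<omega>, ?E - R \<omega>))) \<omega> = ?c (translate Z2 g (R \<omega>))"
        by (simp add: translate_pair_def)
    qed simp_all
    also have "\<dots> = distr (distr (distr M ?N R) ?N (translate Z2 g)) ?N2 ?c"
      by (simp add: distr_distr[OF c] distr_distr[OF transl meas] comp_def)
    also have "\<dots> = distr M ?N2 (\<lambda>\<omega>. (R \<omega>, ?E - R \<omega>))"
      unfolding invariant by (simp add: distr_distr[OF c meas] comp_def)
    finally show "distr (distr M ?N2 (\<lambda>\<omega>. (R \<omega>, ?E - R \<omega>))) ?N2 (translate_pair Z2 g) =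
        distr M ?N2 (\<lambda>\<omega>. (R \<omega>, ?E - R \<omega>))" .
  qed
  \<comment> \<open>The sample space becomes the type of pairs of edge sets, with the two
    projections as random subgraphs.\<close>
  show ?thesis
  proof (rule push_forward_final[OF prob_space_axioms, where f = "\<lambda>\<omega>. (R \<omega>, ?E - R \<omega>)"])
    fix N :: "((int \<times> int) set set \<times> (int \<times> int) set set) measure"
    assume N: "prob_space N" "\<And>P. AE \<omega> in M. P (R \<omega>, ?E - R \<omega>) \<Longrightarrow> AE y in N. P y"
      "\<And>h (K :: (int \<times> int) set set measure). (\<lambda>\<omega>. h (R \<omega>, ?E - R \<omega>)) \<in> M \<rightarrow>\<^sub>M K \<Longrightarrow> h \<in> N \<rightarrow>\<^sub>M K"
      "\<And>h (K :: ((int \<times> int) set set \<times> (int \<times> int) set set) measure).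
        (\<lambda>\<omega>. h (R \<omega>, ?E - R \<omega>)) \<in> M \<rightarrow>\<^sub>M K \<Longrightarrow> distr N K h = distr M K (\<lambda>\<omega>. h (R \<omega>, ?E - R \<omega>))"
    have cm: "(\<lambda>\<omega>. ?E - R \<omega>) \<in> M \<rightarrow>\<^sub>M ?N" by measurable
    have "random_spanning_double_ray square_grid N fst"
      unfolding random_spanning_double_ray_def
      using N(1) N(3)[of fst ?N] meas N(2)[of "\<lambda>p. spanning_double_ray square_grid (spanning_subgraph square_grid (fst p))"] good
      by simp
    moreover have "random_spanning_double_ray square_grid N snd"
      unfolding random_spanning_double_ray_def
      using N(1) N(3)[of snd ?N] cm N(2)[of "\<lambda>p. spanning_double_ray square_grid (spanning_subgraph square_grid (snd p))"] good
      by simp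
    moreover have "AE p in N. \<forall>e\<in>?E. (e \<in> fst p) \<noteq> (e \<in> snd p)"
      by (rule N(2)) simp
    moreover have "distr N ?N2 (\<lambda>p. (fst p, snd p)) = distr M ?N2 (\<lambda>\<omega>. (R \<omega>, ?E - R \<omega>))"
      using N(4)[of "\<lambda>p. (fst p, snd p)" ?N2] cR by simp
    ultimately show ?thesis using inv2 by (intro exI[of _ N] exI[of _ fst] exI[of _ snd]) simp
  qed
qed

theorem theorem1:
  "(\<exists>(M :: ((int \<times> int) set set \<times> (int \<times> int) set set) measure) R1 R2.
      random_spanning_double_ray square_grid M R1 \<and>
      random_spanning_double_ray square_grid M R2 \<and>
      (AE \<omega> in M. \<forall>e\<in>edges square_grid. (e \<in> R1 \<omega>) \<noteq> (e \<in> R2 \<omega>)) \<and>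
      invariant_measure Z2 (translate_pair Z2)
        (distr M (edge_space square_grid \<Otimes>\<^sub>M edge_space square_grid) (\<lambda>\<omega>. (R1 \<omega>, R2 \<omega>))))
   \<and>
   (\<forall>(\<Gamma> :: ('g, 'r) monoid_scheme) S.
      comm_group \<Gamma> \<and> infinite (carrier \<Gamma>) \<and>
      S \<subseteq> carrier \<Gamma> \<and> (\<forall>s\<in>S. inv\<^bsub>\<Gamma>\<^esub> s \<in> S) \<and> \<one>\<^bsub>\<Gamma>\<^esub> \<notin> S \<and>
      graph_connected (cayley_graph \<Gamma> S) \<and> locally_finite (cayley_graph \<Gamma> S)
      \<longrightarrow>
      (\<exists>(M :: 'g set set measure) R.
         random_spanning_double_ray (cayley_graph \<Gamma> S) M R \<and>
         invariant_measure \<Gamma> (translate \<Gamma>) (distr M (edge_space (cayley_graph \<Gamma> S)) R)))"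
  using invariant_double_ray_decomposition comm_group.invariant_random_double_ray by blast

end
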